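(* Let $\mathcal C$ be a Markov category with enough states. Let $M$ be an open deterministic causal model in $\mathcal C$ over variables $V$ with $V^{\rm out}=V^{\rm nin}$, each of whose variables has at least one state in $\mathcal C$, with a set of interventions $\mathcal I$ containing the trivial intervention. Let $W$ be a further finite set of variables, with given objects of $\mathcal C$, input subset $W^{\rm in}$ and output subset $W^{\rm out}=W^{\rm nin}$, and suppose that $\rho\colon V\to W$ is a deterministic isomorphism which respects $(\mathcal I,M)$. Then $$(\rho,\hat\rho)\colon(\mathcal I^{\mathsf{io}},M)\to(\hat\rho(\mathcal I)^{\mathsf{io}},\rho(M))$$ defines a (bijective) upward abstraction. Explicitly, for all $\sigma\in\mathcal I$ we have $$\rho^{\rm nin}\circ(M_\sigma)^{\mathrm{io}}=\big(\rho(M)_{\hat\rho(\sigma)}\big)^{\mathrm{io}}\circ\rho^{\rm in}.$$ In particular $\rho^{\rm nin}\circ M^{\mathrm{io}}=\rho(M)^{\mathrm{io}}\circ\rho^{\rm in}$.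
   Context: **Categories.** A Markov category is a symmetric monoidal category with terminal unit $I$ in which each object has a commutative comonoid structure (copy, discard) compatible with $\otimes$. Morphisms are called channels; $f$ is deterministic if $\mathrm{copy}\circ f=(f\otimes f)\circ\mathrm{copy}$; a sharp state of $A$ is a deterministic morphism $I\to A$. $\mathcal C$ has enough states if $f\circ x=g\circ x$ for all sharp states $x$ implies $f=g$. **Causal models.** An open DAG is a finite DAG with vertex set $V$ and a subset $V^{\rm in}\subseteq V$ of parentless vertices (inputs); $V^{\rm nin}=V\setminus V^{\rm in}$. A causal model $M$ over it in $\mathcal C$ consists of an object of $\mathcal C$ (again written $X$) for each vertex $X$, a channel (mechanism) $c_X\colon\bigotimes_{Y\in\mathrm{Pa}(X)}Y\to X$ for each $X\in V^{\rm nin}$, and outputs $V^{\rm out}\subseteq V$; here always $V^{\rm out}=V^{\rm nin}$. It is deterministic if all $c_X$ are. A set of variables also denotes the tensor of the corresponding objects. $M^{\mathrm{io}}\colon V^{\rm in}\to V^{\rm out}$ is the channel obtained by wiring together all mechanisms with copy maps, copying each output variable once more to form an output (and discarding unused inputs). An intervention $\sigma$ on $M$ specifies new mechanisms $c'_X$ (possibly with new parents, but introducing no directed cycles) for a subset of variables $X\in V^{\rm nin}$, yielding a causal model $M_\sigma$ with the same variables, objects, inputs and outputs; here all $M_\sigma$ are deterministic. The trivial intervention changes nothing. **Parallel mechanism channel.** For $V=\{X_1,\dots,X_n\}$, $F_M\colon V\to V$ is the deterministic channel with $F_M=(F_{X_1}\otimes\dots\otimes F_{X_n})\circ\mathrm{copy}_V^{(n)}$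 (with $\mathrm{copy}_V^{(n)}\colon V\to V^{\otimes n}$ the $n$-fold copy), where for a non-input $X$, $F_X\colon V\to X$ is $c_X$ applied to $\mathrm{Pa}(X)$ with all other variables discarded, and for an input $X$, $F_X\colon V\to X$ is the projection $\mathrm{id}_X\otimes\mathrm{disc}$. **Model from a channel.** Conversely, for a deterministic channel $F\colon V\to V$ with marginals $F_X\colon V\to X$, declare $X$ an input if $F_X=\mathrm{id}_X\otimes\mathrm{disc}$; otherwise let $\mathrm{Pa}(X)$ be the least subset of variables, and $c_X\colon\mathrm{Pa}(X)\to X$ the corresponding channel, such that $F_X=c_X\otimes\mathrm{disc}$ (such a least subset exists). $F$ is acyclic if these parent sets define an acyclic directed graph; then $\mathsf M[F]$ denotes the resulting causal model with mechanisms $c_X$ (outputs being the non-inputs). **Induction.** A deterministic isomorphism $\rho\colon V\to W$ (meaning between the tensor products of all variables) respects $M$ if the channel $\rho\circ F_M\circ\rho^{-1}\colon W\to W$ is acyclic, with set of inputs exactly $W^{\rm in}$, and $\rho=\rho^{\rm in}\otimes\rho^{\rm nin}$ for isomorphisms $\rho^{\rm in}\colon V^{\rm in}\to W^{\rm in}$, $\rho^{\rm nin}\colon V^{\rm nin}\to W^{\rm nin}$. The induced model is then $\rho(M):=\mathsf M[\rho\circ F_M\circ\rho^{-1}]$. $\rho$ respects $(\mathcal I,M)$ if it respects $M_\sigma$ for each $\sigma\in\mathcal I$; in that case, for each $\sigma\in\mathcal I$, the induced intervention $\hat\rho(\sigma)$ on $\rho(M)$ is defined via $\rho(M)_{\hat\rho(\sigma)}:=\rho(M_\sigma)$,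 and $\hat\rho(\mathcal I)$ denotes the set of such interventions on $\rho(M)$. **Upward abstraction.** For a set $\mathcal I$ of interventions on a model $M$, $\mathcal I^{\mathsf{io}}$ is the query signature with two types $\mathsf{in},\mathsf{out}$ and a query $\sigma\colon\mathsf{in}\to\mathsf{out}$ for each $\sigma\in\mathcal I$, modelled by $[\![\mathsf{in}]\!]=V^{\rm in}$, $[\![\mathsf{out}]\!]=V^{\rm out}$, $[\![\sigma]\!]=M_\sigma^{\mathrm{io}}$. An upward abstraction $(\tau,\omega)\colon(\mathcal I_L^{\mathsf{io}},L)\to(\mathcal I_H^{\mathsf{io}},H)$ consists of epic deterministic channels $\tau^{\rm in}\colon V_L^{\rm in}\to V_H^{\rm in}$, $\tau^{\rm out}\colon V_L^{\rm out}\to V_H^{\rm out}$ (with epic tensor products) and a partial surjective map $\omega$ from $\mathcal I_L$ to $\mathcal I_H$ with $\tau^{\rm out}\circ L_\sigma^{\mathrm{io}}=H_{\omega(\sigma)}^{\mathrm{io}}\circ\tau^{\rm in}$ whenever $\omega(\sigma)$ is defined. In the claim, $\tau^{\rm in}=\rho^{\rm in}$, $\tau^{\rm out}=\rho^{\rm nin}$, $\omega=\hat\rho$; "bijective" refers to the map $\omega=\hat\rho\colon\mathcal I\to\hat\rho(\mathcal I)$.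
   Formalization: Interventions carry names, distinct within the set and kept by the induced map, because bare interventions with equal effect (e.g. redundant parents) can make it non-injective; also shown: induced mechanisms agree iff the intervened models have equal parallel mechanism channels. *)

theory Defs
  imports Main
begin

section \<open>Markov categories\<close>

text \<open>
  Categories are given by a carrier of objects and a carrier of arrows. The monoidal structure is
  not assumed to be strict: \<open>assoc A B C : (A \<boxtimes> B) \<boxtimes> C \<rightarrow> A \<boxtimes> (B \<boxtimes> C)\<close>, \<open>lunit A : I \<boxtimes> A \<rightarrow> A\<close>,
  \<open>runit A : A \<boxtimes> I \<rightarrow> A\<close> and \<open>symm A B : A \<boxtimes> B \<rightarrow> B \<boxtimes> A\<close>.
\<close>

record ('o, 'm) markov_data =
  Obj :: "'o set"
  Arr :: "'m set"
  Dom :: "'m \<Rightarrow> 'o"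
  Cod :: "'m \<Rightarrow> 'o"
  ident :: "'o \<Rightarrow> 'm"
  comp :: "'m \<Rightarrow> 'm \<Rightarrow> 'm"  (infixr "\<cdot>\<index>" 60)
  tens_obj :: "'o \<Rightarrow> 'o \<Rightarrow> 'o"  (infixr "\<boxtimes>\<index>" 75)
  tens_arr :: "'m \<Rightarrow> 'm \<Rightarrow> 'm"  (infixr "\<otimes>\<index>" 75)
  unit_obj :: 'o
  assoc :: "'o \<Rightarrow> 'o \<Rightarrow> 'o \<Rightarrow> 'm"
  lunit :: "'o \<Rightarrow> 'm"
  runit :: "'o \<Rightarrow> 'm"
  symm :: "'o \<Rightarrow> 'o \<Rightarrow> 'm"
  copy :: "'o \<Rightarrow> 'm"
  disc :: "'o \<Rightarrow> 'm"

definition hom :: "('o, 'm) markov_data \<Rightarrow> 'o \<Rightarrow> 'o \<Rightarrow> 'm set" where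
  "hom C A B = {f \<in> Arr C. Dom C f = A \<and> Cod C f = B}"

definition inverse_arrows :: "('o, 'm) markov_data \<Rightarrow> 'm \<Rightarrow> 'm \<Rightarrow> bool" where
  "inverse_arrows C f g \<longleftrightarrow>
     f \<in> Arr C \<and> g \<in> hom C (Cod C f) (Dom C f) \<and>
     g \<cdot>\<^bsub>C\<^esub> f = ident C (Dom C f) \<and> f \<cdot>\<^bsub>C\<^esub> g = ident C (Cod C f)"

definition iso :: "('o, 'm) markov_data \<Rightarrow> 'm \<Rightarrow> bool" where
  "iso C f \<longleftrightarrow> (\<exists>g. inverse_arrows C f g)"

definition inv_arr :: "('o, 'm) markov_data \<Rightarrow> 'm \<Rightarrow> 'm" where
  "inv_arr C f = (THE g. inverse_arrows C f g)"

definition epic :: "('o, 'm) markov_data \<Rightarrow> 'm \<Rightarrow> bool" where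
  "epic C f \<longleftrightarrow>
     f \<in> Arr C \<and>
     (\<forall>B\<in>Obj C. \<forall>g\<in>hom C (Cod C f) B. \<forall>h\<in>hom C (Cod C f) B.
        g \<cdot>\<^bsub>C\<^esub> f = h \<cdot>\<^bsub>C\<^esub> f \<longrightarrow> g = h)"

text \<open>The canonical arrow \<open>(A \<boxtimes> A) \<boxtimes> (B \<boxtimes> B) \<rightarrow> (A \<boxtimes> B) \<boxtimes> (A \<boxtimes> B)\<close>.\<close>

definition middle_swap :: "('o, 'm) markov_data \<Rightarrow> 'o \<Rightarrow> 'o \<Rightarrow> 'm" where
  "middle_swap C A B =
     inv_arr C (assoc C A B (A \<boxtimes>\<^bsub>C\<^esub> B)) \<cdot>\<^bsub>C\<^esub>
     (ident C A \<otimes>\<^bsub>C\<^esub> assoc C B A B) \<cdot>\<^bsub>C\<^esub>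
     (ident C A \<otimes>\<^bsub>C\<^esub> (symm C A B \<otimes>\<^bsub>C\<^esub> ident C B)) \<cdot>\<^bsub>C\<^esub>
     (ident C A \<otimes>\<^bsub>C\<^esub> inv_arr C (assoc C A B B)) \<cdot>\<^bsub>C\<^esub>
     assoc C A A (B \<boxtimes>\<^bsub>C\<^esub> B)"

locale category =
  fixes C :: "('o, 'm) markov_data" (structure)
  assumes Dom_Obj: "f \<in> Arr C \<Longrightarrow> Dom C f \<in> Obj C"
    and Cod_Obj: "f \<in> Arr C \<Longrightarrow> Cod C f \<in> Obj C"
    and ident_hom: "A \<in> Obj C \<Longrightarrow> ident C A \<in> hom C A A"
    and comp_hom: "\<lbrakk>f \<in> hom C A B; g \<in> hom C B D\<rbrakk> \<Longrightarrow> g \<cdot> f \<in> hom C A D"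
    and comp_ident_left: "f \<in> hom C A B \<Longrightarrow> ident C B \<cdot> f = f"
    and comp_ident_right: "f \<in> hom C A B \<Longrightarrow> f \<cdot> ident C A = f"
    and comp_assoc:
      "\<lbrakk>f \<in> hom C A B; g \<in> hom C B D; h \<in> hom C D E\<rbrakk> \<Longrightarrow> (h \<cdot> g) \<cdot> f = h \<cdot> (g \<cdot> f)"

locale monoidal_category = category +
  assumes unit_Obj: "unit_obj C \<in> Obj C"
    and tens_Obj: "\<lbrakk>A \<in> Obj C; B \<in> Obj C\<rbrakk> \<Longrightarrow> A \<boxtimes> B \<in> Obj C"
    and tens_hom:
      "\<lbrakk>f \<in> hom C A B; g \<in> hom C A' B'\<rbrakk> \<Longrightarrow> f \<otimes> g \<in> hom C (A \<boxtimes> A') (B \<boxtimes> B')"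
    and tens_ident:
      "\<lbrakk>A \<in> Obj C; B \<in> Obj C\<rbrakk> \<Longrightarrow> ident C A \<otimes> ident C B = ident C (A \<boxtimes> B)"
    and interchange:
      "\<lbrakk>f \<in> hom C A B; g \<in> hom C B D; f' \<in> hom C A' B'; g' \<in> hom C B' D'\<rbrakk>
       \<Longrightarrow> (g \<cdot> f) \<otimes> (g' \<cdot> f') = (g \<otimes> g') \<cdot> (f \<otimes> f')"
    and assoc_hom:
      "\<lbrakk>A \<in> Obj C; B \<in> Obj C; D \<in> Obj C\<rbrakk>
       \<Longrightarrow> assoc C A B D \<in> hom C ((A \<boxtimes> B) \<boxtimes> D) (A \<boxtimes> (B \<boxtimes> D))"
    and assoc_iso: "\<lbrakk>A \<in> Obj C; B \<in> Obj C; D \<in> Obj C\<rbrakk> \<Longrightarrow> iso C (assoc C A B D)"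
    and assoc_natural:
      "\<lbrakk>f \<in> hom C A A'; g \<in> hom C B B'; h \<in> hom C D D'\<rbrakk>
       \<Longrightarrow> assoc C A' B' D' \<cdot> ((f \<otimes> g) \<otimes> h) = (f \<otimes> (g \<otimes> h)) \<cdot> assoc C A B D"
    and lunit_hom: "A \<in> Obj C \<Longrightarrow> lunit C A \<in> hom C (unit_obj C \<boxtimes> A) A"
    and lunit_iso: "A \<in> Obj C \<Longrightarrow> iso C (lunit C A)"
    and lunit_natural:
      "f \<in> hom C A B \<Longrightarrow> lunit C B \<cdot> (ident C (unit_obj C) \<otimes> f) = f \<cdot> lunit C A"
    and runit_hom: "A \<in> Obj C \<Longrightarrow> runit C A \<in> hom C (A \<boxtimes> unit_obj C) A"
    and runit_iso: "A \<in> Obj C \<Longrightarrow> iso C (runit C A)"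
    and runit_natural:
      "f \<in> hom C A B \<Longrightarrow> runit C B \<cdot> (f \<otimes> ident C (unit_obj C)) = f \<cdot> runit C A"
    and pentagon:
      "\<lbrakk>A \<in> Obj C; B \<in> Obj C; D \<in> Obj C; E \<in> Obj C\<rbrakk>
       \<Longrightarrow> (ident C A \<otimes> assoc C B D E) \<cdot> assoc C A (B \<boxtimes> D) E \<cdot> (assoc C A B D \<otimes> ident C E)
         = assoc C A B (D \<boxtimes> E) \<cdot> assoc C (A \<boxtimes> B) D E"
    and triangle:
      "\<lbrakk>A \<in> Obj C; B \<in> Obj C\<rbrakk>
       \<Longrightarrow> (ident C A \<otimes> lunit C B) \<cdot> assoc C A (unit_obj C) B = runit C A \<otimes> ident C B"

locale symmetric_monoidal_category = monoidal_category +
  assumes symm_hom: "\<lbrakk>A \<in> Obj C; B \<in> Obj C\<rbrakk> \<Longrightarrow> symm C A B \<in> hom C (A \<boxtimes> B) (B \<boxtimes> A)"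
    and symm_natural:
      "\<lbrakk>f \<in> hom C A A'; g \<in> hom C B B'\<rbrakk>
       \<Longrightarrow> symm C A' B' \<cdot> (f \<otimes> g) = (g \<otimes> f) \<cdot> symm C A B"
    and symm_symm: "\<lbrakk>A \<in> Obj C; B \<in> Obj C\<rbrakk> \<Longrightarrow> symm C B A \<cdot> symm C A B = ident C (A \<boxtimes> B)"
    and hexagon:
      "\<lbrakk>A \<in> Obj C; B \<in> Obj C; D \<in> Obj C\<rbrakk>
       \<Longrightarrow> assoc C B D A \<cdot> symm C A (B \<boxtimes> D) \<cdot> assoc C A B D
         = (ident C B \<otimes> symm C A D) \<cdot> assoc C B A D \<cdot> (symm C A B \<otimes> ident C D)"

locale markov_category = symmetric_monoidal_category +
  assumes copy_hom: "A \<in> Obj C \<Longrightarrow> copy C A \<in> hom C A (A \<boxtimes> A)"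
    and disc_hom: "A \<in> Obj C \<Longrightarrow> disc C A \<in> hom C A (unit_obj C)"
    and unit_terminal: "f \<in> hom C A (unit_obj C) \<Longrightarrow> f = disc C A"
    and copy_coassoc:
      "A \<in> Obj C \<Longrightarrow>
       assoc C A A A \<cdot> (copy C A \<otimes> ident C A) \<cdot> copy C A = (ident C A \<otimes> copy C A) \<cdot> copy C A"
    and copy_counit_left:
      "A \<in> Obj C \<Longrightarrow> lunit C A \<cdot> (disc C A \<otimes> ident C A) \<cdot> copy C A = ident C A"
    and copy_counit_right:
      "A \<in> Obj C \<Longrightarrow> runit C A \<cdot> (ident C A \<otimes> disc C A) \<cdot> copy C A = ident C A"
    and copy_comm: "A \<in> Obj C \<Longrightarrow> symm C A A \<cdot> copy C A = copy C A"
    and copy_tens: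
      "\<lbrakk>A \<in> Obj C; B \<in> Obj C\<rbrakk>
       \<Longrightarrow> copy C (A \<boxtimes> B) = middle_swap C A B \<cdot> (copy C A \<otimes> copy C B)"
    and disc_tens:
      "\<lbrakk>A \<in> Obj C; B \<in> Obj C\<rbrakk>
       \<Longrightarrow> disc C (A \<boxtimes> B) = lunit C (unit_obj C) \<cdot> (disc C A \<otimes> disc C B)"

definition deterministic :: "('o, 'm) markov_data \<Rightarrow> 'm \<Rightarrow> bool" where
  "deterministic C f \<longleftrightarrow>
     f \<in> Arr C \<and> copy C (Cod C f) \<cdot>\<^bsub>C\<^esub> f = (f \<otimes>\<^bsub>C\<^esub> f) \<cdot>\<^bsub>C\<^esub> copy C (Dom C f)"

definition sharp_states :: "('o, 'm) markov_data \<Rightarrow> 'o \<Rightarrow> 'm set" where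
  "sharp_states C A = {x \<in> hom C (unit_obj C) A. deterministic C x}"

definition enough_states :: "('o, 'm) markov_data \<Rightarrow> bool" where
  "enough_states C \<longleftrightarrow>
     (\<forall>A\<in>Obj C. \<forall>B\<in>Obj C. \<forall>f\<in>hom C A B. \<forall>g\<in>hom C A B.
        (\<forall>x\<in>sharp_states C A. f \<cdot>\<^bsub>C\<^esub> x = g \<cdot>\<^bsub>C\<^esub> x) \<longrightarrow> f = g)"


section \<open>Finite tensor products and wiring\<close>

definition big_tens_obj :: "('o, 'm) markov_data \<Rightarrow> 'o list \<Rightarrow> 'o" where
  "big_tens_obj C As = foldr (tens_obj C) As (unit_obj C)"

definition big_tens_arr :: "('o, 'm) markov_data \<Rightarrow> 'm list \<Rightarrow> 'm" where
  "big_tens_arr C fs = foldr (tens_arr C) fs (ident C (unit_obj C))"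

text \<open>\<open>ncopy C A n : A \<rightarrow> A \<boxtimes> (\<dots> \<boxtimes> (A \<boxtimes> I))\<close> with \<open>n\<close> factors \<open>A\<close>.\<close>

fun ncopy :: "('o, 'm) markov_data \<Rightarrow> 'o \<Rightarrow> nat \<Rightarrow> 'm" where
  "ncopy C A 0 = disc C A"
| "ncopy C A (Suc n) = (ident C A \<otimes>\<^bsub>C\<^esub> ncopy C A n) \<cdot>\<^bsub>C\<^esub> copy C A"

definition tuple :: "('o, 'm) markov_data \<Rightarrow> 'o \<Rightarrow> 'm list \<Rightarrow> 'm" where
  "tuple C A fs = big_tens_arr C fs \<cdot>\<^bsub>C\<^esub> ncopy C A (length fs)"

text \<open>
  In \<open>proj\<close> and \<open>restr\<close>, the wires are labelled by variables, and the function \<open>ob\<close> assigns an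
  object to each of them. The channel \<open>proj C ob xs y\<close> keeps the wire \<open>y\<close> of a product of the wires
  \<open>xs\<close> and discards the others. For distinct \<open>xs\<close> and \<open>ys\<close> with \<open>set ys \<subseteq> set xs\<close>, the comonoid laws
  make \<open>restr C ob xs ys\<close> the channel that discards the wires outside \<open>ys\<close> and permutes the
  remaining ones into the order \<open>ys\<close>.
\<close>

fun proj :: "('o, 'm) markov_data \<Rightarrow> ('v \<Rightarrow> 'o) \<Rightarrow> 'v list \<Rightarrow> 'v \<Rightarrow> 'm" where
  "proj C ob [] y = undefined"
| "proj C ob (x # xs) y =
     (if y = x
      then runit C (ob x) \<cdot>\<^bsub>C\<^esub> (ident C (ob x) \<otimes>\<^bsub>C\<^esub> disc C (big_tens_obj C (map ob xs)))
      else lunit C (ob y) \<cdot>\<^bsub>C\<^esub> (disc C (ob x) \<otimes>\<^bsub>C\<^esub> proj C ob xs y))"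

definition restr :: "('o, 'm) markov_data \<Rightarrow> ('v \<Rightarrow> 'o) \<Rightarrow> 'v list \<Rightarrow> 'v list \<Rightarrow> 'm" where
  "restr C ob xs ys = tuple C (big_tens_obj C (map ob xs)) (map (proj C ob xs) ys)"


section \<open>Open causal models\<close>

record ('v, 'o) variables =
  vars :: "'v set"
  ins :: "'v set"
  outs :: "'v set"
  ob :: "'v \<Rightarrow> 'o"

record ('v, 'o, 'm) causal_model = "('v, 'o) variables" +
  pa :: "'v \<Rightarrow> 'v set"
  mech :: "'v \<Rightarrow> 'm"

definition nin :: "('v, 'o, 'z) variables_scheme \<Rightarrow> 'v set" where
  "nin V = vars V - ins V"

definition is_variables :: "('o, 'm) markov_data \<Rightarrow> ('v, 'o, 'z) variables_scheme \<Rightarrow> bool" where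
  "is_variables C V \<longleftrightarrow>
     finite (vars V) \<and> ins V \<subseteq> vars V \<and> outs V \<subseteq> vars V \<and> ob V ` vars V \<subseteq> Obj C"

text \<open>
  The order on the type of variables only serves to write the tensor product over a finite set of
  variables as an iterated binary one. A set \<open>S\<close> of variables of \<open>V\<close> denotes the object \<open>tens C V S\<close>.
\<close>

abbreviation enum :: "'v::linorder set \<Rightarrow> 'v list" where
  "enum \<equiv> sorted_list_of_set"

definition tens :: "('o, 'm) markov_data \<Rightarrow> ('v::linorder, 'o, 'z) variables_scheme \<Rightarrow> 'v set \<Rightarrow> 'o"
  where "tens C V S = big_tens_obj C (map (ob V) (enum S))"

definition marg :: "('o, 'm) markov_data \<Rightarrow> ('v::linorder, 'o, 'z) variables_scheme \<Rightarrow> 'v \<Rightarrow> 'm"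
  where "marg C V X = proj C (ob V) (enum (vars V)) X"

definition margs :: "('o, 'm) markov_data \<Rightarrow> ('v::linorder, 'o, 'z) variables_scheme \<Rightarrow> 'v set \<Rightarrow> 'm"
  where "margs C V S = restr C (ob V) (enum (vars V)) (enum S)"

text \<open>
  The canonical isomorphism from the product of all variables to the product of the inputs tensored
  with the product of the non-inputs.
\<close>

definition split_in :: "('o, 'm) markov_data \<Rightarrow> ('v::linorder, 'o, 'z) variables_scheme \<Rightarrow> 'm"
  where "split_in C V =
    (margs C V (ins V) \<otimes>\<^bsub>C\<^esub> margs C V (nin V)) \<cdot>\<^bsub>C\<^esub> copy C (tens C V (vars V))"

definition is_causal_model ::
    "('o, 'm) markov_data \<Rightarrow> ('v::linorder, 'o, 'm) causal_model \<Rightarrow> bool" where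
  "is_causal_model C M \<longleftrightarrow>
     is_variables C M \<and>
     (\<forall>X\<in>vars M. pa M X \<subseteq> vars M) \<and>
     (\<forall>X\<in>ins M. pa M X = {}) \<and>
     acyclic {(Y, X). X \<in> vars M \<and> Y \<in> pa M X} \<and>
     (\<forall>X\<in>nin M. mech M X \<in> hom C (tens C M (pa M X)) (ob M X))"

definition deterministic_model ::
    "('o, 'm) markov_data \<Rightarrow> ('v, 'o, 'm) causal_model \<Rightarrow> bool" where
  "deterministic_model C M \<longleftrightarrow> (\<forall>X\<in>nin M. deterministic C (mech M X))"

text \<open>
  \<open>run C M xs Xs\<close> applies the mechanisms of the variables \<open>Xs\<close> one after the other. Starting from the
  wires \<open>xs\<close>, each mechanism is fed with copies of its parents and puts its result in front, so
  that the final wires are \<open>rev Xs @ xs\<close>.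
\<close>

fun run :: "('o, 'm) markov_data \<Rightarrow> ('v::linorder, 'o, 'm) causal_model \<Rightarrow> 'v list \<Rightarrow> 'v list \<Rightarrow> 'm"
  where
  "run C M xs [] = ident C (big_tens_obj C (map (ob M) xs))"
| "run C M xs (X # Xs) =
     run C M (X # xs) Xs \<cdot>\<^bsub>C\<^esub>
     ((mech M X \<cdot>\<^bsub>C\<^esub> restr C (ob M) xs (enum (pa M X)))
       \<otimes>\<^bsub>C\<^esub> ident C (big_tens_obj C (map (ob M) xs))) \<cdot>\<^bsub>C\<^esub>
     copy C (big_tens_obj C (map (ob M) xs))"

definition topological_order :: "('v, 'o, 'm) causal_model \<Rightarrow> 'v list \<Rightarrow> bool" where
  "topological_order M Xs \<longleftrightarrow>
     distinct Xs \<and> set Xs = nin M \<and>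
     (\<forall>i<length Xs. pa M (Xs ! i) \<subseteq> ins M \<union> set (take i Xs))"

text \<open>The channel of the wiring diagram does not depend on the chosen topological order.\<close>

definition io :: "('o, 'm) markov_data \<Rightarrow> ('v::linorder, 'o, 'm) causal_model \<Rightarrow> 'm" where
  "io C M =
     (let Xs = (SOME Xs. topological_order M Xs)
      in restr C (ob M) (rev Xs @ enum (ins M)) (enum (outs M)) \<cdot>\<^bsub>C\<^esub> run C M (enum (ins M)) Xs)"

definition par_comp :: "('o, 'm) markov_data \<Rightarrow> ('v::linorder, 'o, 'm) causal_model \<Rightarrow> 'v \<Rightarrow> 'm"
  where "par_comp C M X =
    (if X \<in> ins M then marg C M X else mech M X \<cdot>\<^bsub>C\<^esub> margs C M (pa M X))"

definition par :: "('o, 'm) markov_data \<Rightarrow> ('v::linorder, 'o, 'm) causal_model \<Rightarrow> 'm" where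
  "par C M = tuple C (tens C M (vars M)) (map (par_comp C M) (enum (vars M)))"


section \<open>Interventions\<close>

text \<open>
  An intervention consists of a name and of the new parents and mechanisms that it specifies.
  The name lets members of a set of interventions, which name the queries of a signature, be told
  apart when they specify the same mechanisms.
\<close>

record ('s, 'v, 'm) intervention =
  name :: 's
  new_mech :: "'v \<rightharpoonup> 'v set \<times> 'm"

definition intervene ::
    "('v, 'o, 'm) causal_model \<Rightarrow> ('s, 'v, 'm) intervention \<Rightarrow> ('v, 'o, 'm) causal_model" where
  "intervene M \<sigma> = M
     \<lparr>pa := (\<lambda>X. case new_mech \<sigma> X of None \<Rightarrow> pa M X | Some (P, c) \<Rightarrow> P),
      mech := (\<lambda>X. case new_mech \<sigma> X of None \<Rightarrow> mech M X | Some (P, c) \<Rightarrow> c)\<rparr>"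

definition is_intervention ::
    "('o, 'm) markov_data \<Rightarrow> ('v::linorder, 'o, 'm) causal_model \<Rightarrow> ('s, 'v, 'm) intervention \<Rightarrow> bool"
  where "is_intervention C M \<sigma> \<longleftrightarrow>
     dom (new_mech \<sigma>) \<subseteq> nin M \<and>
     is_causal_model C (intervene M \<sigma>) \<and> deterministic_model C (intervene M \<sigma>)"

definition intervention_set ::
    "('o, 'm) markov_data \<Rightarrow> ('v::linorder, 'o, 'm) causal_model \<Rightarrow>
     ('s, 'v, 'm) intervention set \<Rightarrow> bool" where
  "intervention_set C M \<I> \<longleftrightarrow> (\<forall>\<sigma>\<in>\<I>. is_intervention C M \<sigma>) \<and> inj_on name \<I>"

definition trivial :: "('s, 'v, 'm) intervention \<Rightarrow> bool" where
  "trivial \<sigma> \<longleftrightarrow> new_mech \<sigma> = Map.empty"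


section \<open>The model of a channel, and induced models\<close>

definition chan_ins ::
    "('o, 'm) markov_data \<Rightarrow> ('v::linorder, 'o, 'z) variables_scheme \<Rightarrow> 'm \<Rightarrow> 'v set" where
  "chan_ins C V F = {X \<in> vars V. marg C V X \<cdot>\<^bsub>C\<^esub> F = marg C V X}"

definition factors_via ::
    "('o, 'm) markov_data \<Rightarrow> ('v::linorder, 'o, 'z) variables_scheme \<Rightarrow> 'm \<Rightarrow> 'v \<Rightarrow>
     'v set \<Rightarrow> 'm \<Rightarrow> bool" where
  "factors_via C V F X P c \<longleftrightarrow>
     P \<subseteq> vars V \<and> c \<in> hom C (tens C V P) (ob V X) \<and> marg C V X \<cdot>\<^bsub>C\<^esub> F = c \<cdot>\<^bsub>C\<^esub> margs C V P"

definition chan_pa ::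
    "('o, 'm) markov_data \<Rightarrow> ('v::linorder, 'o, 'z) variables_scheme \<Rightarrow> 'm \<Rightarrow> 'v \<Rightarrow> 'v set" where
  "chan_pa C V F X = (LEAST P. \<exists>c. factors_via C V F X P c)"

definition chan_mech ::
    "('o, 'm) markov_data \<Rightarrow> ('v::linorder, 'o, 'z) variables_scheme \<Rightarrow> 'm \<Rightarrow> 'v \<Rightarrow> 'm" where
  "chan_mech C V F X = (THE c. factors_via C V F X (chan_pa C V F X) c)"

definition acyclic_chan ::
    "('o, 'm) markov_data \<Rightarrow> ('v::linorder, 'o, 'z) variables_scheme \<Rightarrow> 'm \<Rightarrow> bool" where
  "acyclic_chan C V F \<longleftrightarrow>
     acyclic {(Y, X). X \<in> vars V - chan_ins C V F \<and> Y \<in> chan_pa C V F X}"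

definition chan_model ::
    "('o, 'm) markov_data \<Rightarrow> ('v::linorder, 'o, 'z) variables_scheme \<Rightarrow> 'm \<Rightarrow>
     ('v, 'o, 'm) causal_model" where
  "chan_model C V F =
     \<lparr>vars = vars V, ins = chan_ins C V F, outs = vars V - chan_ins C V F, ob = ob V,
      pa = (\<lambda>X. if X \<in> vars V - chan_ins C V F then chan_pa C V F X else {}),
      mech = (\<lambda>X. if X \<in> vars V - chan_ins C V F then chan_mech C V F X else undefined)\<rparr>"

definition conj_chan ::
    "('o, 'm) markov_data \<Rightarrow> 'm \<Rightarrow> ('v::linorder, 'o, 'm) causal_model \<Rightarrow> 'm" where
  "conj_chan C \<rho> M = \<rho> \<cdot>\<^bsub>C\<^esub> par C M \<cdot>\<^bsub>C\<^esub> inv_arr C \<rho>"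

definition det_iso ::
    "('o, 'm) markov_data \<Rightarrow> ('v::linorder, 'o, 'y) variables_scheme \<Rightarrow>
     ('w::linorder, 'o, 'z) variables_scheme \<Rightarrow> 'm \<Rightarrow> bool" where
  "det_iso C V W \<rho> \<longleftrightarrow>
     \<rho> \<in> hom C (tens C V (vars V)) (tens C W (vars W)) \<and> iso C \<rho> \<and> deterministic C \<rho>"

text \<open>\<open>decomposes C V W \<rho> \<rho>in \<rho>nin\<close> says that \<open>\<rho> = \<rho>in \<otimes> \<rho>nin\<close>, up to \<^const>\<open>split_in\<close>.\<close>

definition decomposes ::
    "('o, 'm) markov_data \<Rightarrow> ('v::linorder, 'o, 'y) variables_scheme \<Rightarrow>
     ('w::linorder, 'o, 'z) variables_scheme \<Rightarrow> 'm \<Rightarrow> 'm \<Rightarrow> 'm \<Rightarrow> bool" where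
  "decomposes C V W \<rho> \<rho>in \<rho>nin \<longleftrightarrow>
     \<rho>in \<in> hom C (tens C V (ins V)) (tens C W (ins W)) \<and> iso C \<rho>in \<and>
     \<rho>nin \<in> hom C (tens C V (nin V)) (tens C W (nin W)) \<and> iso C \<rho>nin \<and>
     split_in C W \<cdot>\<^bsub>C\<^esub> \<rho> = (\<rho>in \<otimes>\<^bsub>C\<^esub> \<rho>nin) \<cdot>\<^bsub>C\<^esub> split_in C V"

definition respects_model ::
    "('o, 'm) markov_data \<Rightarrow> ('w::linorder, 'o) variables \<Rightarrow> 'm \<Rightarrow>
     ('v::linorder, 'o, 'm) causal_model \<Rightarrow> bool" where
  "respects_model C W \<rho> M \<longleftrightarrow>
     det_iso C M W \<rho> \<and>
     acyclic_chan C W (conj_chan C \<rho> M) \<and> chan_ins C W (conj_chan C \<rho> M) = ins W \<and>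
     (\<exists>\<rho>in \<rho>nin. decomposes C M W \<rho> \<rho>in \<rho>nin)"

definition respects_set ::
    "('o, 'm) markov_data \<Rightarrow> ('w::linorder, 'o) variables \<Rightarrow> 'm \<Rightarrow>
     ('s, 'v, 'm) intervention set \<Rightarrow> ('v::linorder, 'o, 'm) causal_model \<Rightarrow> bool" where
  "respects_set C W \<rho> \<I> M \<longleftrightarrow> (\<forall>\<sigma>\<in>\<I>. respects_model C W \<rho> (intervene M \<sigma>))"

definition ind_model ::
    "('o, 'm) markov_data \<Rightarrow> ('w::linorder, 'o) variables \<Rightarrow> 'm \<Rightarrow>
     ('v::linorder, 'o, 'm) causal_model \<Rightarrow> ('w, 'o, 'm) causal_model" where
  "ind_model C W \<rho> M = chan_model C W (conj_chan C \<rho> M)"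

text \<open>
  The induced intervention keeps the name and specifies precisely those mechanisms of the model
  induced by \<open>intervene M \<sigma>\<close> that differ from the ones of the model induced by \<open>M\<close>.
\<close>

definition ind_intervention ::
    "('o, 'm) markov_data \<Rightarrow> ('w::linorder, 'o) variables \<Rightarrow> 'm \<Rightarrow>
     ('v::linorder, 'o, 'm) causal_model \<Rightarrow> ('s, 'v, 'm) intervention \<Rightarrow> ('s, 'w, 'm) intervention"
  where "ind_intervention C W \<rho> M \<sigma> =
    (let H = ind_model C W \<rho> M; N = ind_model C W \<rho> (intervene M \<sigma>)
     in \<lparr>name = name \<sigma>,
         new_mech = (\<lambda>X. if X \<in> nin W \<and> (pa N X, mech N X) \<noteq> (pa H X, mech H X)
                         then Some (pa N X, mech N X) else None)\<rparr>)"


section \<open>Input-output queries and upward abstractions\<close>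

datatype io_type = In | Out

text \<open>
  A signature with types \<^const>\<open>In\<close>, \<^const>\<open>Out\<close> and queries of type \<open>In \<rightarrow> Out\<close>, together with its
  interpretation in a category.
\<close>

record ('q, 'o, 'm) io_signature =
  queries :: "'q set"
  sem_type :: "io_type \<Rightarrow> 'o"
  sem_query :: "'q \<Rightarrow> 'm"

definition io_sig ::
    "('o, 'm) markov_data \<Rightarrow> ('s, 'v, 'm) intervention set \<Rightarrow> ('v::linorder, 'o, 'm) causal_model \<Rightarrow>
     (('s, 'v, 'm) intervention, 'o, 'm) io_signature" where
  "io_sig C \<I> M =
     \<lparr>queries = \<I>,
      sem_type = (\<lambda>t. case t of In \<Rightarrow> tens C M (ins M) | Out \<Rightarrow> tens C M (outs M)),
      sem_query = (\<lambda>\<sigma>. io C (intervene M \<sigma>))\<rparr>"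

definition upward_abstraction ::
    "('o, 'm) markov_data \<Rightarrow> ('q, 'o, 'm) io_signature \<Rightarrow> ('r, 'o, 'm) io_signature \<Rightarrow>
     (io_type \<Rightarrow> 'm) \<Rightarrow> ('q \<rightharpoonup> 'r) \<Rightarrow> bool" where
  "upward_abstraction C L H \<tau> \<omega> \<longleftrightarrow>
     (\<forall>t. \<tau> t \<in> hom C (sem_type L t) (sem_type H t) \<and> epic C (\<tau> t) \<and> deterministic C (\<tau> t)) \<and>
     (\<forall>ts. epic C (big_tens_arr C (map \<tau> ts))) \<and>
     dom \<omega> \<subseteq> queries L \<and> ran \<omega> = queries H \<and>
     (\<forall>\<sigma> \<sigma>'. \<omega> \<sigma> = Some \<sigma>' \<longrightarrow>
        \<tau> Out \<cdot>\<^bsub>C\<^esub> sem_query L \<sigma> = sem_query H \<sigma>' \<cdot>\<^bsub>C\<^esub> \<tau> In)"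

end

theory Submission
  imports Defs
begin

text \<open>
  Since there are enough states, channels may be compared on sharp states, and a sharp state of a
  finite product is determined by its components. Call a sharp state \<open>u\<close> of the product of all
  variables a solution of a model \<open>M\<close> if \<open>F\<^sub>M \<circ> u =
    u\<close>. By acyclicity every sharp state of the inputs
  extends to exactly one solution, and \<open>M\<^sup>i\<^sup>o\<close> sends it to the non-input part of that solution.
  Conjugation by \<open>\<rho>\<close> turns solutions of \<open>M\<close> into solutions of \<open>\<rho>(M)\<close>, and \<open>\<rho> = \<rho>in \<otimes> \<rho>nin\<close> acts
  separately on the two parts; the claim follows. Least parent sets exist because, when every
  variable has a sharp state, two sets through which a channel factors may be intersected.
\<close>

section \<open>Coherence in monoidal categories\<close>

text \<open>Components forget the correlations of a general joint state, but a deterministic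
  \<open>s\<close> into \<open>A \<boxtimes> B\<close> is the pair of its components. Hence sharp
  states can be handled like elements and deterministic channels like functions, provided that the
  projections are themselves deterministic. These are built from the unitors of a monoidal structure
  that is not strict, so the determinism of \<open>lunit\<close> and \<open>runit\<close> has to be
  derived; the unit laws proved below serve this purpose.

  The detour through solutions is forced by \<rho>. The channel \<open>io\<close> evaluates
  mechanisms along a topological order, but \<rho> may mix the non-input variables with each other,
  so an order for \<open>M\<close> says nothing about an order for the induced model. The fixed
  point equation mentions no order and is carried along by conjugation.\<close>

context category
begin

lemma comp_Arr [simp]:
  assumes "f \<in> Arr C" "g \<in> Arr C" "Cod C f = Dom C g"
  shows "g \<cdot> f \<in> Arr C" "Dom C (g \<cdot> f) = Dom C f" "Cod C (g \<cdot> f) = Cod C g"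
  using comp_hom[of f "Dom C f" "Cod C f" g "Cod C g"] assms by (simp_all add: hom_def)

lemma comp_assoc_Arr [simp]:
  assumes "f \<in> Arr C" "g \<in> Arr C" "h \<in> Arr C" "Cod C f = Dom C g" "Cod C g = Dom C h"
  shows "(h \<cdot> g) \<cdot> f = h \<cdot> g \<cdot> f"
  using comp_assoc[of f "Dom C f" "Cod C f" g "Cod C g" h "Cod C h"] assms by (simp add: hom_def)

lemma ident_Arr [simp]:
  assumes "A \<in> Obj C"
  shows "ident C A \<in> Arr C" "Dom C (ident C A) = A" "Cod C (ident C A) = A"
  using ident_hom[OF assms] by (simp_all add: hom_def)

lemma comp_ident_Arr [simp]:
  assumes "f \<in> Arr C"
  shows "Cod C f = A \<Longrightarrow> ident C A \<cdot> f = f" "Dom C f = A \<Longrightarrow> f \<cdot> ident C A = f"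
  using comp_ident_left comp_ident_right assms by (auto simp: hom_def)

lemmas Dom_Cod_Obj [simp] = Dom_Obj Cod_Obj

lemma inverse_arrows_unique:
  assumes "inverse_arrows C f g" "inverse_arrows C f h"
  shows "g = h"
proof -
  have "g = g \<cdot> f \<cdot> h"
    using assms by (simp add: inverse_arrows_def hom_def)
  also have "\<dots> = (g \<cdot> f) \<cdot> h"
    using assms by (subst comp_assoc_Arr) (simp_all add: inverse_arrows_def hom_def)
  also have "\<dots> = h"
    using assms by (simp add: inverse_arrows_def hom_def)
  finally show ?thesis .
qed

lemma inverse_arrows_inv_arr:
  assumes "iso C f"
  shows "inverse_arrows C f (inv_arr C f)"
  using assms theI'[of "inverse_arrows C f"] inverse_arrows_unique
  unfolding iso_def inv_arr_def by blast

lemma inv_arr_props: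
  assumes "iso C f"
  shows "f \<in> Arr C" "inv_arr C f \<in> Arr C"
    "Dom C (inv_arr C f) = Cod C f" "Cod C (inv_arr C f) = Dom C f"
    "inv_arr C f \<cdot> f = ident C (Dom C f)" "f \<cdot> inv_arr C f = ident C (Cod C f)"
    "\<lbrakk>h \<in> Arr C; Cod C h = Dom C f\<rbrakk> \<Longrightarrow> inv_arr C f \<cdot> f \<cdot> h = h"
    "\<lbrakk>h \<in> Arr C; Cod C h = Cod C f\<rbrakk> \<Longrightarrow> f \<cdot> inv_arr C f \<cdot> h = h"
proof -
  note inv = inverse_arrows_inv_arr[OF assms, unfolded inverse_arrows_def hom_def, simplified]
  show *: "f \<in> Arr C" "inv_arr C f \<in> Arr C"
    "Dom C (inv_arr C f) = Cod C f" "Cod C (inv_arr C f) = Dom C f"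
    "inv_arr C f \<cdot> f = ident C (Dom C f)" "f \<cdot> inv_arr C f = ident C (Cod C f)"
    using inv by auto
  show "\<lbrakk>h \<in> Arr C; Cod C h = Dom C f\<rbrakk> \<Longrightarrow> inv_arr C f \<cdot> f \<cdot> h = h"
    using * comp_assoc_Arr[of h f "inv_arr C f"] by simp
  show "\<lbrakk>h \<in> Arr C; Cod C h = Cod C f\<rbrakk> \<Longrightarrow> f \<cdot> inv_arr C f \<cdot> h = h"
    using * comp_assoc_Arr[of h "inv_arr C f" f] by simp
qed

lemma iso_cancel_right:
  assumes "iso C f" "g \<in> Arr C" "h \<in> Arr C" "Dom C g = Cod C f" "Dom C h = Cod C f"
    "g \<cdot> f = h \<cdot> f"
  shows "g = h"
proof -
  have "(g \<cdot> f) \<cdot> inv_arr C f = (h \<cdot> f) \<cdot> inv_arr C f"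
    using assms(6) by simp
  then show ?thesis
    using assms(2-5) inv_arr_props[OF assms(1)] by simp
qed

lemma iso_cancel_left:
  assumes "iso C f" "g \<in> Arr C" "h \<in> Arr C" "Cod C g = Dom C f" "Cod C h = Dom C f"
    "f \<cdot> g = f \<cdot> h"
  shows "g = h"
proof -
  have "inv_arr C f \<cdot> f \<cdot> g = inv_arr C f \<cdot> f \<cdot> h"
    using assms(6) by simp
  then show ?thesis
    using assms(2-5) inv_arr_props[OF assms(1)] by simp
qed

lemma iso_epic: "iso C f \<Longrightarrow> epic C f"
  unfolding epic_def using iso_cancel_right inv_arr_props(1) by (auto simp: hom_def)

lemma iso_ident: "A \<in> Obj C \<Longrightarrow> iso C (ident C A)"
  unfolding iso_def inverse_arrows_def hom_def by (rule exI[of _ "ident C A"]) simp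

end

section \<open>Interchange, naturality of the structure arrows, and unit laws\<close>

context monoidal_category
begin

lemmas objs [simp] = unit_Obj tens_Obj

lemma tens_Arr [simp]:
  assumes "f \<in> Arr C" "g \<in> Arr C"
  shows "f \<otimes> g \<in> Arr C" "Dom C (f \<otimes> g) = Dom C f \<boxtimes> Dom C g"
    "Cod C (f \<otimes> g) = Cod C f \<boxtimes> Cod C g"
  using tens_hom[of f "Dom C f" "Cod C f" g "Dom C g" "Cod C g"] assms by (simp_all add: hom_def)

lemmas tens_ident' [simp] = tens_ident

lemma tens_comp [simp]:
  assumes "f \<in> Arr C" "g \<in> Arr C" "Cod C f = Dom C g"
    "f' \<in> Arr C" "g' \<in> Arr C" "Cod C f' = Dom C g'"
  shows "(g \<otimes> g') \<cdot> (f \<otimes> f') = (g \<cdot> f) \<otimes> (g' \<cdot> f')"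
  using interchange[of f "Dom C f" "Cod C f" g "Cod C g" f' "Dom C f'" "Cod C f'" g' "Cod C g'"]
    assms
  by (simp add: hom_def)

text \<open>\<open>comp_assoc_Arr\<close> keeps composites nested to the right, so two tensors
  meeting inside a longer composite are not the two arguments of one composition. This form lets the
  interchange law apply there as well.\<close>

lemma tens_comp_tail [simp]:
  assumes "f \<in> Arr C" "g \<in> Arr C" "Cod C f = Dom C g"
    "f' \<in> Arr C" "g' \<in> Arr C" "Cod C f' = Dom C g'"
    "h \<in> Arr C" "Cod C h = Dom C f \<boxtimes> Dom C f'"
  shows "(g \<otimes> g') \<cdot> (f \<otimes> f') \<cdot> h = ((g \<cdot> f) \<otimes> (g' \<cdot> f')) \<cdot> h"
  using assms by (simp flip: tens_comp)

lemma assoc_Arr [simp]: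
  assumes "A \<in> Obj C" "B \<in> Obj C" "D \<in> Obj C"
  shows "assoc C A B D \<in> Arr C" "Dom C (assoc C A B D) = (A \<boxtimes> B) \<boxtimes> D"
    "Cod C (assoc C A B D) = A \<boxtimes> (B \<boxtimes> D)"
  using assoc_hom[OF assms] by (simp_all add: hom_def)

lemma lunit_Arr [simp]:
  assumes "A \<in> Obj C"
  shows "lunit C A \<in> Arr C" "Dom C (lunit C A) = unit_obj C \<boxtimes> A" "Cod C (lunit C A) = A"
  using lunit_hom[OF assms] by (simp_all add: hom_def)

lemma runit_Arr [simp]:
  assumes "A \<in> Obj C"
  shows "runit C A \<in> Arr C" "Dom C (runit C A) = A \<boxtimes> unit_obj C" "Cod C (runit C A) = A"
  using runit_hom[OF assms] by (simp_all add: hom_def)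

lemma inv_assoc_Arr [simp]:
  assumes "A \<in> Obj C" "B \<in> Obj C" "D \<in> Obj C"
  shows "inv_arr C (assoc C A B D) \<in> Arr C"
    "Dom C (inv_arr C (assoc C A B D)) = A \<boxtimes> (B \<boxtimes> D)"
    "Cod C (inv_arr C (assoc C A B D)) = (A \<boxtimes> B) \<boxtimes> D"
    "inv_arr C (assoc C A B D) \<cdot> assoc C A B D = ident C ((A \<boxtimes> B) \<boxtimes> D)"
    "assoc C A B D \<cdot> inv_arr C (assoc C A B D) = ident C (A \<boxtimes> (B \<boxtimes> D))"
    "\<lbrakk>h \<in> Arr C; Cod C h = (A \<boxtimes> B) \<boxtimes> D\<rbrakk> \<Longrightarrow> inv_arr C (assoc C A B D) \<cdot> assoc C A B D \<cdot> h = h"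
    "\<lbrakk>h \<in> Arr C; Cod C h = A \<boxtimes> (B \<boxtimes> D)\<rbrakk> \<Longrightarrow> assoc C A B D \<cdot> inv_arr C (assoc C A B D) \<cdot> h = h"
  using inv_arr_props[OF assoc_iso[OF assms]] assms by simp_all

lemma assoc_natural_Arr:
  assumes "f \<in> Arr C" "g \<in> Arr C" "h \<in> Arr C"
  shows "assoc C (Cod C f) (Cod C g) (Cod C h) \<cdot> ((f \<otimes> g) \<otimes> h) =
    (f \<otimes> (g \<otimes> h)) \<cdot> assoc C (Dom C f) (Dom C g) (Dom C h)"
  using assoc_natural[of f "Dom C f" "Cod C f" g "Dom C g" "Cod C g" h "Dom C h" "Cod C h"] assms
  by (simp add: hom_def)

lemma inv_assoc_natural:
  assumes "f \<in> Arr C" "g \<in> Arr C" "h \<in> Arr C"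
  shows "inv_arr C (assoc C (Cod C f) (Cod C g) (Cod C h)) \<cdot> (f \<otimes> (g \<otimes> h)) =
    ((f \<otimes> g) \<otimes> h) \<cdot> inv_arr C (assoc C (Dom C f) (Dom C g) (Dom C h))"
proof (rule iso_cancel_left[OF assoc_iso])
  show "assoc C (Cod C f) (Cod C g) (Cod C h) \<cdot>
    inv_arr C (assoc C (Cod C f) (Cod C g) (Cod C h)) \<cdot> (f \<otimes> (g \<otimes> h)) =
    assoc C (Cod C f) (Cod C g) (Cod C h) \<cdot> ((f \<otimes> g) \<otimes> h) \<cdot>
      inv_arr C (assoc C (Dom C f) (Dom C g) (Dom C h))"
  proof -
    have "assoc C (Cod C f) (Cod C g) (Cod C h) \<cdot> ((f \<otimes> g) \<otimes> h) \<cdot>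
      inv_arr C (assoc C (Dom C f) (Dom C g) (Dom C h))
      = (assoc C (Cod C f) (Cod C g) (Cod C h) \<cdot> ((f \<otimes> g) \<otimes> h)) \<cdot>
        inv_arr C (assoc C (Dom C f) (Dom C g) (Dom C h))"
      using assms by (subst comp_assoc_Arr) simp_all
    then show ?thesis
      using assms by (simp add: assoc_natural_Arr)
  qed
qed (use assms in simp_all)

lemma lunit_natural_Arr:
  assumes "f \<in> Arr C"
  shows "lunit C (Cod C f) \<cdot> (ident C (unit_obj C) \<otimes> f) = f \<cdot> lunit C (Dom C f)"
  using lunit_natural[of f "Dom C f" "Cod C f"] assms by (simp add: hom_def)

lemma runit_natural_Arr:
  assumes "f \<in> Arr C"
  shows "runit C (Cod C f) \<cdot> (f \<otimes> ident C (unit_obj C)) = f \<cdot> runit C (Dom C f)"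
  using runit_natural[of f "Dom C f" "Cod C f"] assms by (simp add: hom_def)

text \<open>Naturality of \<open>lunit\<close> turns the hypothesis into an equation between
  \<open>f\<close> and \<open>g\<close> precomposed with \<open>lunit C (Dom C g)\<close>, which is
  invertible.\<close>

lemma unit_tens_cancel:
  assumes "f \<in> Arr C" "g \<in> Arr C" "Dom C f = Dom C g" "Cod C f = Cod C g"
    "ident C (unit_obj C) \<otimes> f = ident C (unit_obj C) \<otimes> g"
  shows "f = g"
proof (rule iso_cancel_right[OF lunit_iso])
  show "f \<cdot> lunit C (Dom C g) = g \<cdot> lunit C (Dom C g)"
    using assms lunit_natural_Arr[of f] lunit_natural_Arr[of g] by simp
qed (use assms in simp_all)

lemma tens_unit_cancel:
  assumes "f \<in> Arr C" "g \<in> Arr C" "Dom C f = Dom C g" "Cod C f = Cod C g"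
    "f \<otimes> ident C (unit_obj C) = g \<otimes> ident C (unit_obj C)"
  shows "f = g"
proof (rule iso_cancel_right[OF runit_iso])
  show "f \<cdot> runit C (Dom C g) = g \<cdot> runit C (Dom C g)"
    using assms runit_natural_Arr[of f] runit_natural_Arr[of g] by simp
qed (use assms in simp_all)

lemma iso_tens:
  assumes "iso C f" "iso C g"
  shows "iso C (f \<otimes> g)"
  unfolding iso_def inverse_arrows_def hom_def
  by (rule exI[of _ "inv_arr C f \<otimes> inv_arr C g"])
    (simp add: inv_arr_props[OF assms(1)] inv_arr_props[OF assms(2)])

text \<open>The three unit laws below are Kelly's consequences of the axioms. Tensoring with the unit is
  faithful, so it suffices to prove them after such a tensoring.\<close>

lemma lunit_tens:
  assumes [simp]: "A \<in> Obj C" "B \<in> Obj C"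
  shows "lunit C (A \<boxtimes> B) \<cdot> assoc C (unit_obj C) A B = lunit C A \<otimes> ident C B"
proof (rule unit_tens_cancel)
  let ?I = "unit_obj C"
  let ?i = "ident C ?I"
  let ?p = "assoc C ?I (?I \<boxtimes> A) B" and ?q = "assoc C ?I ?I A \<otimes> ident C B"
  \<comment> \<open>The pentagon for two units, \<open>A\<close> and \<open>B\<close> has
    \<open>?i \<otimes> assoc C ?I A B\<close> as an edge; \<open>?p \<cdot> ?q\<close> is the rest
    of that path and, being invertible, cancels at the end.\<close>
  have iso: "iso C (?p \<cdot> ?q)"
    unfolding iso_def inverse_arrows_def hom_def
    by (rule exI[of _ "(inv_arr C (assoc C ?I ?I A) \<otimes> ident C B) \<cdot> inv_arr C ?p"]) simp
  have "(?i \<otimes> (lunit C (A \<boxtimes> B) \<cdot> assoc C ?I A B)) \<cdot> ?p \<cdot> ?q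
    = (?i \<otimes> lunit C (A \<boxtimes> B)) \<cdot> (?i \<otimes> assoc C ?I A B) \<cdot> ?p \<cdot> ?q"
    by simp
  also have "\<dots> = (?i \<otimes> lunit C (A \<boxtimes> B)) \<cdot> assoc C ?I ?I (A \<boxtimes> B) \<cdot> assoc C (?I \<boxtimes> ?I) A B"
    by (simp only: pentagon unit_Obj assms)
  also have "\<dots> = ((?i \<otimes> lunit C (A \<boxtimes> B)) \<cdot> assoc C ?I ?I (A \<boxtimes> B)) \<cdot> assoc C (?I \<boxtimes> ?I) A B"
    by simp
  also have "\<dots> = (runit C ?I \<otimes> (ident C A \<otimes> ident C B)) \<cdot> assoc C (?I \<boxtimes> ?I) A B"
    by (subst triangle) simp_all
  also have "\<dots> = assoc C ?I A B \<cdot> ((runit C ?I \<otimes> ident C A) \<otimes> ident C B)"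
    using assoc_natural_Arr[of "runit C ?I" "ident C A" "ident C B"] by (simp del: tens_ident')
  also have "\<dots> = assoc C ?I A B \<cdot> (((?i \<otimes> lunit C A) \<cdot> assoc C ?I ?I A) \<otimes> ident C B)"
    by (subst triangle) simp_all
  also have "\<dots> = assoc C ?I A B \<cdot> ((?i \<otimes> lunit C A) \<otimes> ident C B) \<cdot> ?q"
    by simp
  also have "\<dots> = (assoc C ?I A B \<cdot> ((?i \<otimes> lunit C A) \<otimes> ident C B)) \<cdot> ?q"
    by (subst comp_assoc_Arr) simp_all
  also have "\<dots> = ((?i \<otimes> (lunit C A \<otimes> ident C B)) \<cdot> ?p) \<cdot> ?q"
    using assoc_natural_Arr[of ?i "lunit C A" "ident C B"] by simp
  also have "\<dots> = (?i \<otimes> (lunit C A \<otimes> ident C B)) \<cdot> ?p \<cdot> ?q"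
    by simp
  finally have eq: "(?i \<otimes> (lunit C (A \<boxtimes> B) \<cdot> assoc C ?I A B)) \<cdot> ?p \<cdot> ?q =
    (?i \<otimes> (lunit C A \<otimes> ident C B)) \<cdot> ?p \<cdot> ?q" .
  show "?i \<otimes> (lunit C (A \<boxtimes> B) \<cdot> assoc C ?I A B) = ?i \<otimes> (lunit C A \<otimes> ident C B)"
    by (rule iso_cancel_right[OF iso _ _ _ _ eq]) simp_all
qed simp_all

lemma runit_tens:
  assumes [simp]: "A \<in> Obj C" "B \<in> Obj C"
  shows "(ident C A \<otimes> runit C B) \<cdot> assoc C A B (unit_obj C) = runit C (A \<boxtimes> B)"
proof (rule tens_unit_cancel)
  let ?I = "unit_obj C"
  let ?i = "ident C ?I"
  let ?a = "ident C A"
  let ?k = "assoc C A B ?I"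
  \<comment> \<open>The associator in front is there for naturality to apply; it is invertible and
    cancels. After that, \<open>?k \<otimes> ?i\<close> is an edge of the pentagon for
    \<open>A\<close>, \<open>B\<close> and two units.\<close>
  have eq: "assoc C A B ?I \<cdot> (((?a \<otimes> runit C B) \<cdot> ?k) \<otimes> ?i) =
    assoc C A B ?I \<cdot> (runit C (A \<boxtimes> B) \<otimes> ?i)"
  proof -
    have "assoc C A B ?I \<cdot> (((?a \<otimes> runit C B) \<cdot> ?k) \<otimes> ?i)
      = (assoc C A B ?I \<cdot> ((?a \<otimes> runit C B) \<otimes> ?i)) \<cdot> (?k \<otimes> ?i)"
      by simp
    also have "\<dots> = ((?a \<otimes> (runit C B \<otimes> ?i)) \<cdot> assoc C A (B \<boxtimes> ?I) ?I) \<cdot> (?k \<otimes> ?i)"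
      using assoc_natural_Arr[of ?a "runit C B" ?i] by simp
    also have "\<dots> = ((?a \<otimes> ((ident C B \<otimes> lunit C ?I) \<cdot> assoc C B ?I ?I)) \<cdot> assoc C A (B \<boxtimes> ?I) ?I) \<cdot>
      (?k \<otimes> ?i)"
      by (subst triangle) simp_all
    also have "\<dots> = (?a \<otimes> (ident C B \<otimes> lunit C ?I)) \<cdot> (?a \<otimes> assoc C B ?I ?I) \<cdot>
      assoc C A (B \<boxtimes> ?I) ?I \<cdot> (?k \<otimes> ?i)"
      by simp
    also have "\<dots> = (?a \<otimes> (ident C B \<otimes> lunit C ?I)) \<cdot> assoc C A B (?I \<boxtimes> ?I) \<cdot> assoc C (A \<boxtimes> B) ?I ?I"
      by (simp only: pentagon unit_Obj assms)
    also have "\<dots> = ((?a \<otimes> (ident C B \<otimes> lunit C ?I)) \<cdot> assoc C A B (?I \<boxtimes> ?I)) \<cdot>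
      assoc C (A \<boxtimes> B) ?I ?I"
      by simp
    also have "\<dots> = (assoc C A B ?I \<cdot> ((?a \<otimes> ident C B) \<otimes> lunit C ?I)) \<cdot> assoc C (A \<boxtimes> B) ?I ?I"
      using assoc_natural_Arr[of ?a "ident C B" "lunit C ?I"] by (simp del: tens_ident')
    also have "\<dots> = assoc C A B ?I \<cdot> ((ident C (A \<boxtimes> B) \<otimes> lunit C ?I) \<cdot> assoc C (A \<boxtimes> B) ?I ?I)"
      by simp
    also have "\<dots> = assoc C A B ?I \<cdot> (runit C (A \<boxtimes> B) \<otimes> ?i)"
      by (subst triangle) simp_all
    finally show ?thesis .
  qed
  show "((?a \<otimes> runit C B) \<cdot> ?k) \<otimes> ?i = runit C (A \<boxtimes> B) \<otimes> ?i"
    by (rule iso_cancel_left[OF assoc_iso _ _ _ _ eq]) simp_all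
qed simp_all

end

section \<open>Compatibility of the units with the symmetry\<close>

context symmetric_monoidal_category
begin

lemma symm_Arr [simp]:
  assumes "A \<in> Obj C" "B \<in> Obj C"
  shows "symm C A B \<in> Arr C" "Dom C (symm C A B) = A \<boxtimes> B" "Cod C (symm C A B) = B \<boxtimes> A"
  using symm_hom[OF assms] by (simp_all add: hom_def)

lemma symm_natural_Arr:
  assumes "f \<in> Arr C" "g \<in> Arr C"
  shows "symm C (Cod C f) (Cod C g) \<cdot> (f \<otimes> g) = (g \<otimes> f) \<cdot> symm C (Dom C f) (Dom C g)"
  using symm_natural[of f "Dom C f" "Cod C f" g "Dom C g" "Cod C g"] assms by (simp add: hom_def)

lemma iso_symm: "\<lbrakk>A \<in> Obj C; B \<in> Obj C\<rbrakk> \<Longrightarrow> iso C (symm C A B)"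
  unfolding iso_def inverse_arrows_def hom_def
  by (rule exI[of _ "symm C B A"]) (simp add: symm_symm)

lemma lunit_symm:
  assumes [simp]: "A \<in> Obj C"
  shows "lunit C A \<cdot> symm C A (unit_obj C) = runit C A"
proof (rule tens_unit_cancel)
  let ?I = "unit_obj C"
  let ?i = "ident C ?I"
  let ?s = "symm C A ?I"
  \<comment> \<open>The invertible \<open>?s\<close> in front moves past \<open>lunit\<close> by
    naturality, which completes one side of the hexagon for \<open>A\<close> and two units; it
    reappears in front and cancels.\<close>
  have "?s \<cdot> ((lunit C A \<cdot> ?s) \<otimes> ?i) = ?s \<cdot> (lunit C A \<otimes> ?i) \<cdot> (?s \<otimes> ?i)"
    by simp
  also have "\<dots> = ?s \<cdot> (lunit C (A \<boxtimes> ?I) \<cdot> assoc C ?I A ?I) \<cdot> (?s \<otimes> ?i)"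
    by (simp only: lunit_tens assms unit_Obj)
  also have "\<dots> = (?s \<cdot> lunit C (A \<boxtimes> ?I)) \<cdot> assoc C ?I A ?I \<cdot> (?s \<otimes> ?i)"
    by simp
  also have "\<dots> = (lunit C (?I \<boxtimes> A) \<cdot> (?i \<otimes> ?s)) \<cdot> assoc C ?I A ?I \<cdot> (?s \<otimes> ?i)"
    using lunit_natural_Arr[of ?s] by simp
  also have "\<dots> = lunit C (?I \<boxtimes> A) \<cdot> (?i \<otimes> ?s) \<cdot> assoc C ?I A ?I \<cdot> (?s \<otimes> ?i)"
    by simp
  also have "\<dots> = lunit C (?I \<boxtimes> A) \<cdot> assoc C ?I ?I A \<cdot> symm C A (?I \<boxtimes> ?I) \<cdot> assoc C A ?I ?I"
    by (simp only: hexagon assms unit_Obj)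
  also have "\<dots> = (lunit C (?I \<boxtimes> A) \<cdot> assoc C ?I ?I A) \<cdot> symm C A (?I \<boxtimes> ?I) \<cdot> assoc C A ?I ?I"
    by simp
  also have "\<dots> = ((lunit C ?I \<otimes> ident C A) \<cdot> symm C A (?I \<boxtimes> ?I)) \<cdot> assoc C A ?I ?I"
    by (subst lunit_tens) simp_all
  also have "\<dots> = (?s \<cdot> (ident C A \<otimes> lunit C ?I)) \<cdot> assoc C A ?I ?I"
    using symm_natural_Arr[of "ident C A" "lunit C ?I"] by simp
  also have "\<dots> = ?s \<cdot> (ident C A \<otimes> lunit C ?I) \<cdot> assoc C A ?I ?I"
    by simp
  also have "\<dots> = ?s \<cdot> (runit C A \<otimes> ?i)"
    by (subst triangle) simp_all
  finally have eq: "?s \<cdot> ((lunit C A \<cdot> ?s) \<otimes> ?i) = ?s \<cdot> (runit C A \<otimes> ?i)" .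
  show "(lunit C A \<cdot> ?s) \<otimes> ?i = runit C A \<otimes> ?i"
    by (rule iso_cancel_left[OF iso_symm _ _ _ _ eq]) simp_all
qed simp_all

lemma runit_symm:
  assumes [simp]: "A \<in> Obj C"
  shows "runit C A \<cdot> symm C (unit_obj C) A = lunit C A"
  by (simp add: lunit_symm[OF assms, symmetric] symm_symm)

end

section \<open>Deterministic channels\<close>

text \<open>\<open>middle_swap\<close> is the diagonal case \<open>mswap A A B B\<close>. Naturality
  is needed for four independent objects, because discarding one copy of each factor leads from
  \<open>A, A, B, B\<close> to \<open>A, I, I, B\<close>.\<close>

definition (in markov_category) mswap :: "'a \<Rightarrow> 'a \<Rightarrow> 'a \<Rightarrow> 'a \<Rightarrow> 'b" where
  "mswap A A' B B' =
     inv_arr C (assoc C A B (A' \<boxtimes> B')) \<cdot> (ident C A \<otimes> assoc C B A' B') \<cdot>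
     (ident C A \<otimes> (symm C A' B \<otimes> ident C B')) \<cdot>
     (ident C A \<otimes> inv_arr C (assoc C A' B B')) \<cdot> assoc C A A' (B \<boxtimes> B')"

definition (in markov_category) pr1 :: "'a \<Rightarrow> 'a \<Rightarrow> 'b" where
  "pr1 A B = runit C A \<cdot> (ident C A \<otimes> disc C B)"

definition (in markov_category) pr2 :: "'a \<Rightarrow> 'a \<Rightarrow> 'b" where
  "pr2 A B = lunit C B \<cdot> (disc C A \<otimes> ident C B)"

text \<open>The pairing of a cartesian category. Its projection laws hold for all channels, whereas
  compatibility with precomposition relies on a deterministic argument.\<close>

definition (in markov_category) pair :: "'b \<Rightarrow> 'b \<Rightarrow> 'b" where
  "pair f g = (f \<otimes> g) \<cdot> copy C (Dom C f)"

context markov_category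
begin

lemma copy_Arr [simp]:
  assumes "A \<in> Obj C"
  shows "copy C A \<in> Arr C" "Dom C (copy C A) = A" "Cod C (copy C A) = A \<boxtimes> A"
  using copy_hom[OF assms] by (simp_all add: hom_def)

lemma disc_Arr [simp]:
  assumes "A \<in> Obj C"
  shows "disc C A \<in> Arr C" "Dom C (disc C A) = A" "Cod C (disc C A) = unit_obj C"
  using disc_hom[OF assms] by (simp_all add: hom_def)

lemma to_unit_eq:
  assumes "f \<in> Arr C" "g \<in> Arr C" "Dom C f = Dom C g" "Cod C f = unit_obj C" "Cod C g = unit_obj C"
  shows "f = g"
  using unit_terminal[of f "Dom C f"] unit_terminal[of g "Dom C g"] assms by (simp add: hom_def)

lemma disc_unit [simp]: "disc C (unit_obj C) = ident C (unit_obj C)"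
  by (rule to_unit_eq) simp_all

lemma disc_comp [simp]:
  "\<lbrakk>f \<in> Arr C; Cod C f = A\<rbrakk> \<Longrightarrow> disc C A \<cdot> f = disc C (Dom C f)"
  by (rule to_unit_eq) auto

text \<open>Through \<open>lunit\<close> the object \<open>I \<boxtimes> I\<close> is isomorphic to
  \<open>I\<close> and so terminal as well. This spares coherence computations between
  units.\<close>

lemma to_unit_tens_unit_eq:
  assumes "f \<in> Arr C" "g \<in> Arr C" "Dom C f = Dom C g"
    "Cod C f = unit_obj C \<boxtimes> unit_obj C" "Cod C g = unit_obj C \<boxtimes> unit_obj C"
  shows "f = g"
  by (rule iso_cancel_left[OF lunit_iso[OF unit_Obj]], use assms in simp_all)
    (rule to_unit_eq, simp_all)

lemma symm_unit: "symm C (unit_obj C) (unit_obj C) = ident C (unit_obj C \<boxtimes> unit_obj C)"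
  by (rule to_unit_tens_unit_eq) simp_all

lemma mswap_Arr [simp]:
  assumes "A \<in> Obj C" "A' \<in> Obj C" "B \<in> Obj C" "B' \<in> Obj C"
  shows "mswap A A' B B' \<in> Arr C" "Dom C (mswap A A' B B') = (A \<boxtimes> A') \<boxtimes> (B \<boxtimes> B')"
    "Cod C (mswap A A' B B') = (A \<boxtimes> B) \<boxtimes> (A' \<boxtimes> B')"
  using assms by (simp_all add: mswap_def)

lemma mswap_natural:
  assumes [simp]: "f \<in> Arr C" "f' \<in> Arr C" "g \<in> Arr C" "g' \<in> Arr C"
  shows "mswap (Cod C f) (Cod C f') (Cod C g) (Cod C g') \<cdot> ((f \<otimes> f') \<otimes> (g \<otimes> g')) =
    ((f \<otimes> g) \<otimes> (f' \<otimes> g')) \<cdot> mswap (Dom C f) (Dom C f') (Dom C g) (Dom C g')"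
proof -
  let ?i = "ident C (Cod C f)" and ?j = "ident C (Dom C f)"
  \<comment> \<open>The structure arrows are named so that the simplifier treats them as opaque
    arrows with known ends. Each square \<open>n1\<close> to \<open>n5\<close> then slides the four
    given arrows through one factor of \<open>mswap\<close>.\<close>
  define a1 where "a1 = inv_arr C (assoc C (Cod C f) (Cod C g) (Cod C f' \<boxtimes> Cod C g'))"
  define a2 where "a2 = assoc C (Cod C g) (Cod C f') (Cod C g')"
  define a3 where "a3 = symm C (Cod C f') (Cod C g)"
  define a4 where "a4 = inv_arr C (assoc C (Cod C f') (Cod C g) (Cod C g'))"
  define a5 where "a5 = assoc C (Cod C f) (Cod C f') (Cod C g \<boxtimes> Cod C g')"
  define b1 where "b1 = inv_arr C (assoc C (Dom C f) (Dom C g) (Dom C f' \<boxtimes> Dom C g'))"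
  define b2 where "b2 = assoc C (Dom C g) (Dom C f') (Dom C g')"
  define b3 where "b3 = symm C (Dom C f') (Dom C g)"
  define b4 where "b4 = inv_arr C (assoc C (Dom C f') (Dom C g) (Dom C g'))"
  define b5 where "b5 = assoc C (Dom C f) (Dom C f') (Dom C g \<boxtimes> Dom C g')"
  note abbrs = a1_def a2_def a3_def a4_def a5_def b1_def b2_def b3_def b4_def b5_def
  have n1: "a1 \<cdot> (f \<otimes> (g \<otimes> (f' \<otimes> g'))) = ((f \<otimes> g) \<otimes> (f' \<otimes> g')) \<cdot> b1"
    using inv_assoc_natural[of f g "f' \<otimes> g'"] by (simp add: abbrs)
  have n2: "a2 \<cdot> ((g \<otimes> f') \<otimes> g') = (g \<otimes> (f' \<otimes> g')) \<cdot> b2"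
    using assoc_natural_Arr[of g f' g'] by (simp add: abbrs)
  have n3: "a3 \<cdot> (f' \<otimes> g) = (g \<otimes> f') \<cdot> b3"
    using symm_natural_Arr[of f' g] by (simp add: abbrs)
  have n4: "a4 \<cdot> (f' \<otimes> (g \<otimes> g')) = ((f' \<otimes> g) \<otimes> g') \<cdot> b4"
    using inv_assoc_natural[of f' g g'] by (simp add: abbrs)
  have n5: "a5 \<cdot> ((f \<otimes> f') \<otimes> (g \<otimes> g')) = (f \<otimes> (f' \<otimes> (g \<otimes> g'))) \<cdot> b5"
    using assoc_natural_Arr[of f f' "g \<otimes> g'"] by (simp add: abbrs)
  have [simp]: "a1 \<in> Arr C" "Dom C a1 = Cod C f \<boxtimes> Cod C g \<boxtimes> Cod C f' \<boxtimes> Cod C g'"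
    "a2 \<in> Arr C" "Dom C a2 = (Cod C g \<boxtimes> Cod C f') \<boxtimes> Cod C g'" "Cod C a2 =
      Cod C g \<boxtimes> Cod C f' \<boxtimes> Cod C g'"
    "a3 \<in> Arr C" "Dom C a3 = Cod C f' \<boxtimes> Cod C g" "Cod C a3 = Cod C g \<boxtimes> Cod C f'"
    "a4 \<in> Arr C" "Dom C a4 = Cod C f' \<boxtimes> Cod C g \<boxtimes> Cod C g'" "Cod C a4 =
      (Cod C f' \<boxtimes> Cod C g) \<boxtimes> Cod C g'"
    "a5 \<in> Arr C" "Dom C a5 = (Cod C f \<boxtimes> Cod C f') \<boxtimes> Cod C g \<boxtimes> Cod C g'"
    "Cod C a5 = Cod C f \<boxtimes> Cod C f' \<boxtimes> Cod C g \<boxtimes> Cod C g'"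
    "b1 \<in> Arr C" "Dom C b1 = Dom C f \<boxtimes> Dom C g \<boxtimes> Dom C f' \<boxtimes> Dom C g'"
    "Cod C b1 = (Dom C f \<boxtimes> Dom C g) \<boxtimes> Dom C f' \<boxtimes> Dom C g'"
    "b2 \<in> Arr C" "Dom C b2 = (Dom C g \<boxtimes> Dom C f') \<boxtimes> Dom C g'" "Cod C b2 =
      Dom C g \<boxtimes> Dom C f' \<boxtimes> Dom C g'"
    "b3 \<in> Arr C" "Dom C b3 = Dom C f' \<boxtimes> Dom C g" "Cod C b3 = Dom C g \<boxtimes> Dom C f'"
    "b4 \<in> Arr C" "Dom C b4 = Dom C f' \<boxtimes> Dom C g \<boxtimes> Dom C g'" "Cod C b4 =
      (Dom C f' \<boxtimes> Dom C g) \<boxtimes> Dom C g'"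
    "b5 \<in> Arr C" "Dom C b5 = (Dom C f \<boxtimes> Dom C f') \<boxtimes> Dom C g \<boxtimes> Dom C g'"
    "Cod C b5 = Dom C f \<boxtimes> Dom C f' \<boxtimes> Dom C g \<boxtimes> Dom C g'"
    by (simp_all add: abbrs)
  have "mswap (Cod C f) (Cod C f') (Cod C g) (Cod C g') \<cdot> ((f \<otimes> f') \<otimes> (g \<otimes> g'))
    = a1 \<cdot> (?i \<otimes> a2) \<cdot> (?i \<otimes> (a3 \<otimes> ident C (Cod C g'))) \<cdot> (?i \<otimes> a4) \<cdot> (a5 \<cdot> ((f \<otimes> f') \<otimes> (g \<otimes> g')))"
    by (simp add: mswap_def flip: abbrs)
  also have "\<dots> = a1 \<cdot> (f \<otimes> (a2 \<cdot> (a3 \<otimes> ident C (Cod C g')) \<cdot> (a4 \<cdot> (f' \<otimes> (g \<otimes> g'))))) \<cdot> b5"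
    unfolding n5 by simp
  also have "\<dots> = a1 \<cdot> (f \<otimes> (a2 \<cdot> ((a3 \<cdot> (f' \<otimes> g)) \<otimes> g') \<cdot> b4)) \<cdot> b5"
    unfolding n4 by simp
  also have "\<dots> = a1 \<cdot> (f \<otimes> ((a2 \<cdot> ((g \<otimes> f') \<otimes> g')) \<cdot> (b3 \<otimes> ident C (Dom C g')) \<cdot> b4)) \<cdot> b5"
    unfolding n3 by simp
  also have "\<dots> = (a1 \<cdot> (f \<otimes> (g \<otimes> (f' \<otimes> g')))) \<cdot> (?j \<otimes> (b2 \<cdot> (b3 \<otimes> ident C (Dom C g')) \<cdot> b4)) \<cdot> b5"
    unfolding n2 by simp
  also have "\<dots> = ((f \<otimes> g) \<otimes> (f' \<otimes> g')) \<cdot> mswap (Dom C f) (Dom C f') (Dom C g) (Dom C g')"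
    unfolding n1 by (simp add: mswap_def flip: abbrs)
  finally show ?thesis .
qed

lemma copy_tens_mswap:
  "\<lbrakk>A \<in> Obj C; B \<in> Obj C\<rbrakk> \<Longrightarrow> copy C (A \<boxtimes> B) = mswap A A B B \<cdot> (copy C A \<otimes> copy C B)"
  by (simp add: copy_tens middle_swap_def mswap_def)

text \<open>The only wires that cross are two units, whose symmetry is an identity; the associators
  then cancel in pairs.\<close>

lemma mswap_unit:
  assumes [simp]: "A \<in> Obj C" "B \<in> Obj C"
  shows "mswap A (unit_obj C) (unit_obj C) B =
    ident C ((A \<boxtimes> unit_obj C) \<boxtimes> (unit_obj C \<boxtimes> B))"
  by (simp add: mswap_def symm_unit)

lemma pr_Arr [simp]:
  assumes "A \<in> Obj C" "B \<in> Obj C"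
  shows "pr1 A B \<in> Arr C" "Dom C (pr1 A B) = A \<boxtimes> B" "Cod C (pr1 A B) = A"
    "pr2 A B \<in> Arr C" "Dom C (pr2 A B) = A \<boxtimes> B" "Cod C (pr2 A B) = B"
  using assms by (simp_all add: pr1_def pr2_def)

lemma pair_Arr [simp]:
  assumes "f \<in> Arr C" "g \<in> Arr C" "Dom C f = Dom C g"
  shows "pair f g \<in> Arr C" "Dom C (pair f g) = Dom C g" "Cod C (pair f g) = Cod C f \<boxtimes> Cod C g"
  using assms by (simp_all add: pair_def)

text \<open>The discarded component leaves no trace because every channel into the unit equals
  \<open>disc\<close>. Naturality of the unitor and the counit law do the rest, for arbitrary
  \<open>f\<close> and \<open>g\<close>.\<close>

lemma pr1_pair [simp]:
  assumes [simp]: "f \<in> Arr C" "g \<in> Arr C" and eq: "Dom C f = Dom C g"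
    and cod: "A = Cod C f" "B = Cod C g"
  shows "pr1 A B \<cdot> pair f g = f"
proof -
  have "pr1 A B \<cdot> pair f g = (runit C (Cod C f) \<cdot> (f \<otimes> disc C (Dom C f))) \<cdot> copy C (Dom C f)"
    by (simp add: pair_def pr1_def eq cod)
  also have "f \<otimes> disc C (Dom C f) = (f \<otimes> ident C (unit_obj C)) \<cdot>
    (ident C (Dom C f) \<otimes> disc C (Dom C f))"
    by simp
  also have "runit C (Cod C f) \<cdot> \<dots> = (runit C (Cod C f) \<cdot> (f \<otimes> ident C (unit_obj C))) \<cdot>
    (ident C (Dom C f) \<otimes> disc C (Dom C f))"
    by (subst comp_assoc_Arr) simp_all
  also have "\<dots> \<cdot> copy C (Dom C f) = f \<cdot> runit C (Dom C f) \<cdot>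
    (ident C (Dom C f) \<otimes> disc C (Dom C f)) \<cdot> copy C (Dom C f)"
    by (subst runit_natural_Arr) simp_all
  also have "\<dots> = f"
    by (subst copy_counit_right) simp_all
  finally show ?thesis .
qed

lemma pr2_pair [simp]:
  assumes [simp]: "f \<in> Arr C" "g \<in> Arr C" and eq: "Dom C f = Dom C g"
    and cod: "A = Cod C f" "B = Cod C g"
  shows "pr2 A B \<cdot> pair f g = g"
proof -
  have "pr2 A B \<cdot> pair f g = (lunit C (Cod C g) \<cdot> (disc C (Dom C g) \<otimes> g)) \<cdot> copy C (Dom C g)"
    by (simp add: pair_def pr2_def eq cod)
  also have "disc C (Dom C g) \<otimes> g = (ident C (unit_obj C) \<otimes> g) \<cdot>
    (disc C (Dom C g) \<otimes> ident C (Dom C g))"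
    by simp
  also have "lunit C (Cod C g) \<cdot> \<dots> = (lunit C (Cod C g) \<cdot> (ident C (unit_obj C) \<otimes> g)) \<cdot>
    (disc C (Dom C g) \<otimes> ident C (Dom C g))"
    by (subst comp_assoc_Arr) simp_all
  also have "\<dots> \<cdot> copy C (Dom C g) = g \<cdot> lunit C (Dom C g) \<cdot>
    (disc C (Dom C g) \<otimes> ident C (Dom C g)) \<cdot> copy C (Dom C g)"
    by (subst lunit_natural_Arr) simp_all
  also have "\<dots> = g"
    by (subst copy_counit_left) simp_all
  finally show ?thesis .
qed

text \<open>Determinism of \<open>s\<close> is exactly the permission to run \<open>s\<close> twice
  instead of copying its result.\<close>

lemma pair_comp_det:
  assumes "f \<in> Arr C" "g \<in> Arr C" "deterministic C s" "Dom C f = Cod C s" "Dom C g = Cod C s"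
  shows "pair f g \<cdot> s = pair (f \<cdot> s) (g \<cdot> s)"
proof -
  have s: "s \<in> Arr C" "copy C (Cod C s) \<cdot> s = (s \<otimes> s) \<cdot> copy C (Dom C s)"
    using assms(3) by (simp_all add: deterministic_def)
  then show ?thesis
    using assms by (simp add: pair_def)
qed

text \<open>Of the two copies that \<open>copy C (A \<boxtimes> B)\<close> makes of each factor, the
  projections discard one. Sliding these discards through the middle swap leaves a swap of units,
  and the two counit laws remain.\<close>

lemma pair_pr:
  assumes [simp]: "A \<in> Obj C" "B \<in> Obj C"
  shows "pair (pr1 A B) (pr2 A B) = ident C (A \<boxtimes> B)"
proof -
  let ?I = "unit_obj C"
  have "pair (pr1 A B) (pr2 A B) = (runit C A \<otimes> lunit C B) \<cdot>
      (((ident C A \<otimes> disc C B) \<otimes> (disc C A \<otimes> ident C B)) \<cdot> mswap A A B B) \<cdot> (copy C A \<otimes> copy C B)"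
    by (simp add: pair_def pr1_def pr2_def copy_tens_mswap)
  also have "\<dots> = (runit C A \<otimes> lunit C B) \<cdot>
      (mswap A ?I ?I B \<cdot> ((ident C A \<otimes> disc C A) \<otimes> (disc C B \<otimes> ident C B))) \<cdot> (copy C A \<otimes> copy C B)"
    using mswap_natural[of "ident C A" "disc C A" "disc C B" "ident C B"] by simp
  also have "\<dots> = (runit C A \<cdot> (ident C A \<otimes> disc C A) \<cdot> copy C A) \<otimes> (lunit C B \<cdot>
    (disc C B \<otimes> ident C B) \<cdot> copy C B)"
    by (simp add: mswap_unit)
  also have "\<dots> = ident C (A \<boxtimes> B)"
    by (subst copy_counit_left copy_counit_right, simp)+ simp
  finally show ?thesis .
qed

section \<open>Closure properties of deterministic channels\<close>

lemma det_Arr: "deterministic C f \<Longrightarrow> f \<in> Arr C"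
  by (simp add: deterministic_def)

lemma pair_pr_det:
  assumes "deterministic C s" "Cod C s = A \<boxtimes> B" "A \<in> Obj C" "B \<in> Obj C"
  shows "pair (pr1 A B \<cdot> s) (pr2 A B \<cdot> s) = s"
  using assms pair_comp_det[of "pr1 A B" "pr2 A B" s] det_Arr[of s] by (simp add: pair_pr)

lemma det_ident: "A \<in> Obj C \<Longrightarrow> deterministic C (ident C A)"
  by (simp add: deterministic_def)

lemma det_comp:
  assumes "deterministic C f" "deterministic C g" "Cod C f = Dom C g"
  shows "deterministic C (g \<cdot> f)"
proof -
  have [simp]: "f \<in> Arr C" "g \<in> Arr C"
    and f: "copy C (Dom C g) \<cdot> f = (f \<otimes> f) \<cdot> copy C (Dom C f)"
    and g: "copy C (Cod C g) \<cdot> g = (g \<otimes> g) \<cdot> copy C (Dom C g)"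
    using assms by (simp_all add: deterministic_def)
  have "copy C (Cod C g) \<cdot> g \<cdot> f = (copy C (Cod C g) \<cdot> g) \<cdot> f"
    using assms(3) by simp
  also have "\<dots> = (g \<otimes> g) \<cdot> copy C (Dom C g) \<cdot> f"
    using assms(3) unfolding g by simp
  finally show ?thesis
    using assms(3) by (simp add: deterministic_def f)
qed

lemma det_tens:
  assumes "deterministic C f" "deterministic C g"
  shows "deterministic C (f \<otimes> g)"
proof -
  have [simp]: "f \<in> Arr C" "g \<in> Arr C"
    and f: "copy C (Cod C f) \<cdot> f = (f \<otimes> f) \<cdot> copy C (Dom C f)"
    and g: "copy C (Cod C g) \<cdot> g = (g \<otimes> g) \<cdot> copy C (Dom C g)"
    using assms by (simp_all add: deterministic_def)
  have "copy C (Cod C f \<boxtimes> Cod C g) \<cdot> (f \<otimes> g)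
    = mswap (Cod C f) (Cod C f) (Cod C g) (Cod C g) \<cdot> ((copy C (Cod C f) \<cdot>
      f) \<otimes> (copy C (Cod C g) \<cdot> g))"
    by (simp add: copy_tens_mswap)
  also have "\<dots> = (mswap (Cod C f) (Cod C f) (Cod C g) (Cod C g) \<cdot> ((f \<otimes> f) \<otimes> (g \<otimes> g))) \<cdot>
    (copy C (Dom C f) \<otimes> copy C (Dom C g))"
    unfolding f g by simp
  also have "\<dots> = ((f \<otimes> g) \<otimes> (f \<otimes> g)) \<cdot> mswap (Dom C f) (Dom C f) (Dom C g) (Dom C g) \<cdot>
    (copy C (Dom C f) \<otimes> copy C (Dom C g))"
    unfolding mswap_natural[OF \<open>f \<in> Arr C\<close> \<open>f \<in> Arr C\<close> \<open>g \<in> Arr C\<close> \<open>g \<in> Arr C\<close>] by simp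
  finally show ?thesis
    by (simp add: deterministic_def copy_tens_mswap)
qed

lemma det_disc: "A \<in> Obj C \<Longrightarrow> deterministic C (disc C A)"
  unfolding deterministic_def using to_unit_tens_unit_eq by simp

text \<open>The copy map of \<open>A \<boxtimes> I\<close> involves a middle swap in which a unit
  crosses \<open>A\<close>. The unit laws have to remove the units again: \<open>l\<close> disposes
  of the outer associator, \<open>m\<close> of the crossing.\<close>

lemma det_runit:
  assumes [simp]: "A \<in> Obj C"
  shows "deterministic C (runit C A)"
proof -
  let ?I = "unit_obj C"
  let ?i = "ident C ?I" and ?a = "ident C A"
  define s where "s = symm C A ?I"
  define k where "k = assoc C ?I A ?I"
  define k' where "k' = inv_arr C (assoc C A ?I ?I)"
  define l where "l = inv_arr C (assoc C A ?I (A \<boxtimes> ?I))"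
  have [simp]: "s \<in> Arr C" "Dom C s = A \<boxtimes> ?I" "Cod C s = ?I \<boxtimes> A"
    "k \<in> Arr C" "Dom C k = (?I \<boxtimes> A) \<boxtimes> ?I" "Cod C k = ?I \<boxtimes> A \<boxtimes> ?I"
    "k' \<in> Arr C" "Dom C k' = A \<boxtimes> ?I \<boxtimes> ?I" "Cod C k' = (A \<boxtimes> ?I) \<boxtimes> ?I"
    "l \<in> Arr C" "Dom C l = A \<boxtimes> ?I \<boxtimes> A \<boxtimes> ?I" "Cod C l = (A \<boxtimes> ?I) \<boxtimes> A \<boxtimes> ?I"
    by (simp_all add: s_def k_def k'_def l_def)
  have l: "(runit C A \<otimes> ident C (A \<boxtimes> ?I)) \<cdot> l = ?a \<otimes> lunit C (A \<boxtimes> ?I)"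
  proof -
    have "(runit C A \<otimes> ident C (A \<boxtimes> ?I)) \<cdot> l =
      ((?a \<otimes> lunit C (A \<boxtimes> ?I)) \<cdot> assoc C A ?I (A \<boxtimes> ?I)) \<cdot> l"
      by (subst triangle) simp_all
    then show ?thesis
      by (simp add: l_def)
  qed
  \<comment> \<open>Absorbing the unit on the left after it has crossed \<open>A\<close> equals, by
    \<open>lunit_symm\<close>, absorbing it on the right before the crossing; the triangle identity
    then removes \<open>k'\<close>.\<close>
  have m: "runit C A \<cdot> lunit C (A \<boxtimes> ?I) \<cdot> k \<cdot> (s \<otimes> ?i) \<cdot> k' = runit C A \<cdot> (?a \<otimes> lunit C ?I)"
  proof -
    have "runit C A \<cdot> lunit C (A \<boxtimes> ?I) \<cdot> k \<cdot> (s \<otimes> ?i) \<cdot> k' =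
      runit C A \<cdot> (lunit C (A \<boxtimes> ?I) \<cdot> k) \<cdot> (s \<otimes> ?i) \<cdot> k'"
      by simp
    also have "\<dots> = runit C A \<cdot> ((lunit C A \<cdot> s) \<otimes> ?i) \<cdot> k'"
      unfolding k_def by (subst lunit_tens) simp_all
    also have "\<dots> = runit C A \<cdot> ((?a \<otimes> lunit C ?I) \<cdot> assoc C A ?I ?I) \<cdot> k'"
      unfolding s_def by (simp only: lunit_symm assms triangle unit_Obj)
    also have "\<dots> = runit C A \<cdot> (?a \<otimes> lunit C ?I)"
      by (simp add: k'_def)
    finally show ?thesis .
  qed
  have "(runit C A \<otimes> runit C A) \<cdot> copy C (A \<boxtimes> ?I)
    = (runit C A \<otimes> runit C A) \<cdot> l \<cdot> (?a \<otimes> k) \<cdot> (?a \<otimes> (s \<otimes> ?i)) \<cdot> (?a \<otimes> k') \<cdot>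
      assoc C A A (?I \<boxtimes> ?I) \<cdot> (copy C A \<otimes> copy C ?I)"
    by (simp add: copy_tens_mswap mswap_def s_def k_def k'_def l_def)
  also have "\<dots> = (?a \<otimes> runit C A) \<cdot> ((runit C A \<otimes> ident C (A \<boxtimes> ?I)) \<cdot> l) \<cdot> (?a \<otimes> (k \<cdot> (s \<otimes> ?i) \<cdot>
    k')) \<cdot> assoc C A A (?I \<boxtimes> ?I) \<cdot> (copy C A \<otimes> copy C ?I)"
    by simp
  also have "\<dots> = (?a \<otimes> (runit C A \<cdot> lunit C (A \<boxtimes> ?I) \<cdot> k \<cdot> (s \<otimes> ?i) \<cdot> k')) \<cdot>
    assoc C A A (?I \<boxtimes> ?I) \<cdot> (copy C A \<otimes> copy C ?I)"
    unfolding l by simp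
  also have "\<dots> = (?a \<otimes> runit C A) \<cdot> ((?a \<otimes> (?a \<otimes> lunit C ?I)) \<cdot> assoc C A A (?I \<boxtimes> ?I)) \<cdot>
    (copy C A \<otimes> copy C ?I)"
    unfolding m by simp
  also have "(?a \<otimes> (?a \<otimes> lunit C ?I)) \<cdot> assoc C A A (?I \<boxtimes> ?I) =
    assoc C A A ?I \<cdot> ((?a \<otimes> ?a) \<otimes> lunit C ?I)"
    using assoc_natural_Arr[of ?a ?a "lunit C ?I"] by (simp del: tens_ident')
  also have "(?a \<otimes> runit C A) \<cdot> \<dots> \<cdot> (copy C A \<otimes> copy C ?I)
    = ((?a \<otimes> runit C A) \<cdot> assoc C A A ?I) \<cdot> (copy C A \<otimes> (lunit C ?I \<cdot> copy C ?I))"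
    by simp
  also have "\<dots> = runit C (A \<boxtimes> A) \<cdot> (copy C A \<otimes> (lunit C ?I \<cdot> copy C ?I))"
    by (subst runit_tens) simp_all
  also have "lunit C ?I \<cdot> copy C ?I = ?i"
    by (rule to_unit_eq) simp_all
  also have "runit C (A \<boxtimes> A) \<cdot> (copy C A \<otimes> ?i) = copy C A \<cdot> runit C A"
    using runit_natural_Arr[of "copy C A"] by simp
  finally show ?thesis
    by (simp add: deterministic_def)
qed

lemma det_lunit:
  assumes [simp]: "A \<in> Obj C"
  shows "deterministic C (lunit C A)"
proof -
  let ?I = "unit_obj C"
  let ?i = "ident C ?I" and ?a = "ident C A"
  define s where "s = symm C ?I A"
  define k where "k = assoc C A ?I A"
  define k' where "k' = inv_arr C (assoc C ?I A A)"
  define l where "l = inv_arr C (assoc C ?I A (?I \<boxtimes> A))"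
  define q where "q = assoc C ?I ?I (A \<boxtimes> A)"
  have [simp]: "s \<in> Arr C" "Dom C s = ?I \<boxtimes> A" "Cod C s = A \<boxtimes> ?I"
    "k \<in> Arr C" "Dom C k = (A \<boxtimes> ?I) \<boxtimes> A" "Cod C k = A \<boxtimes> ?I \<boxtimes> A"
    "k' \<in> Arr C" "Dom C k' = ?I \<boxtimes> A \<boxtimes> A" "Cod C k' = (?I \<boxtimes> A) \<boxtimes> A"
    "l \<in> Arr C" "Dom C l = ?I \<boxtimes> A \<boxtimes> ?I \<boxtimes> A" "Cod C l = (?I \<boxtimes> A) \<boxtimes> ?I \<boxtimes> A"
    "q \<in> Arr C" "Dom C q = (?I \<boxtimes> ?I) \<boxtimes> A \<boxtimes> A" "Cod C q = ?I \<boxtimes> ?I \<boxtimes> A \<boxtimes> A"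
    by (simp_all add: s_def k_def k'_def l_def q_def)
  have l: "(lunit C A \<otimes> ident C (?I \<boxtimes> A)) \<cdot> l = lunit C (A \<boxtimes> ?I \<boxtimes> A)"
  proof -
    have "(lunit C A \<otimes> ident C (?I \<boxtimes> A)) \<cdot> l = (lunit C (A \<boxtimes> ?I \<boxtimes> A) \<cdot> assoc C ?I A (?I \<boxtimes> A)) \<cdot> l"
      by (subst lunit_tens) simp_all
    then show ?thesis
      by (simp add: l_def)
  qed
  have m: "(?a \<otimes> lunit C A) \<cdot> k \<cdot> (s \<otimes> ?a) \<cdot> k' = lunit C (A \<boxtimes> A)"
  proof -
    have "(?a \<otimes> lunit C A) \<cdot> k \<cdot> (s \<otimes> ?a) \<cdot> k' = ((?a \<otimes> lunit C A) \<cdot> k) \<cdot> (s \<otimes> ?a) \<cdot> k'"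
      by simp
    also have "\<dots> = ((runit C A \<cdot> s) \<otimes> ?a) \<cdot> k'"
      unfolding k_def by (subst triangle) simp_all
    also have "\<dots> = (lunit C (A \<boxtimes> A) \<cdot> assoc C ?I A A) \<cdot> k'"
      unfolding s_def by (simp only: runit_symm lunit_tens assms unit_Obj)
    also have "\<dots> = lunit C (A \<boxtimes> A)"
      by (simp add: k'_def)
    finally show ?thesis .
  qed
  have "(lunit C A \<otimes> lunit C A) \<cdot> copy C (?I \<boxtimes> A)
    = (lunit C A \<otimes> lunit C A) \<cdot> l \<cdot> (?i \<otimes> k) \<cdot> (?i \<otimes> (s \<otimes> ?a)) \<cdot> (?i \<otimes> k') \<cdot> q \<cdot>
      (copy C ?I \<otimes> copy C A)"
    by (simp add: copy_tens_mswap mswap_def s_def k_def k'_def l_def q_def)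
  also have "\<dots> = (?a \<otimes> lunit C A) \<cdot> ((lunit C A \<otimes> ident C (?I \<boxtimes> A)) \<cdot> l) \<cdot> (?i \<otimes> (k \<cdot> (s \<otimes> ?a) \<cdot>
    k')) \<cdot> q \<cdot> (copy C ?I \<otimes> copy C A)"
    by simp
  also have "\<dots> = (?a \<otimes> lunit C A) \<cdot> (lunit C (A \<boxtimes> ?I \<boxtimes> A) \<cdot> (?i \<otimes> (k \<cdot> (s \<otimes> ?a) \<cdot> k'))) \<cdot> q \<cdot>
    (copy C ?I \<otimes> copy C A)"
    unfolding l by simp
  also have "\<dots> = ((?a \<otimes> lunit C A) \<cdot> k \<cdot> (s \<otimes> ?a) \<cdot> k') \<cdot> lunit C (?I \<boxtimes> A \<boxtimes> A) \<cdot> q \<cdot>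
    (copy C ?I \<otimes> copy C A)"
    using lunit_natural_Arr[of "k \<cdot> (s \<otimes> ?a) \<cdot> k'"] by simp
  also have "\<dots> = lunit C (A \<boxtimes> A) \<cdot> (lunit C (?I \<boxtimes> A \<boxtimes> A) \<cdot> q) \<cdot> (copy C ?I \<otimes> copy C A)"
    unfolding m by simp
  also have "lunit C (?I \<boxtimes> A \<boxtimes> A) \<cdot> q = lunit C ?I \<otimes> ident C (A \<boxtimes> A)"
    unfolding q_def by (rule lunit_tens) simp_all
  also have "lunit C (A \<boxtimes> A) \<cdot> \<dots> \<cdot> (copy C ?I \<otimes> copy C A) =
    lunit C (A \<boxtimes> A) \<cdot> ((lunit C ?I \<cdot> copy C ?I) \<otimes> copy C A)"
    by simp
  also have "lunit C ?I \<cdot> copy C ?I = ?i"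
    by (rule to_unit_eq) simp_all
  also have "lunit C (A \<boxtimes> A) \<cdot> (?i \<otimes> copy C A) = copy C A \<cdot> lunit C A"
    using lunit_natural_Arr[of "copy C A"] by simp
  finally show ?thesis
    by (simp add: deterministic_def)
qed

lemma det_pr:
  assumes "A \<in> Obj C" "B \<in> Obj C"
  shows "deterministic C (pr1 A B)" "deterministic C (pr2 A B)"
  unfolding pr1_def pr2_def using assms
  by (auto intro!: det_comp det_tens det_lunit det_runit det_ident det_disc)

lemma det_inv_arr:
  assumes "iso C f" "deterministic C f"
  shows "deterministic C (inv_arr C f)"
proof -
  note inv = inv_arr_props[OF assms(1)]
  have f: "copy C (Cod C f) \<cdot> f = (f \<otimes> f) \<cdot> copy C (Dom C f)"
    using assms(2) by (simp add: deterministic_def)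
  let ?g = "inv_arr C f"
  have "(?g \<otimes> ?g) \<cdot> (copy C (Cod C f) \<cdot> f) \<cdot> ?g = copy C (Dom C f) \<cdot> ?g"
    unfolding f using inv by simp
  then show ?thesis
    using inv by (simp add: deterministic_def)
qed

end

section \<open>Sharp states of finite products\<close>

locale states_category = markov_category +
  assumes enough: "enough_states C"
begin

lemma sharp_stateD:
  assumes "s \<in> sharp_states C A"
  shows "s \<in> Arr C" "Dom C s = unit_obj C" "Cod C s = A" "deterministic C s" "A \<in> Obj C"
  using assms by (auto simp: sharp_states_def hom_def)

lemma homD: "f \<in> hom C A B \<Longrightarrow> f \<in> Arr C" "f \<in> hom C A B \<Longrightarrow> Dom C f = A"
  "f \<in> hom C A B \<Longrightarrow> Cod C f = B"
  by (simp_all add: hom_def)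

lemma hom_Obj: "f \<in> hom C A B \<Longrightarrow> A \<in> Obj C" "f \<in> hom C A B \<Longrightarrow> B \<in> Obj C"
  by (auto simp: hom_def)

lemma hom_eqI:
  assumes "f \<in> hom C A B" "g \<in> hom C A B" "\<And>s. s \<in> sharp_states C A \<Longrightarrow> f \<cdot> s = g \<cdot> s"
  shows "f = g"
proof -
  have "A \<in> Obj C" "B \<in> Obj C"
    using assms(1) by (auto simp: hom_def)
  then show ?thesis
    using enough assms unfolding enough_states_def by blast
qed

lemma sharp_comp:
  assumes "f \<in> hom C A B" "deterministic C f" "s \<in> sharp_states C A"
  shows "f \<cdot> s \<in> sharp_states C B"
  using assms det_comp[of s f] by (auto simp: sharp_states_def hom_def)

lemma comp_assoc_state:
  assumes "f \<in> hom C A B" "g \<in> hom C B D" "s \<in> sharp_states C A"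
  shows "(g \<cdot> f) \<cdot> s = g \<cdot> f \<cdot> s"
  using assms by (auto simp: sharp_states_def hom_def)

text \<open>On a sharp state \<open>s\<close>, both sides of the defining equation of determinism
  become copies of \<open>f \<cdot> s\<close>, which is sharp by assumption; enough states turn this
  into an equation of channels.\<close>

lemma detI:
  assumes f: "f \<in> hom C A B" and sharp: "\<And>s. s \<in> sharp_states C A \<Longrightarrow> f \<cdot> s \<in> sharp_states C B"
  shows "deterministic C f"
proof -
  have [simp]: "f \<in> Arr C" "Dom C f = A" "Cod C f = B" "A \<in> Obj C" "B \<in> Obj C"
    using f by (auto simp: hom_def)
  have "copy C B \<cdot> f = (f \<otimes> f) \<cdot> copy C A"
  proof (rule hom_eqI)
    fix s assume s: "s \<in> sharp_states C A"
    then have [simp]: "s \<in> Arr C" "Dom C s = unit_obj C" "Cod C s = A"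
      and cs: "copy C A \<cdot> s = (s \<otimes> s) \<cdot> copy C (unit_obj C)"
      by (auto simp: sharp_states_def hom_def deterministic_def)
    have "copy C B \<cdot> f \<cdot> s = ((f \<cdot> s) \<otimes> (f \<cdot> s)) \<cdot> copy C (unit_obj C)"
      using sharp[OF s] by (simp add: sharp_states_def deterministic_def)
    then show "(copy C B \<cdot> f) \<cdot> s = ((f \<otimes> f) \<cdot> copy C A) \<cdot> s"
      by (simp add: cs)
  qed (simp_all add: hom_def)
  then show ?thesis
    by (simp add: deterministic_def)
qed

text \<open>If \<open>A\<close> had no sharp state, all parallel channels out of \<open>A\<close> would be equal, so that \<open>A\<close>
  would be
  isomorphic to the unit and any state of \<open>A\<close> would be sharp after all.\<close>

lemma sharp_state_exists:
  assumes "hom C (unit_obj C) A \<noteq> {}"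
  shows "sharp_states C A \<noteq> {}"
proof
  assume empty: "sharp_states C A = {}"
  have eqI: "f = g" if "f \<in> hom C A B" "g \<in> hom C A B" for f g B
    using hom_eqI[OF that] empty by blast
  obtain x where x: "x \<in> hom C (unit_obj C) A"
    using assms by blast
  then have [simp]: "x \<in> Arr C" "Dom C x = unit_obj C" "Cod C x = A" "A \<in> Obj C"
    by (auto simp: hom_def)
  \<comment> \<open>Precomposing with \<open>disc C A\<close> makes both sides start at
    \<open>A\<close>, where \<open>eqI\<close> applies. Composing with \<open>x\<close> removes it
    again, since \<open>disc C A \<cdot> x\<close> is the identity of the unit.\<close>
  have "(copy C A \<cdot> x) \<cdot> disc C A = ((x \<otimes> x) \<cdot> copy C (unit_obj C)) \<cdot> disc C A"
    by (rule eqI) (simp_all add: hom_def)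
  then have "((copy C A \<cdot> x) \<cdot> disc C A) \<cdot> x = (((x \<otimes> x) \<cdot> copy C (unit_obj C)) \<cdot> disc C A) \<cdot> x"
    by simp
  then have "deterministic C x"
    by (simp add: deterministic_def)
  then show False
    using x empty by (auto simp: sharp_states_def)
qed

text \<open>By \<open>detI\<close> this is a question about states, and on a sharp state the pair is
  a tensor of two sharp states after \<open>copy C (unit_obj C)\<close>.\<close>

lemma det_pair:
  assumes "f \<in> hom C A B" "g \<in> hom C A D" "deterministic C f" "deterministic C g"
  shows "deterministic C (pair f g)"
proof (rule detI)
  show "pair f g \<in> hom C A (B \<boxtimes> D)"
    using assms by (simp add: hom_def)
next
  fix s assume s: "s \<in> sharp_states C A"
  \<comment> \<open>Both sides end in
    \<open>(I \<boxtimes> I) \<boxtimes> (I \<boxtimes> I)\<close>, which is again isomorphic to the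
    unit, so terminality identifies them.\<close>
  have copy: "deterministic C (copy C (unit_obj C))"
    unfolding deterministic_def
    by (simp, rule iso_cancel_left[OF iso_tens[OF lunit_iso[OF unit_Obj] lunit_iso[OF unit_Obj]]])
      (simp_all add: to_unit_tens_unit_eq)
  have "pair f g \<cdot> s = ((f \<cdot> s) \<otimes> (g \<cdot> s)) \<cdot> copy C (unit_obj C)"
    using assms(1,2) s pair_comp_det[of f g s] by (simp add: hom_def sharp_states_def pair_def)
  then show "pair f g \<cdot> s \<in> sharp_states C (B \<boxtimes> D)"
    using sharp_comp[OF assms(1,3) s] sharp_comp[OF assms(2,4) s]
    by (auto simp: sharp_states_def hom_def intro!: det_comp det_tens copy)
qed

section \<open>Projections and tuples for lists of wires\<close>

abbreviation wires :: "('x \<Rightarrow> 'a) \<Rightarrow> 'x list \<Rightarrow> 'a" where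
  "wires b xs \<equiv> big_tens_obj C (map b xs)"

lemma big_tens_obj_simps [simp]:
  "big_tens_obj C [] = unit_obj C" "big_tens_obj C (A # As) = A \<boxtimes> big_tens_obj C As"
  by (simp_all add: big_tens_obj_def)

lemma big_tens_arr_simps [simp]:
  "big_tens_arr C [] = ident C (unit_obj C)" "big_tens_arr C (f # fs) = f \<otimes> big_tens_arr C fs"
  by (simp_all add: big_tens_arr_def)

lemma big_tens_Obj [simp]: "set As \<subseteq> Obj C \<Longrightarrow> big_tens_obj C As \<in> Obj C"
  by (induction As) auto

lemma iso_big_tens: "(\<And>f. f \<in> set fs \<Longrightarrow> iso C f) \<Longrightarrow> iso C (big_tens_arr C fs)"
  by (induction fs) (auto intro: iso_tens iso_ident)

lemma proj_Cons_same: "proj C b (x # xs) x = pr1 (b x) (wires b xs)"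
  by (simp add: pr1_def)

text \<open>The last clause replaces the recursive case of \<open>proj\<close> by a composite with
  \<open>pr2\<close>, so that lists of wires can be treated as iterated pairs. It shares the
  induction with the other two because typing and determinism of the longer projection are deduced
  from it.\<close>

lemma proj_props:
  assumes "b ` set xs \<subseteq> Obj C" "y \<in> set xs"
  shows "proj C b xs y \<in> hom C (wires b xs) (b y) \<and> deterministic C (proj C b xs y) \<and>
    (\<forall>x. x \<noteq> y \<longrightarrow> b x \<in> Obj C \<longrightarrow> proj C b (x # xs) y = proj C b xs y \<cdot> pr2 (b x) (wires b xs))"
  using assms
proof (induction xs)
  case (Cons z xs)
  have [simp]: "b z \<in> Obj C" "wires b xs \<in> Obj C"
    using Cons.prems(1) by auto
  have 1: "proj C b (z # xs) y \<in> hom C (wires b (z # xs)) (b y)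
    \<and> deterministic C (proj C b (z # xs) y)"
  proof (cases "y = z")
    case True
    then show ?thesis
      using det_pr(1)[of "b z" "wires b xs"] by (simp add: proj_Cons_same hom_def del: proj.simps)
  next
    case False
    then have IH: "proj C b xs y \<in> hom C (wires b xs) (b y)" "deterministic C (proj C b xs y)"
      "proj C b (z # xs) y = proj C b xs y \<cdot> pr2 (b z) (wires b xs)"
      using Cons by auto
    then show ?thesis
      using det_comp[OF det_pr(2)[of "b z" "wires b xs"] IH(2)]
      by (simp add: hom_def del: proj.simps)
  qed
  have "proj C b (x # z # xs) y = proj C b (z # xs) y \<cdot> pr2 (b x) (wires b (z # xs))"
    if "x \<noteq> y" "b x \<in> Obj C" for x
  proof -
    let ?p = "proj C b (z # xs) y"
    have p: "?p \<in> Arr C" "Dom C ?p = b z \<boxtimes> wires b xs" "Cod C ?p = b y"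
      using 1 by (simp_all add: hom_def del: proj.simps)
    have "proj C b (x # z # xs) y = lunit C (b y) \<cdot> (disc C (b x) \<otimes> ?p)"
      using that by simp
    also have "disc C (b x) \<otimes> ?p =
      (ident C (unit_obj C) \<otimes> ?p) \<cdot> (disc C (b x) \<otimes> ident C (b z \<boxtimes> wires b xs))"
      using that p by (simp del: proj.simps)
    also have "lunit C (b y) \<cdot> \<dots> =
      (lunit C (b y) \<cdot> (ident C (unit_obj C) \<otimes> ?p)) \<cdot> (disc C (b x) \<otimes> ident C (b z \<boxtimes> wires b xs))"
      using that p Dom_Cod_Obj(2)[OF p(1)] by (subst comp_assoc_Arr) (simp_all del: proj.simps)
    also have "\<dots> = ?p \<cdot> pr2 (b x) (wires b (z # xs))"
      using that p lunit_natural_Arr[OF p(1)] by (simp add: pr2_def del: proj.simps)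
    finally show ?thesis .
  qed
  with 1 show ?case by blast
qed simp

lemmas proj_hom = proj_props[THEN conjunct1]
lemmas proj_det = proj_props[THEN conjunct2, THEN conjunct1]

lemma proj_Cons_other:
  assumes "b ` set xs \<subseteq> Obj C" "y \<in> set xs" "x \<noteq> y" "b x \<in> Obj C"
  shows "proj C b (x # xs) y = proj C b xs y \<cdot> pr2 (b x) (wires b xs)"
  using proj_props[OF assms(1,2)] assms(3,4) by blast

declare proj.simps [simp del]

text \<open>Iterates \<open>pair_pr_det\<close> along the list. Distinctness matters: of two wires
  with the same label, \<open>proj\<close> reaches only the first.\<close>

lemma sharp_proj_eqI:
  assumes "b ` set xs \<subseteq> Obj C" "distinct xs" "s \<in> sharp_states C (wires b xs)"
    "t \<in> sharp_states C (wires b xs)" "\<And>y. y \<in> set xs \<Longrightarrow> proj C b xs y \<cdot> s = proj C b xs y \<cdot> t"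
  shows "s = t"
  using assms
proof (induction xs arbitrary: s t)
  case Nil
  then show ?case
    by (intro to_unit_eq) (auto simp: sharp_states_def hom_def)
next
  case (Cons x xs)
  let ?p = "pr1 (b x) (wires b xs)" and ?q = "pr2 (b x) (wires b xs)"
  have [simp]: "b x \<in> Obj C" "wires b xs \<in> Obj C"
    using Cons.prems(1) by auto
  have q: "?q \<in> hom C (wires b (x # xs)) (wires b xs)" "deterministic C ?q"
    by (simp_all add: hom_def det_pr)
  have 1: "?p \<cdot> s = ?p \<cdot> t"
    using Cons.prems(5)[of x] by (simp add: proj_Cons_same)
  have 2: "?q \<cdot> s = ?q \<cdot> t"
  proof (rule Cons.IH)
    fix y assume y: "y \<in> set xs"
    then have ne: "x \<noteq> y" and ob: "b ` set xs \<subseteq> Obj C"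
      using Cons.prems by auto
    note p = proj_hom[OF ob y]
    show "proj C b xs y \<cdot> ?q \<cdot> s = proj C b xs y \<cdot> ?q \<cdot> t"
      using Cons.prems(5)[of y] y proj_Cons_other[OF ob y ne]
        comp_assoc_state[OF q(1) p Cons.prems(3)] comp_assoc_state[OF q(1) p Cons.prems(4)]
      by simp
  next
    show "?q \<cdot> s \<in> sharp_states C (wires b xs)" "?q \<cdot> t \<in> sharp_states C (wires b xs)"
      using sharp_comp[OF q] Cons.prems(3,4) by blast+
  qed (use Cons.prems in auto)
  have "pair (?p \<cdot> s) (?q \<cdot> s) = s" "pair (?p \<cdot> t) (?q \<cdot> t) = t"
    using sharp_stateD(3,4)[OF Cons.prems(3)] sharp_stateD(3,4)[OF Cons.prems(4)]
    by (simp_all add: pair_pr_det)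
  then show ?case
    using 1 2 by metis
qed

lemma ncopy_Arr [simp]:
  assumes "A \<in> Obj C"
  shows "ncopy C A n \<in> Arr C" "Dom C (ncopy C A n) = A"
    "Cod C (ncopy C A n) = big_tens_obj C (replicate n A)"
proof -
  have "ncopy C A n \<in> Arr C \<and> Dom C (ncopy C A n) = A \<and>
    Cod C (ncopy C A n) = big_tens_obj C (replicate n A)"
    using assms by (induction n) auto
  then show "ncopy C A n \<in> Arr C" "Dom C (ncopy C A n) = A"
    "Cod C (ncopy C A n) = big_tens_obj C (replicate n A)"
    by auto
qed

lemma big_tens_Arr:
  assumes "\<forall>f\<in>set fs. f \<in> Arr C"
  shows "big_tens_arr C fs \<in> Arr C \<and> Dom C (big_tens_arr C fs) = big_tens_obj C (map (Dom C) fs) \<and>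
    Cod C (big_tens_arr C fs) = big_tens_obj C (map (Cod C) fs)"
  using assms by (induction fs) auto

lemma tuple_Nil: "A \<in> Obj C \<Longrightarrow> tuple C A [] = disc C A"
  by (simp add: tuple_def)

lemma tuple_Cons:
  assumes "f \<in> hom C A B" "\<forall>g\<in>set fs. g \<in> Arr C \<and> Dom C g = A"
  shows "tuple C A (f # fs) = pair f (tuple C A fs)"
proof -
  have [simp]: "A \<in> Obj C" "f \<in> Arr C" "Dom C f = A" "Cod C f = B"
    using assms(1) by (auto simp: hom_def)
  have "map (Dom C) fs = replicate (length fs) A"
    using assms(2) by (induction fs) auto
  then have [simp]: "Dom C (big_tens_arr C fs) = big_tens_obj C (replicate (length fs) A)"
    "big_tens_arr C fs \<in> Arr C"
    using big_tens_Arr[of fs] assms(2) by auto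
  show ?thesis
    by (simp add: tuple_def pair_def)
qed

text \<open>Labels may repeat here, since every occurrence of \<open>y\<close> carries the same
  component \<open>g y\<close>. Determinism is needed for the last clause only.\<close>

lemma tuple_props:
  assumes "A \<in> Obj C" "\<forall>y\<in>set ys. g y \<in> hom C A (b y)"
  shows "tuple C A (map g ys) \<in> hom C A (wires b ys) \<and>
    (\<forall>y\<in>set ys. proj C b ys y \<cdot> tuple C A (map g ys) = g y) \<and>
    ((\<forall>y\<in>set ys. deterministic C (g y)) \<longrightarrow> deterministic C (tuple C A (map g ys)))"
  using assms(2)
proof (induction ys)
  case Nil
  then show ?case
    using assms(1) by (simp add: tuple_Nil hom_def det_disc)
next
  case (Cons x ys)
  let ?t = "tuple C A (map g ys)"
  have t: "?t \<in> hom C A (wires b ys)" "\<forall>y\<in>set ys. proj C b ys y \<cdot> ?t = g y"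
    "(\<forall>y\<in>set ys. deterministic C (g y)) \<Longrightarrow> deterministic C ?t"
    using Cons by auto
  have x: "g x \<in> hom C A (b x)"
    using Cons.prems by simp
  have tC: "tuple C A (map g (x # ys)) = pair (g x) ?t"
    using tuple_Cons[OF x, of "map g ys"] Cons.prems by (auto simp: hom_def)
  have ob: "b ` set ys \<subseteq> Obj C" "b x \<in> Obj C"
    using Cons.prems hom_Obj(2) by fastforce+
  have [simp]: "wires b ys \<in> Obj C"
    using ob by (auto simp: image_subset_iff)
  have 1: "pair (g x) ?t \<in> hom C A (wires b (x # ys))"
    using x t(1) by (simp add: hom_def)
  have 2: "proj C b (x # ys) y \<cdot> pair (g x) ?t = g y" if "y \<in> set (x # ys)" for y
  proof (cases "y = x")
    case True
    then show ?thesis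
      using x t(1) by (simp add: proj_Cons_same hom_def)
  next
    case False
    then have y: "y \<in> set ys"
      using that by simp
    have "proj C b (x # ys) y \<cdot> pair (g x) ?t =
      (proj C b ys y \<cdot> pr2 (b x) (wires b ys)) \<cdot> pair (g x) ?t"
      using proj_Cons_other[OF ob(1) y _ ob(2)] False by simp
    also have "\<dots> = proj C b ys y \<cdot> ?t"
      using x t(1) proj_hom[OF ob(1) y] ob by (simp add: hom_def)
    finally show ?thesis
      using t(2) y by simp
  qed
  have 3: "deterministic C (pair (g x) ?t)" if "\<forall>y\<in>set (x # ys). deterministic C (g y)"
    using det_pair[OF x t(1)] t(3) that by simp
  from 1 2 3 show ?case
    unfolding tC by blast
qed

lemma tuple_hom: "\<lbrakk>A \<in> Obj C; \<And>y. y \<in> set ys \<Longrightarrow> g y \<in> hom C A (b y)\<rbrakk>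
    \<Longrightarrow> tuple C A (map g ys) \<in> hom C A (wires b ys)"
  and proj_tuple: "\<lbrakk>A \<in> Obj C; \<And>y. y \<in> set ys \<Longrightarrow> g y \<in> hom C A (b y); y \<in> set ys\<rbrakk>
    \<Longrightarrow> proj C b ys y \<cdot> tuple C A (map g ys) = g y"
  and tuple_det: "\<lbrakk>A \<in> Obj C; \<And>y. y \<in> set ys \<Longrightarrow> g y \<in> hom C A (b y);
      \<And>y. y \<in> set ys \<Longrightarrow> deterministic C (g y)\<rbrakk>
    \<Longrightarrow> deterministic C (tuple C A (map g ys))"
  using tuple_props[of A ys g b] by blast+

lemma restr_hom:
  assumes "b ` set xs \<subseteq> Obj C" "set ys \<subseteq> set xs"
  shows "restr C b xs ys \<in> hom C (wires b xs) (wires b ys)"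
  unfolding restr_def using assms proj_hom[OF assms(1)] by (intro tuple_hom) auto

lemma restr_det:
  assumes "b ` set xs \<subseteq> Obj C" "set ys \<subseteq> set xs"
  shows "deterministic C (restr C b xs ys)"
  unfolding restr_def
  using assms proj_hom[OF assms(1)] proj_det[OF assms(1)] by (intro tuple_det[where b = b]) auto

lemma proj_restr:
  assumes "b ` set xs \<subseteq> Obj C" "set ys \<subseteq> set xs" "y \<in> set ys"
  shows "proj C b ys y \<cdot> restr C b xs ys = proj C b xs y"
  unfolding restr_def using assms proj_hom[OF assms(1)] by (intro proj_tuple) auto

lemma proj_restr_state:
  assumes "b ` set xs \<subseteq> Obj C" "set ys \<subseteq> set xs" "y \<in> set ys" "s \<in> sharp_states C (wires b xs)"
  shows "proj C b ys y \<cdot> restr C b xs ys \<cdot> s = proj C b xs y \<cdot> s"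
proof -
  have "b ` set ys \<subseteq> Obj C"
    using assms by auto
  from comp_assoc_state[OF restr_hom[OF assms(1,2)] proj_hom[OF this assms(3)] assms(4)]
  show ?thesis
    using proj_restr[OF assms(1-3)] by simp
qed

lemma restr_state:
  assumes "b ` set xs \<subseteq> Obj C" "set ys \<subseteq> set xs" "s \<in> sharp_states C (wires b xs)"
  shows "restr C b xs ys \<cdot> s \<in> sharp_states C (wires b ys)"
  using sharp_comp[OF restr_hom restr_det] assms by blast

text \<open>The two wire lists may differ. While \<open>run\<close> lengthens its list, the parents
  of a variable must be seen to carry the same joint state before and after.\<close>

lemma restr_state_eqI:
  assumes "b ` set xs \<subseteq> Obj C" "b ` set xs' \<subseteq> Obj C" "set ys \<subseteq> set xs" "set ys \<subseteq> set xs'"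
    "distinct ys" "s \<in> sharp_states C (wires b xs)" "t \<in> sharp_states C (wires b xs')"
    "\<And>y. y \<in> set ys \<Longrightarrow> proj C b xs y \<cdot> s = proj C b xs' y \<cdot> t"
  shows "restr C b xs ys \<cdot> s = restr C b xs' ys \<cdot> t"
proof (rule sharp_proj_eqI)
  show "b ` set ys \<subseteq> Obj C"
    using assms(1,3) by auto
  fix y assume "y \<in> set ys"
  then show "proj C b ys y \<cdot> restr C b xs ys \<cdot> s = proj C b ys y \<cdot> restr C b xs' ys \<cdot> t"
    using assms by (simp add: proj_restr_state)
qed (use assms restr_state in auto)

end

section \<open>Products over finite sets of variables\<close>

context states_category
begin

abbreviation coord :: "('x::linorder, 'a, 'z) variables_scheme \<Rightarrow> 'x set \<Rightarrow> 'x \<Rightarrow> 'b" where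
  "coord V S X \<equiv> proj C (ob V) (enum S) X"

lemma vars_subset:
  assumes "is_variables C V" "S \<subseteq> vars V"
  shows "finite S" "ob V ` S \<subseteq> Obj C" "set (enum S) = S" "ob V ` set (enum S) \<subseteq> Obj C"
    "tens C V S \<in> Obj C"
proof -
  show S: "finite S" "ob V ` S \<subseteq> Obj C"
    using assms finite_subset[OF assms(2)] unfolding is_variables_def by blast+
  then show "set (enum S) = S"
    by simp
  then show "ob V ` set (enum S) \<subseteq> Obj C"
    using S by simp
  then show "tens C V S \<in> Obj C"
    by (simp add: tens_def)
qed

lemma coord_hom:
  assumes "is_variables C V" "S \<subseteq> vars V" "X \<in> S"
  shows "coord V S X \<in> hom C (tens C V S) (ob V X)" "deterministic C (coord V S X)"
  using proj_hom[of "ob V" "enum S" X] proj_det[of "ob V" "enum S" X] vars_subset[OF assms(1,2)]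
    assms(3)
  by (auto simp: tens_def)

lemma marg_hom:
  assumes "is_variables C V" "X \<in> vars V"
  shows "marg C V X \<in> hom C (tens C V (vars V)) (ob V X)" "deterministic C (marg C V X)"
  using coord_hom[OF assms(1) order_refl assms(2)] by (simp_all add: marg_def)

lemma margs_hom:
  assumes "is_variables C V" "S \<subseteq> vars V"
  shows "margs C V S \<in> hom C (tens C V (vars V)) (tens C V S)" "deterministic C (margs C V S)"
  unfolding margs_def tens_def
  using restr_hom[of "ob V" "enum (vars V)" "enum S"] restr_det[of "ob V" "enum (vars V)" "enum S"]
    vars_subset[OF assms] vars_subset[OF assms(1) order_refl] assms(2)
  by auto

lemma marg_state:
  assumes "is_variables C V" "X \<in> vars V" "s \<in> sharp_states C (tens C V (vars V))"
  shows "marg C V X \<cdot> s \<in> sharp_states C (ob V X)"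
  using sharp_comp[OF marg_hom] assms by blast

lemma margs_state:
  assumes "is_variables C V" "S \<subseteq> vars V" "s \<in> sharp_states C (tens C V (vars V))"
  shows "margs C V S \<cdot> s \<in> sharp_states C (tens C V S)"
  using sharp_comp[OF margs_hom] assms by blast

lemma coord_margs:
  assumes "is_variables C V" "S \<subseteq> vars V" "X \<in> S" "s \<in> sharp_states C (tens C V (vars V))"
  shows "coord V S X \<cdot> margs C V S \<cdot> s = marg C V X \<cdot> s"
  unfolding margs_def marg_def
  using assms vars_subset[OF assms(1,2)] vars_subset[OF assms(1) order_refl]
  by (intro proj_restr_state) (auto simp: tens_def)

lemma coord_eqI:
  assumes "is_variables C V" "S \<subseteq> vars V" "s \<in> sharp_states C (tens C V S)"
    "t \<in> sharp_states C (tens C V S)" "\<And>X. X \<in> S \<Longrightarrow> coord V S X \<cdot> s = coord V S X \<cdot> t"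
  shows "s = t"
proof (rule sharp_proj_eqI[of "ob V" "enum S"])
  show "ob V ` set (enum S) \<subseteq> Obj C" "distinct (enum S)"
    using vars_subset(4)[OF assms(1,2)] by simp_all
  show "s \<in> sharp_states C (wires (ob V) (enum S))" "t \<in> sharp_states C (wires (ob V) (enum S))"
    using assms(3,4) by (simp_all add: tens_def)
  fix X assume "X \<in> set (enum S)"
  then show "coord V S X \<cdot> s = coord V S X \<cdot> t"
    using assms(5) vars_subset(3)[OF assms(1,2)] by blast
qed

lemma marg_eqI:
  assumes "is_variables C V" "s \<in> sharp_states C (tens C V (vars V))"
    "t \<in> sharp_states C (tens C V (vars V))"
    "\<And>X. X \<in> vars V \<Longrightarrow> marg C V X \<cdot> s = marg C V X \<cdot> t"
  shows "s = t"
  using coord_eqI[OF assms(1) order_refl assms(2,3)] assms(4) by (simp add: marg_def)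

lemma margs_eqI:
  assumes "is_variables C V" "S \<subseteq> vars V" "s \<in> sharp_states C (tens C V (vars V))"
    "t \<in> sharp_states C (tens C V (vars V))" "\<And>X. X \<in> S \<Longrightarrow> marg C V X \<cdot> s = marg C V X \<cdot> t"
  shows "margs C V S \<cdot> s = margs C V S \<cdot> t"
  using coord_eqI[OF assms(1,2) margs_state margs_state] assms coord_margs by metis

lemma margs_eqD:
  assumes "is_variables C V" "S \<subseteq> vars V" "s \<in> sharp_states C (tens C V (vars V))"
    "t \<in> sharp_states C (tens C V (vars V))" "margs C V S \<cdot> s = margs C V S \<cdot> t" "X \<in> S"
  shows "marg C V X \<cdot> s = marg C V X \<cdot> t"
  using assms coord_margs by metis

lemma margs_vars:
  assumes "is_variables C V"
  shows "margs C V (vars V) = ident C (tens C V (vars V))"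
proof (rule hom_eqI[OF margs_hom(1)[OF assms order_refl] ident_hom])
  show "tens C V (vars V) \<in> Obj C"
    using vars_subset[OF assms order_refl] by simp
  fix s assume s: "s \<in> sharp_states C (tens C V (vars V))"
  have "margs C V (vars V) \<cdot> s = s"
    using coord_eqI[OF assms order_refl margs_state[OF assms order_refl s] s]
      coord_margs[OF assms order_refl _ s] by (simp add: marg_def)
  then show "margs C V (vars V) \<cdot> s = ident C (tens C V (vars V)) \<cdot> s"
    using sharp_stateD[OF s] by simp
qed

end


section \<open>Solutions of a causal model\<close>

context states_category
begin

lemma causal_modelD:
  assumes "is_causal_model C M"
  shows "is_variables C M" "X \<in> vars M \<Longrightarrow> pa M X \<subseteq> vars M" "ins M \<subseteq> vars M" "nin M \<subseteq> vars M"
    "outs M \<subseteq> vars M" "X \<in> nin M \<Longrightarrow> mech M X \<in> hom C (tens C M (pa M X)) (ob M X)"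
    "X \<in> nin M \<Longrightarrow> X \<in> vars M" "X \<in> nin M \<Longrightarrow> X \<notin> ins M"
    "X \<in> vars M \<Longrightarrow> X \<notin> ins M \<Longrightarrow> X \<in> nin M"
  using assms by (auto simp: is_causal_model_def is_variables_def nin_def)

lemma par_comp_hom:
  assumes "is_causal_model C M" "X \<in> vars M"
  shows "par_comp C M X \<in> hom C (tens C M (vars M)) (ob M X)"
proof -
  note cm = causal_modelD[OF assms(1)]
  show ?thesis
    unfolding par_comp_def
    using marg_hom(1)[OF cm(1) assms(2)]
      comp_hom[OF margs_hom(1)[OF cm(1) cm(2)[OF assms(2)]] cm(6)[OF cm(9)[OF assms(2)]]]
    by simp
qed

lemma par_comp_det:
  assumes "is_causal_model C M" "deterministic_model C M" "X \<in> vars M"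
  shows "deterministic C (par_comp C M X)"
proof (cases "X \<in> ins M")
  case True
  then show ?thesis
    using marg_hom[OF causal_modelD(1)] assms by (simp add: par_comp_def)
next
  case False
  note cm = causal_modelD[OF assms(1)]
  have X: "X \<in> nin M"
    using cm(9) False assms(3) by blast
  then show ?thesis
    unfolding par_comp_def using False assms(2) margs_hom[OF cm(1) cm(2)[OF assms(3)]] cm(6)[OF X]
    by (auto simp: deterministic_model_def hom_def intro!: det_comp)
qed

lemma par_hom:
  assumes "is_causal_model C M"
  shows "par C M \<in> hom C (tens C M (vars M)) (tens C M (vars M))"
proof -
  note cm = causal_modelD[OF assms]
  have *: "tuple C (tens C M (vars M)) (map (par_comp C M) (enum (vars M)))
    \<in> hom C (tens C M (vars M)) (wires (ob M) (enum (vars M)))"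
    using vars_subset[OF cm(1) order_refl] par_comp_hom[OF assms] by (intro tuple_hom) auto
  then show ?thesis
    by (simp add: par_def tens_def)
qed

lemma par_det:
  assumes "is_causal_model C M" "deterministic_model C M"
  shows "deterministic C (par C M)"
proof -
  note cm = causal_modelD[OF assms(1)]
  show ?thesis
    unfolding par_def
    using vars_subset[OF cm(1) order_refl] par_comp_hom[OF assms(1)] par_comp_det[OF assms]
    by (intro tuple_det[where b = "ob M"]) auto
qed

lemma marg_par:
  assumes "is_causal_model C M" "X \<in> vars M"
  shows "marg C M X \<cdot> par C M = par_comp C M X"
proof -
  note cm = causal_modelD[OF assms(1)]
  show ?thesis
    unfolding par_def marg_def
    using vars_subset[OF cm(1) order_refl] par_comp_hom[OF assms(1)] assms(2)
    by (intro proj_tuple) auto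
qed

definition solves :: "('x::linorder, 'a, 'b) causal_model \<Rightarrow> 'b \<Rightarrow> bool" where
  "solves M u \<longleftrightarrow> u \<in> sharp_states C (tens C M (vars M)) \<and> par C M \<cdot> u = u"

text \<open>At an input the fixed point equation is vacuous, because its component of
  \<open>par\<close> is a projection; at the other variables it is the structural equation.\<close>

lemma solves_iff:
  assumes M: "is_causal_model C M" "deterministic_model C M"
    and u: "u \<in> sharp_states C (tens C M (vars M))"
  shows "solves M u \<longleftrightarrow> (\<forall>X\<in>nin M. marg C M X \<cdot> u = mech M X \<cdot> margs C M (pa M X) \<cdot> u)"
proof -
  note cm = causal_modelD[OF M(1)]
  have comp: "marg C M X \<cdot> par C M \<cdot> u =
      (if X \<in> ins M then marg C M X \<cdot> u else mech M X \<cdot> margs C M (pa M X) \<cdot> u)"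
    if X: "X \<in> vars M" for X
  proof -
    have "marg C M X \<cdot> par C M \<cdot> u = par_comp C M X \<cdot> u"
      using comp_assoc_state[OF par_hom[OF M(1)] marg_hom(1)[OF cm(1) X] u] marg_par[OF M(1) X] by
        simp
    also have "\<dots> = (if X \<in> ins M then marg C M X \<cdot> u else mech M X \<cdot> margs C M (pa M X) \<cdot> u)"
      using comp_assoc_state[OF margs_hom(1)[OF cm(1) cm(2)[OF X]] cm(6)[OF cm(9)[OF X]] u]
      by (simp add: par_comp_def)
    finally show ?thesis .
  qed
  have pu: "par C M \<cdot> u \<in> sharp_states C (tens C M (vars M))"
    using sharp_comp[OF par_hom[OF M(1)] par_det[OF M] u] .
  have "solves M u \<longleftrightarrow> (\<forall>X\<in>vars M. marg C M X \<cdot> par C M \<cdot> u = marg C M X \<cdot> u)"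
    using marg_eqI[OF cm(1) pu u] u by (auto simp: solves_def)
  also have "\<dots> \<longleftrightarrow> (\<forall>X\<in>nin M. marg C M X \<cdot> u = mech M X \<cdot> margs C M (pa M X) \<cdot> u)"
    using comp cm(7-9) by (metis (no_types, lifting))
  finally show ?thesis .
qed

lemma finite_parents:
  assumes "is_causal_model C M"
  shows "finite {(Y, X). X \<in> vars M \<and> Y \<in> pa M X}"
proof (rule finite_subset)
  show "{(Y, X). X \<in> vars M \<and> Y \<in> pa M X} \<subseteq> vars M \<times> vars M"
    using causal_modelD(2)[OF assms] by auto
  show "finite (vars M \<times> vars M)"
    using causal_modelD(1)[OF assms] by (simp add: is_variables_def)
qed

text \<open>Well-founded induction along the parent relation: agreement on all parents of
  \<open>X\<close> passes through the mechanism of \<open>X\<close>, and on inputs it is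
  given.\<close>

lemma solves_unique:
  assumes M: "is_causal_model C M" "deterministic_model C M"
    and "solves M u" "solves M v" "margs C M (ins M) \<cdot> u = margs C M (ins M) \<cdot> v"
  shows "u = v"
proof -
  note cm = causal_modelD[OF M(1)]
  have u: "u \<in> sharp_states C (tens C M (vars M))" and v: "v \<in> sharp_states C (tens C M (vars M))"
    using assms(3,4) by (simp_all add: solves_def)
  have "wf {(Y, X). X \<in> vars M \<and> Y \<in> pa M X}"
    using finite_acyclic_wf[OF finite_parents[OF M(1)]] M(1) by (simp add: is_causal_model_def)
  then have "X \<in> vars M \<longrightarrow> marg C M X \<cdot> u = marg C M X \<cdot> v" for X
  proof (induction X rule: wf_induct_rule)
    case (less X)
    show ?case
    proof
      assume X: "X \<in> vars M"
      show "marg C M X \<cdot> u = marg C M X \<cdot> v"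
      proof (cases "X \<in> ins M")
        case True
        then show ?thesis
          using margs_eqD[OF cm(1,3) u v assms(5)] by blast
      next
        case False
        have "margs C M (pa M X) \<cdot> u = margs C M (pa M X) \<cdot> v"
          using less cm(2)[OF X] X by (intro margs_eqI[OF cm(1,2) u v]) auto
        then show ?thesis
          using assms(3,4) solves_iff[OF M u] solves_iff[OF M v] cm(9)[OF X False] by simp
      qed
    qed
  qed
  then show ?thesis
    using marg_eqI[OF cm(1) u v] by blast
qed

section \<open>Solutions obtained by running the mechanisms in order\<close>

lemma topological_order_exists:
  assumes "is_causal_model C M"
  shows "\<exists>Xs. topological_order M Xs"
proof -
  let ?r = "{(Y, X). X \<in> vars M \<and> Y \<in> pa M X}"
  note cm = causal_modelD[OF assms]
  have wf: "wf (?r\<inverse>)"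
    using finite_acyclic_wf_converse[OF finite_parents[OF assms]] assms by (simp add:
      is_causal_model_def)
  \<comment> \<open>The claim is generalised to sets closed under non-input parents. A minimal
    element of \<open>A\<close> for the converse relation has no children in \<open>A\<close>, so
    removing it preserves closure and it can be put last.\<close>
  have "\<exists>Xs. distinct Xs \<and> set Xs = A \<and> (\<forall>i<length Xs. pa M (Xs ! i) \<subseteq> ins M \<union> set (take i Xs))"
    if "finite A" "A \<subseteq> nin M" "\<forall>X\<in>A. pa M X \<subseteq> ins M \<union> A" for A
    using that
  proof (induction A rule: finite_psubset_induct)
    case (psubset A)
    show ?case
    proof (cases "A = {}")
      case False
      then obtain X where X: "X \<in> A" "\<And>Y. (Y, X) \<in> ?r\<inverse> \<Longrightarrow> Y \<notin> A"
        using wfE_min'[OF wf] by blast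
      then have "\<forall>Y\<in>A. X \<notin> pa M Y"
        using psubset.prems(1) cm(4) by auto
      then have "\<exists>Xs. distinct Xs \<and> set Xs = A - {X} \<and>
          (\<forall>i<length Xs. pa M (Xs ! i) \<subseteq> ins M \<union> set (take i Xs))"
        using psubset.prems X(1) by (intro psubset.IH) blast+
      then obtain Xs where Xs: "distinct Xs" "set Xs = A - {X}"
          "\<forall>i<length Xs. pa M (Xs ! i) \<subseteq> ins M \<union> set (take i Xs)"
        by blast
      have "pa M X \<subseteq> ins M \<union> set Xs"
        using psubset.prems(2) X(1) Xs(2) \<open>\<forall>Y\<in>A. X \<notin> pa M Y\<close> by blast
      then have "\<forall>i<length (Xs @ [X]). pa M ((Xs @ [X]) ! i) \<subseteq> ins M \<union> set (take i (Xs @ [X]))"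
        using Xs(3) by (auto simp: nth_append less_Suc_eq)
      moreover have "distinct (Xs @ [X])" "set (Xs @ [X]) = A"
        using Xs(1,2) X(1) by auto
      ultimately show ?thesis by blast
    qed simp
  qed
  from this[of "nin M"] show ?thesis
    unfolding topological_order_def
    using cm(2,4,7,9) vars_subset(1)[OF cm(1) cm(4)] by blast
qed

text \<open>This is a single step of \<open>run\<close>: \<open>p\<close> adds the wire
  \<open>x\<close> in front and keeps the others. Freshness of \<open>x\<close> prevents an old
  label from being shadowed.\<close>

lemma proj_pair_ident:
  assumes "b ` set xs \<subseteq> Obj C" "m \<in> hom C (wires b xs) (b x)" "deterministic C m" "x \<notin> set xs"
    and s: "s \<in> sharp_states C (wires b xs)"
  defines "p \<equiv> pair m (ident C (wires b xs))"
  shows "p \<in> hom C (wires b xs) (wires b (x # xs))" "deterministic C p"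
    "proj C b (x # xs) x \<cdot> p \<cdot> s = m \<cdot> s"
    "y \<in> set xs \<Longrightarrow> proj C b (x # xs) y \<cdot> p \<cdot> s = proj C b xs y \<cdot> s"
proof -
  note sD = sharp_stateD[OF s]
  have [simp]: "b x \<in> Obj C" "wires b xs \<in> Obj C" "m \<in> Arr C" "Dom C m = wires b xs" "Cod C m = b x"
    using hom_Obj[OF assms(2)] assms(2) by (simp_all add: hom_def)
  show "p \<in> hom C (wires b xs) (wires b (x # xs))"
    by (simp add: p_def hom_def)
  show "deterministic C p"
    unfolding p_def by (rule det_pair[OF assms(2) ident_hom assms(3) det_ident]) simp_all
  have p: "p \<cdot> s = pair (m \<cdot> s) s"
    unfolding p_def using pair_comp_det[of m "ident C (wires b xs)" s] sD by simp
  show "proj C b (x # xs) x \<cdot> p \<cdot> s = m \<cdot> s"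
    using sD by (simp add: p proj_Cons_same)
  show "proj C b (x # xs) y \<cdot> p \<cdot> s = proj C b xs y \<cdot> s" if y: "y \<in> set xs"
  proof -
    have "proj C b (x # xs) y \<cdot> p \<cdot> s = (proj C b xs y \<cdot> pr2 (b x) (wires b xs)) \<cdot> pair (m \<cdot> s) s"
      using proj_Cons_other[OF assms(1) y] assms(4) y p by fastforce
    also have "\<dots> = proj C b xs y \<cdot> s"
      using homD[OF proj_hom[OF assms(1) y]] sD by simp
    finally show ?thesis .
  qed
qed

text \<open>The structural equations are stated with the parents read off the final wires
  \<open>ys\<close>, not off those present when a mechanism is applied. The two readings agree since
  wires are only added, and the final reading is the one that describes a solution.\<close>

lemma run_props:
  assumes M: "is_causal_model C M" "deterministic_model C M"
    and "set Xs \<subseteq> nin M" "set xs \<subseteq> vars M" "distinct (Xs @ xs)"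
    and "\<forall>i<length Xs. pa M (Xs ! i) \<subseteq> set xs \<union> set (take i Xs)"
  defines "ys \<equiv> rev Xs @ xs"
  shows "run C M xs Xs \<in> hom C (wires (ob M) xs) (wires (ob M) ys) \<and>
    deterministic C (run C M xs Xs) \<and>
    (\<forall>s\<in>sharp_states C (wires (ob M) xs).
      (\<forall>y\<in>set xs. proj C (ob M) ys y \<cdot> run C M xs Xs \<cdot> s = proj C (ob M) xs y \<cdot> s) \<and>
      (\<forall>X\<in>set Xs. proj C (ob M) ys X \<cdot> run C M xs Xs \<cdot> s =
        mech M X \<cdot> restr C (ob M) ys (enum (pa M X)) \<cdot> run C M xs Xs \<cdot> s))"
  using assms(3-6) unfolding ys_def
proof (induction Xs arbitrary: xs)
  case Nil
  have "wires (ob M) xs \<in> Obj C"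
    using Nil.prems(2) causal_modelD(1)[OF M(1)] unfolding is_variables_def
    by (intro big_tens_Obj) (simp, blast)
  then show ?case
    using sharp_stateD ident_hom det_ident by auto
next
  case (Cons X Xs)
  note cm = causal_modelD[OF M(1)]
  let ?b = "ob M"
  let ?zs = "rev Xs @ X # xs"
  define r where "r = restr C ?b xs (enum (pa M X))"
  define m where "m = mech M X \<cdot> r"
  define p where "p = pair m (ident C (wires ?b xs))"
  define R where "R = run C M (X # xs) Xs"
  have X: "X \<in> nin M" "X \<in> vars M"
    using Cons.prems(1) cm(4) by auto
  have obs: "?b ` vars M \<subseteq> Obj C"
    using cm(1) by (simp add: is_variables_def)
  then have xs: "?b ` set xs \<subseteq> Obj C"
    using Cons.prems(2) by blast
  have obj: "wires ?b xs \<in> Obj C"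
    using xs by simp
  have enum_pa: "set (enum (pa M Y)) = pa M Y" if "Y \<in> vars M" for Y
    using vars_subset(3)[OF cm(1,2)] that by blast
  have paX: "pa M X \<subseteq> set xs"
    using Cons.prems(4)[rule_format, of 0] by simp
  have r: "r \<in> hom C (wires ?b xs) (tens C M (pa M X))" "deterministic C r"
    using restr_hom[OF xs] restr_det[OF xs] paX enum_pa[OF X(2)] by (simp_all add: r_def tens_def)
  have m: "m \<in> hom C (wires ?b xs) (?b X)"
    unfolding m_def using comp_hom[OF r(1) cm(6)[OF X(1)]] .
  have mdet: "deterministic C m"
    unfolding m_def using r cm(6)[OF X(1)] M(2) X(1)
    by (auto simp: deterministic_model_def hom_def intro!: det_comp)
  have Xxs: "X \<notin> set xs"
    using Cons.prems(3) by simp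
  have phom: "p \<in> hom C (wires ?b xs) (wires ?b (X # xs))"
    using m obj hom_Obj(2)[OF m] by (simp add: p_def hom_def)
  have pdet: "deterministic C p"
    unfolding p_def using det_pair[OF m ident_hom mdet det_ident] obj by blast
  have run: "run C M xs (X # Xs) = R \<cdot> p"
    using m by (simp add: R_def p_def pair_def m_def r_def hom_def)
  \<comment> \<open>Once \<open>X\<close> is a wire, it moves from the prefix of processed variables
    to the initial wires, and all indices drop by one.\<close>
  have pas: "\<forall>i<length Xs. pa M (Xs ! i) \<subseteq> set (X # xs) \<union> set (take i Xs)"
  proof (intro allI impI)
    fix i assume "i < length Xs"
    then have "pa M ((X # Xs) ! Suc i) \<subseteq> set xs \<union> set (take (Suc i) (X # Xs))"
      using Cons.prems(4) by (metis Suc_less_eq length_Cons)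
    then show "pa M (Xs ! i) \<subseteq> set (X # xs) \<union> set (take i Xs)"
      by auto
  qed
  have IH: "R \<in> hom C (wires ?b (X # xs)) (wires ?b ?zs)" "deterministic C R"
    "\<forall>s\<in>sharp_states C (wires ?b (X # xs)).
      (\<forall>y\<in>set (X # xs). proj C ?b ?zs y \<cdot> R \<cdot> s = proj C ?b (X # xs) y \<cdot> s) \<and>
      (\<forall>Y\<in>set Xs. proj C ?b ?zs Y \<cdot> R \<cdot> s = mech M Y \<cdot> restr C ?b ?zs (enum (pa M Y)) \<cdot> R \<cdot> s)"
    using Cons.IH[of "X # xs"] Cons.prems X pas unfolding R_def by auto
  have zs: "set ?zs \<subseteq> vars M"
    using X(2) Cons.prems(1,2) cm(4) by auto
  then have zs_obj: "?b ` set ?zs \<subseteq> Obj C"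
    using obs by blast
  have main: "(\<forall>y\<in>set xs. proj C ?b ?zs y \<cdot> (R \<cdot> p) \<cdot> s = proj C ?b xs y \<cdot> s) \<and>
      (\<forall>Y\<in>set (X # Xs). proj C ?b ?zs Y \<cdot> (R \<cdot> p) \<cdot> s =
        mech M Y \<cdot> restr C ?b ?zs (enum (pa M Y)) \<cdot> (R \<cdot> p) \<cdot> s)"
    if s: "s \<in> sharp_states C (wires ?b xs)" for s
  proof -
    note pp = proj_pair_ident[OF xs m mdet Xxs s, folded p_def]
    have ps: "p \<cdot> s \<in> sharp_states C (wires ?b (X # xs))"
      using sharp_comp[OF phom pdet s] .
    have Rps: "R \<cdot> p \<cdot> s \<in> sharp_states C (wires ?b ?zs)"
      using sharp_comp[OF IH(1,2) ps] .
    have eq: "(R \<cdot> p) \<cdot> s = R \<cdot> p \<cdot> s"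
      using comp_assoc_state[OF phom IH(1) s] .
    have 1: "proj C ?b ?zs y \<cdot> R \<cdot> p \<cdot> s = proj C ?b xs y \<cdot> s" if "y \<in> set xs" for y
      using IH(3) ps pp(4) that by simp
    have "proj C ?b ?zs X \<cdot> R \<cdot> p \<cdot> s = m \<cdot> s"
      using IH(3) ps pp(3) by simp
    also have "\<dots> = mech M X \<cdot> r \<cdot> s"
      unfolding m_def using comp_assoc_state[OF r(1) cm(6)[OF X(1)] s] .
    \<comment> \<open>The mechanism of \<open>X\<close> took its parents from \<open>xs\<close>; by
      \<open>1\<close> the final wires still carry the same states there.\<close>
    also have "r \<cdot> s = restr C ?b ?zs (enum (pa M X)) \<cdot> R \<cdot> p \<cdot> s"
      unfolding r_def using xs zs_obj paX enum_pa[OF X(2)] s Rps 1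
      by (intro restr_state_eqI) auto
    finally have "proj C ?b ?zs X \<cdot> R \<cdot> p \<cdot> s =
      mech M X \<cdot> restr C ?b ?zs (enum (pa M X)) \<cdot> R \<cdot> p \<cdot> s" .
    then show ?thesis
      using 1 IH(3) ps by (simp add: eq)
  qed
  show ?case
    using main comp_hom[OF phom IH(1)] det_comp[OF pdet IH(2)] homD[OF phom] homD[OF IH(1)]
    unfolding run by simp
qed

text \<open>Any topological order makes the final state of \<open>run\<close> a solution, so the
  choice made inside \<open>io\<close> disappears from the description. Together with
  \<open>solves_unique\<close> this determines \<open>io C M\<close> on sharp states.\<close>

lemma io_solution:
  assumes M: "is_causal_model C M" "deterministic_model C M"
  shows "io C M \<in> hom C (tens C M (ins M)) (tens C M (outs M))"
    and "s \<in> sharp_states C (tens C M (ins M)) \<Longrightarrow>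
      \<exists>u. solves M u \<and> margs C M (ins M) \<cdot> u = s \<and> io C M \<cdot> s = margs C M (outs M) \<cdot> u"
proof -
  note cm = causal_modelD[OF M(1)]
  let ?b = "ob M"
  define Xs where "Xs = (SOME Xs. topological_order M Xs)"
  define xs where "xs = enum (ins M)"
  define ys where "ys = rev Xs @ xs"
  define R where "R = run C M xs Xs"
  have "topological_order M Xs"
    unfolding Xs_def using someI_ex[OF topological_order_exists[OF M(1)]] .
  then have Xs: "distinct Xs" "set Xs = nin M"
    "\<forall>i<length Xs. pa M (Xs ! i) \<subseteq> ins M \<union> set (take i Xs)"
    by (simp_all add: topological_order_def)
  have xs: "set xs = ins M" "distinct xs"
    using vars_subset(3)[OF cm(1,3)] by (simp_all add: xs_def)
  have ys: "set ys = vars M" "distinct ys"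
    using Xs xs cm(3) by (auto simp: ys_def nin_def)
  have ys_obj: "?b ` set ys \<subseteq> Obj C"
    using ys(1) cm(1) by (simp add: is_variables_def)
  have dist: "distinct (Xs @ xs)"
    using ys(2) by (auto simp: ys_def)
  have R: "R \<in> hom C (wires ?b xs) (wires ?b ys)" "deterministic C R"
    "\<forall>s\<in>sharp_states C (wires ?b xs).
      (\<forall>y\<in>set xs. proj C ?b ys y \<cdot> R \<cdot> s = proj C ?b xs y \<cdot> s) \<and>
      (\<forall>X\<in>set Xs. proj C ?b ys X \<cdot> R \<cdot> s = mech M X \<cdot> restr C ?b ys (enum (pa M X)) \<cdot> R \<cdot> s)"
    using run_props[OF M _ _ dist] Xs xs cm(3) unfolding R_def ys_def by auto
  have io: "io C M = restr C ?b ys (enum (outs M)) \<cdot> R"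
    by (simp add: io_def Let_def R_def ys_def xs_def Xs_def)
  have out: "set (enum (outs M)) \<subseteq> set ys"
    using vars_subset(3)[OF cm(1,5)] cm(5) ys(1) by simp
  show "io C M \<in> hom C (tens C M (ins M)) (tens C M (outs M))"
    unfolding io using comp_hom[OF R(1) restr_hom[OF ys_obj out]] by (simp add: tens_def xs_def)
  assume "s \<in> sharp_states C (tens C M (ins M))"
  then have s: "s \<in> sharp_states C (wires ?b xs)"
    by (simp add: tens_def xs_def)
  define t where "t = R \<cdot> s"
  have t: "t \<in> sharp_states C (wires ?b ys)"
    unfolding t_def using sharp_comp[OF R(1,2) s] .
  \<comment> \<open>The wires of \<open>t\<close> stand in the order of evaluation
    \<open>ys\<close>; \<open>u\<close> is the same state in the order used for sets of
    variables.\<close>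
  define u where "u = restr C ?b ys (enum (vars M)) \<cdot> t"
  have enum_vars: "set (enum (vars M)) = vars M"
    using vars_subset(3)[OF cm(1) order_refl] .
  have u: "u \<in> sharp_states C (tens C M (vars M))"
    unfolding u_def tens_def using restr_state[OF ys_obj _ t] enum_vars ys(1) by simp
  have marg_u: "marg C M X \<cdot> u = proj C ?b ys X \<cdot> t" if "X \<in> vars M" for X
    unfolding u_def marg_def using proj_restr_state[OF ys_obj _ _ t] enum_vars ys(1) that by simp
  have margs_u: "margs C M S \<cdot> u = restr C ?b ys (enum S) \<cdot> t" if "S \<subseteq> vars M" for S
    unfolding margs_def
    using vars_subset[OF cm(1) that] vars_subset[OF cm(1) order_refl] ys_obj ys(1) u t marg_u that
    by (intro restr_state_eqI) (auto simp: tens_def marg_def)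
  have "solves M u"
    unfolding solves_iff[OF M u]
  proof
    fix X assume X: "X \<in> nin M"
    then have "X \<in> vars M"
      using cm(7) by blast
    then show "marg C M X \<cdot> u = mech M X \<cdot> margs C M (pa M X) \<cdot> u"
      using marg_u margs_u[OF cm(2)] R(3) s Xs(2) X by (simp add: t_def)
  qed
  moreover have "margs C M (ins M) \<cdot> u = s"
  proof (rule coord_eqI[OF cm(1,3) margs_state[OF cm(1,3) u]])
    show "s \<in> sharp_states C (tens C M (ins M))" by fact
    fix X assume X: "X \<in> ins M"
    then have "X \<in> vars M"
      using cm(3) by blast
    have "coord M (ins M) X \<cdot> margs C M (ins M) \<cdot> u = proj C ?b ys X \<cdot> t"
      using coord_margs[OF cm(1,3) X u] marg_u[OF \<open>X \<in> vars M\<close>] by simp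
    then show "coord M (ins M) X \<cdot> margs C M (ins M) \<cdot> u = coord M (ins M) X \<cdot> s"
      using R(3) s xs(1) X by (simp add: t_def xs_def)
  qed
  moreover have "io C M \<cdot> s = margs C M (outs M) \<cdot> u"
    unfolding io margs_u[OF cm(5)] t_def using comp_assoc_state[OF R(1) restr_hom[OF ys_obj out]
      s] .
  ultimately show "\<exists>u. solves M u \<and> margs C M (ins M) \<cdot> u = s \<and> io C M \<cdot> s = margs C M (outs M) \<cdot> u"
    by blast
qed

end

section \<open>The model of a deterministic channel\<close>

text \<open>A section of \<open>margs C V S\<close>: the variables outside \<open>S\<close> are set
  to the states \<open>d\<close>. When these are sharp, the section is deterministic.\<close>

definition (in states_category) fill ::
    "('x::linorder, 'a, 'z) variables_scheme \<Rightarrow> ('x \<Rightarrow> 'b) \<Rightarrow> 'x set \<Rightarrow> 'b" where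
  "fill V d S = tuple C (tens C V S)
    (map (\<lambda>X. if X \<in> S then coord V S X else d X \<cdot> disc C (tens C V S)) (enum (vars V)))"

context states_category
begin

lemma fill_props:
  assumes V: "is_variables C V" and d: "\<forall>X\<in>vars V. d X \<in> sharp_states C (ob V X)"
    and S: "S \<subseteq> vars V"
  shows "fill V d S \<in> hom C (tens C V S) (tens C V (vars V))" "deterministic C (fill V d S)"
    and "\<lbrakk>s \<in> sharp_states C (tens C V S); X \<in> vars V\<rbrakk>
      \<Longrightarrow> marg C V X \<cdot> fill V d S \<cdot> s = (if X \<in> S then coord V S X \<cdot> s else d X)"
    and "margs C V S \<cdot> fill V d S = ident C (tens C V S)"
proof -
  let ?g = "\<lambda>X. if X \<in> S then coord V S X else d X \<cdot> disc C (tens C V S)"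
  have obj: "tens C V S \<in> Obj C"
    using vars_subset(5)[OF V S] .
  have enum_vars: "set (enum (vars V)) = vars V"
    using vars_subset(3)[OF V order_refl] .
  have g: "?g X \<in> hom C (tens C V S) (ob V X) \<and> deterministic C (?g X)" if X: "X \<in> vars V" for X
  proof (cases "X \<in> S")
    case True
    then show ?thesis
      using coord_hom[OF V S] by simp
  next
    case False
    have dX: "d X \<in> sharp_states C (ob V X)"
      using d X by blast
    show ?thesis
      using False obj sharp_stateD[OF dX] by (auto simp: hom_def intro!: det_comp det_disc)
  qed
  have "tuple C (tens C V S) (map ?g (enum (vars V))) \<in> hom C (tens C V S) (wires (ob V) (enum
    (vars V)))"
    using g enum_vars by (intro tuple_hom[OF obj]) blast
  then show hom: "fill V d S \<in> hom C (tens C V S) (tens C V (vars V))"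
    by (simp add: fill_def tens_def[of C V "vars V"])
  show det: "deterministic C (fill V d S)"
    unfolding fill_def using g enum_vars by (intro tuple_det[OF obj, of _ _ "ob V"]) blast+
  have proj: "marg C V X \<cdot> fill V d S = ?g X" if "X \<in> vars V" for X
    unfolding fill_def marg_def
    by (rule proj_tuple[OF obj]) (use g enum_vars that in blast)+
  show marg: "marg C V X \<cdot> fill V d S \<cdot> s = (if X \<in> S then coord V S X \<cdot> s else d X)"
    if s: "s \<in> sharp_states C (tens C V S)" and X: "X \<in> vars V" for s X
  proof -
    have dX: "d X \<in> sharp_states C (ob V X)"
      using d X by blast
    have "marg C V X \<cdot> fill V d S \<cdot> s = ?g X \<cdot> s"
      using comp_assoc_state[OF hom marg_hom(1)[OF V X] s] proj[OF X] by simp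
    then show ?thesis
      using sharp_stateD[OF dX] sharp_stateD[OF s] obj by simp
  qed
  show "margs C V S \<cdot> fill V d S = ident C (tens C V S)"
  proof (rule hom_eqI[OF comp_hom[OF hom margs_hom(1)[OF V S]] ident_hom[OF obj]])
    fix s assume s: "s \<in> sharp_states C (tens C V S)"
    have fs: "fill V d S \<cdot> s \<in> sharp_states C (tens C V (vars V))"
      using sharp_comp[OF hom det s] .
    have "margs C V S \<cdot> fill V d S \<cdot> s = s"
      using coord_margs[OF V S _ fs] marg[OF s] S
      by (intro coord_eqI[OF V S margs_state[OF V S fs] s]) auto
    then show "(margs C V S \<cdot> fill V d S) \<cdot> s = ident C (tens C V S) \<cdot> s"
      using comp_assoc_state[OF hom margs_hom(1)[OF V S] s] sharp_stateD[OF s] by simp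
  qed
qed

end

locale channel = states_category C for C :: "('o, 'm) markov_data" (structure) +
  fixes V :: "('v::linorder, 'o, 'z) variables_scheme" and d :: "'v \<Rightarrow> 'm" and F :: 'm
  assumes V: "is_variables C V"
    and default: "\<forall>X\<in>vars V. d X \<in> sharp_states C (ob V X)"
    and F: "F \<in> hom C (tens C V (vars V)) (tens C V (vars V))"
    and F_det: "deterministic C F"
begin

lemmas fill = fill_props[OF V default]

lemma marg_F_hom:
  assumes "X \<in> vars V"
  shows "marg C V X \<cdot> F \<in> hom C (tens C V (vars V)) (ob V X)" "deterministic C (marg C V X \<cdot> F)"
  using comp_hom[OF F marg_hom(1)[OF V assms]] det_comp[OF F_det marg_hom(2)[OF V assms]]
    homD[OF F] homD[OF marg_hom(1)[OF V assms]]
  by simp_all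

text \<open>Since \<open>fill V d P\<close> is a section of \<open>margs C V P\<close>, a
  factorisation through \<open>P\<close> determines its channel. This makes the description in
  \<open>chan_mech\<close> denote, and it exhibits the mechanism as a composite of deterministic
  channels.\<close>

lemma mech_eq_fill:
  assumes "factors_via C V F X P c"
  shows "c = (marg C V X \<cdot> F) \<cdot> fill V d P"
proof -
  have P: "P \<subseteq> vars V" and c: "c \<in> hom C (tens C V P) (ob V X)"
    and eq: "marg C V X \<cdot> F = c \<cdot> margs C V P"
    using assms by (auto simp: factors_via_def)
  have "(c \<cdot> margs C V P) \<cdot> fill V d P = c \<cdot> margs C V P \<cdot> fill V d P"
    using homD[OF margs_hom(1)[OF V P]] homD[OF fill(1)[OF P]] homD[OF c]
    by (intro comp_assoc_Arr) simp_all
  then show ?thesis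
    using eq fill(4)[OF P] homD[OF c] by simp
qed

text \<open>Resetting the variables outside \<open>P\<close> to default values does not affect \<open>F\<^sub>X\<close>; afterwards the
  variables in \<open>Q\<close> depend only on those in \<open>P \<inter> Q\<close>.\<close>

lemma factors_via_inter:
  assumes "factors_via C V F X P c" "factors_via C V F X Q c'"
  shows "\<exists>e. factors_via C V F X (P \<inter> Q) e"
proof -
  let ?N = "P \<inter> Q"
  have P: "P \<subseteq> vars V" and c: "c \<in> hom C (tens C V P) (ob V X)"
    and eqP: "marg C V X \<cdot> F = c \<cdot> margs C V P"
    using assms(1) by (auto simp: factors_via_def)
  have Q: "Q \<subseteq> vars V" and c': "c' \<in> hom C (tens C V Q) (ob V X)"
    and eqQ: "marg C V X \<cdot> F = c' \<cdot> margs C V Q"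
    using assms(2) by (auto simp: factors_via_def)
  have N: "?N \<subseteq> vars V"
    using P by blast
  define e where "e = c' \<cdot> margs C V Q \<cdot> fill V d ?N"
  have mf: "margs C V Q \<cdot> fill V d ?N \<in> hom C (tens C V ?N) (tens C V Q)"
    using comp_hom[OF fill(1)[OF N] margs_hom(1)[OF V Q]] .
  have e: "e \<in> hom C (tens C V ?N) (ob V X)"
    unfolding e_def using comp_hom[OF mf c'] .
  have "marg C V X \<cdot> F = e \<cdot> margs C V ?N"
  proof (rule hom_eqI)
    show "marg C V X \<cdot> F \<in> hom C (tens C V (vars V)) (ob V X)"
      unfolding eqP using comp_hom[OF margs_hom(1)[OF V P] c] .
    show "e \<cdot> margs C V ?N \<in> hom C (tens C V (vars V)) (ob V X)"
      using comp_hom[OF margs_hom(1)[OF V N] e] .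
    fix s assume s: "s \<in> sharp_states C (tens C V (vars V))"
    \<comment> \<open>\<open>c\<close> cannot distinguish \<open>s\<close> from \<open>s1\<close>,
      and \<open>c'\<close> cannot distinguish \<open>s1\<close> from \<open>s2\<close>, because
      \<open>s1\<close> and \<open>s2\<close> agree on \<open>Q\<close>. Only the variables in
      \<open>P \<inter> Q\<close> enter \<open>s2\<close>.\<close>
    define s1 where "s1 = fill V d P \<cdot> margs C V P \<cdot> s"
    define s2 where "s2 = fill V d ?N \<cdot> margs C V ?N \<cdot> s"
    have mP: "margs C V P \<cdot> s \<in> sharp_states C (tens C V P)"
      and mN: "margs C V ?N \<cdot> s \<in> sharp_states C (tens C V ?N)"
      using margs_state[OF V P s] margs_state[OF V N s] by auto
    have s1: "s1 \<in> sharp_states C (tens C V (vars V))"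
      unfolding s1_def using sharp_comp[OF fill(1,2)[OF P] mP] .
    have s2: "s2 \<in> sharp_states C (tens C V (vars V))"
      unfolding s2_def using sharp_comp[OF fill(1,2)[OF N] mN] .
    have marg1: "marg C V Y \<cdot> s1 = (if Y \<in> P then marg C V Y \<cdot> s else d Y)" if "Y \<in> vars V" for Y
      unfolding s1_def using fill(3)[OF P mP that] coord_margs[OF V P _ s] by simp
    have marg2: "marg C V Y \<cdot> s2 = (if Y \<in> ?N then marg C V Y \<cdot> s else d Y)" if "Y \<in> vars V" for Y
      unfolding s2_def using fill(3)[OF N mN that] coord_margs[OF V N _ s] by simp
    have "(marg C V X \<cdot> F) \<cdot> s = c \<cdot> margs C V P \<cdot> s"
      unfolding eqP using comp_assoc_state[OF margs_hom(1)[OF V P] c s] .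
    also have "margs C V P \<cdot> s = margs C V P \<cdot> s1"
      using marg1 P by (intro margs_eqI[OF V P s s1]) auto
    also have "c \<cdot> margs C V P \<cdot> s1 = (marg C V X \<cdot> F) \<cdot> s1"
      unfolding eqP using comp_assoc_state[OF margs_hom(1)[OF V P] c s1] by simp
    also have "\<dots> = c' \<cdot> margs C V Q \<cdot> s1"
      unfolding eqQ using comp_assoc_state[OF margs_hom(1)[OF V Q] c' s1] .
    also have "margs C V Q \<cdot> s1 = margs C V Q \<cdot> s2"
    proof (rule margs_eqI[OF V Q s1 s2])
      fix Y assume "Y \<in> Q"
      then have "Y \<in> vars V" "Y \<in> ?N \<longleftrightarrow> Y \<in> P"
        using Q by blast+
      then show "marg C V Y \<cdot> s1 = marg C V Y \<cdot> s2"
        using marg1[of Y] marg2[of Y] by simp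
    qed
    also have "c' \<cdot> margs C V Q \<cdot> s2 = e \<cdot> margs C V ?N \<cdot> s"
      unfolding s2_def e_def
      using homD[OF c'] homD[OF margs_hom(1)[OF V Q]] homD[OF fill(1)[OF N]] sharp_stateD[OF mN]
        by simp
    also have "\<dots> = (e \<cdot> margs C V ?N) \<cdot> s"
      using comp_assoc_state[OF margs_hom(1)[OF V N] e s] by simp
    finally show "(marg C V X \<cdot> F) \<cdot> s = (e \<cdot> margs C V ?N) \<cdot> s" .
  qed
  then show ?thesis
    using N e by (auto simp: factors_via_def)
qed

lemma factors_via_vars:
  assumes "X \<in> vars V"
  shows "factors_via C V F X (vars V) (marg C V X \<cdot> F)"
  using marg_F_hom[OF assms] homD[OF marg_F_hom(1)[OF assms]]
  by (simp add: factors_via_def margs_vars[OF V])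

text \<open>A set of least cardinality is also least for inclusion: its intersection with any
  competitor again admits a factorisation, so it cannot be smaller. The set of all variables is a
  first candidate.\<close>

lemma factors_via_chan_pa:
  assumes "X \<in> vars V"
  shows "\<exists>c. factors_via C V F X (chan_pa C V F X) c"
proof -
  let ?P = "\<lambda>P. \<exists>c. factors_via C V F X P c"
  obtain P where P: "?P P" and min: "\<And>Q. ?P Q \<Longrightarrow> card P \<le> card Q"
    using ex_has_least_nat[of ?P "vars V" card] factors_via_vars[OF assms] by blast
  have fin: "finite P"
    using P vars_subset(1)[OF V] by (auto simp: factors_via_def)
  have le: "P \<le> Q" if "?P Q" for Q
  proof -
    have "?P (P \<inter> Q)"
      using factors_via_inter P that by blast
    then have "P \<inter> Q = P"
      using min fin by (intro card_seteq) auto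
    then show ?thesis by blast
  qed
  have "chan_pa C V F X = P"
    unfolding chan_pa_def by (rule Least_equality) (use P le in blast)+
  then show ?thesis
    using P by simp
qed

lemma factors_via_chan_mech:
  assumes "X \<in> vars V"
  shows "factors_via C V F X (chan_pa C V F X) (chan_mech C V F X)"
proof -
  obtain c where c: "factors_via C V F X (chan_pa C V F X) c"
    using factors_via_chan_pa[OF assms] by blast
  show ?thesis
    unfolding chan_mech_def by (rule theI[where P =
      "factors_via C V F X (chan_pa C V F X)", OF c]) (metis c mech_eq_fill)
qed

lemma chan_mech_det:
  assumes "X \<in> vars V"
  shows "deterministic C (chan_mech C V F X)"
proof -
  note fac = factors_via_chan_mech[OF assms]
  have P: "chan_pa C V F X \<subseteq> vars V"
    using fac by (simp add: factors_via_def)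
  show ?thesis
    unfolding mech_eq_fill[OF fac]
    using det_comp[OF fill(2)[OF P] marg_F_hom(2)[OF assms]] homD[OF fill(1)[OF P]]
      homD[OF marg_F_hom(1)[OF assms]] by simp
qed

lemma chan_model_simps:
  "vars (chan_model C V F) = vars V" "ins (chan_model C V F) = chan_ins C V F"
  "outs (chan_model C V F) = vars V - chan_ins C V F" "ob (chan_model C V F) = ob V"
  "nin (chan_model C V F) = vars V - chan_ins C V F"
  "tens C (chan_model C V F) = tens C V" "marg C (chan_model C V F) = marg C V"
  "margs C (chan_model C V F) = margs C V"
  by (auto simp: chan_model_def nin_def tens_def[abs_def] marg_def[abs_def] margs_def[abs_def])

lemma chan_ins_subset: "chan_ins C V F \<subseteq> vars V"
  by (auto simp: chan_ins_def)

lemma chan_model_causal: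
  assumes "acyclic_chan C V F"
  shows "is_causal_model C (chan_model C V F)"
proof -
  let ?M = "chan_model C V F"
  have pa: "pa ?M X = (if X \<in> vars V - chan_ins C V F then chan_pa C V F X else {})" for X
    by (simp add: chan_model_def)
  have rel: "{(Y, X). X \<in> vars V \<and> Y \<in> pa ?M X} =
      {(Y, X). X \<in> vars V - chan_ins C V F \<and> Y \<in> chan_pa C V F X}"
    by (auto simp: pa)
  have fac: "chan_pa C V F X \<subseteq> vars V"
    "chan_mech C V F X \<in> hom C (tens C V (chan_pa C V F X)) (ob V X)" if "X \<in> vars V" for X
    using factors_via_chan_mech[OF that] by (simp_all add: factors_via_def)
  have mech: "mech ?M X = chan_mech C V F X" if "X \<in> vars V - chan_ins C V F" for X
    using that by (simp add: chan_model_def)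
  have "is_variables C ?M"
    using V chan_ins_subset by (auto simp: is_variables_def chan_model_simps)
  moreover have "\<forall>X\<in>vars V. pa ?M X \<subseteq> vars V"
    using fac(1) by (simp add: pa)
  moreover have "\<forall>X\<in>chan_ins C V F. pa ?M X = {}"
    by (simp add: pa)
  moreover have "\<forall>X\<in>vars V - chan_ins C V F. mech ?M X \<in> hom C (tens C V (pa ?M X)) (ob V X)"
    using fac(2) mech by (simp add: pa)
  ultimately show ?thesis
    using assms by (simp add: is_causal_model_def chan_model_simps rel acyclic_chan_def)
qed

lemma chan_model_det: "deterministic_model C (chan_model C V F)"
  using chan_mech_det by (simp add: deterministic_model_def chan_model_simps) (simp add:
    chan_model_def)

text \<open>No information is lost in passing to the model: its parallel channel is \<open>F\<close>
  again. Solutions of the model are therefore the sharp fixed points of \<open>F\<close>.\<close>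

lemma par_chan_model:
  assumes "acyclic_chan C V F"
  shows "par C (chan_model C V F) = F"
proof -
  let ?M = "chan_model C V F"
  note M = chan_model_causal[OF assms]
  have par_comp: "par_comp C ?M X = marg C V X \<cdot> F" if X: "X \<in> vars V" for X
  proof (cases "X \<in> chan_ins C V F")
    case True
    then show ?thesis
      by (simp add: par_comp_def chan_model_simps) (simp add: chan_ins_def)
  next
    case False
    then show ?thesis
      using X factors_via_chan_mech[OF X]
      by (simp add: par_comp_def chan_model_simps) (simp add: chan_model_def factors_via_def)
  qed
  have hom: "par C ?M \<in> hom C (tens C V (vars V)) (tens C V (vars V))"
    using par_hom[OF M] by (simp add: chan_model_simps)
  show ?thesis
  proof (rule hom_eqI[OF hom F])
    fix s assume s: "s \<in> sharp_states C (tens C V (vars V))"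
    show "par C ?M \<cdot> s = F \<cdot> s"
    proof (rule marg_eqI[OF V])
      show "par C ?M \<cdot> s \<in> sharp_states C (tens C V (vars V))"
        using sharp_comp[OF hom par_det[OF M chan_model_det] s] .
      show "F \<cdot> s \<in> sharp_states C (tens C V (vars V))"
        using sharp_comp[OF F F_det s] .
      fix X assume X: "X \<in> vars V"
      have "marg C V X \<cdot> par C ?M = marg C V X \<cdot> F"
        using marg_par[OF M, of X] par_comp[OF X] X by (simp add: chan_model_simps)
      then show "marg C V X \<cdot> par C ?M \<cdot> s = marg C V X \<cdot> F \<cdot> s"
        using comp_assoc_state[OF hom marg_hom(1)[OF V X] s]
          comp_assoc_state[OF F marg_hom(1)[OF V X] s] by simp
    qed
  qed
qed

end

section \<open>Induced models\<close>

context states_category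
begin

lemma pair_eqD:
  assumes "pair f g = pair f' g'" "f \<in> hom C A B" "f' \<in> hom C A B" "g \<in> hom C A D" "g' \<in> hom C A D"
  shows "f = f'" "g = g'"
proof -
  have "pr1 B D \<cdot> pair f g = pr1 B D \<cdot> pair f' g'" "pr2 B D \<cdot> pair f g = pr2 B D \<cdot> pair f' g'"
    using assms(1) by simp_all
  then show "f = f'" "g = g'"
    using assms(2-5) by (simp_all add: hom_def)
qed

lemma split_in_pair:
  assumes "is_variables C V"
  shows "split_in C V = pair (margs C V (ins V)) (margs C V (nin V))"
  using margs_hom(1)[OF assms, of "ins V"] assms
  by (simp add: split_in_def pair_def hom_def is_variables_def)

text \<open>Determinism of \<rho> makes \<open>split_in C W \<cdot> \<rho>\<close> a pair of
  marginals of \<rho>; the other side is a pair as well, and the components of equal pairs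
  agree.\<close>

lemma decomposes_margs:
  assumes V: "is_variables C V" and W: "is_variables C W"
    and \<rho>: "det_iso C V W \<rho>" and dec: "decomposes C V W \<rho> \<rho>in \<rho>nin"
  shows "margs C W (ins W) \<cdot> \<rho> = \<rho>in \<cdot> margs C V (ins V)"
    and "margs C W (nin W) \<cdot> \<rho> = \<rho>nin \<cdot> margs C V (nin V)"
proof -
  have sub: "ins V \<subseteq> vars V" "nin V \<subseteq> vars V" "ins W \<subseteq> vars W" "nin W \<subseteq> vars W"
    using V W by (auto simp: is_variables_def nin_def)
  have \<rho>hom: "\<rho> \<in> hom C (tens C V (vars V)) (tens C W (vars W))" and \<rho>det: "deterministic C \<rho>"
    using \<rho> by (simp_all add: det_iso_def)
  have \<rho>i: "\<rho>in \<in> hom C (tens C V (ins V)) (tens C W (ins W))"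
    and \<rho>n: "\<rho>nin \<in> hom C (tens C V (nin V)) (tens C W (nin W))"
    and eq: "split_in C W \<cdot> \<rho> = (\<rho>in \<otimes> \<rho>nin) \<cdot> split_in C V"
    using dec by (simp_all add: decomposes_def)
  note mV = margs_hom(1)[OF V sub(1)] margs_hom(1)[OF V sub(2)]
  note mW = margs_hom(1)[OF W sub(3)] margs_hom(1)[OF W sub(4)]
  have obj: "tens C V (vars V) \<in> Obj C"
    using hom_Obj(1)[OF \<rho>hom] .
  have "split_in C W \<cdot> \<rho> = pair (margs C W (ins W) \<cdot> \<rho>) (margs C W (nin W) \<cdot> \<rho>)"
    unfolding split_in_pair[OF W] using \<rho>det homD[OF \<rho>hom] homD[OF mW(1)] homD[OF mW(2)]
    by (intro pair_comp_det) simp_all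
  moreover have "(\<rho>in \<otimes> \<rho>nin) \<cdot> split_in C V =
    pair (\<rho>in \<cdot> margs C V (ins V)) (\<rho>nin \<cdot> margs C V (nin V))"
    unfolding split_in_pair[OF V] pair_def
    using homD[OF \<rho>i] homD[OF \<rho>n] homD[OF mV(1)] homD[OF mV(2)] obj by simp
  ultimately have "pair (margs C W (ins W) \<cdot> \<rho>) (margs C W (nin W) \<cdot> \<rho>) =
      pair (\<rho>in \<cdot> margs C V (ins V)) (\<rho>nin \<cdot> margs C V (nin V))"
    using eq by simp
  from pair_eqD[OF this comp_hom[OF \<rho>hom mW(1)] comp_hom[OF mV(1) \<rho>i] comp_hom[OF \<rho>hom mW(2)]
    comp_hom[OF mV(2) \<rho>n]]
  show "margs C W (ins W) \<cdot> \<rho> = \<rho>in \<cdot> margs C V (ins V)"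
    "margs C W (nin W) \<cdot> \<rho> = \<rho>nin \<cdot> margs C V (nin V)"
    by auto
qed

text \<open>\<open>f\<close> is recovered from \<open>f \<cdot> margs C V S\<close> by composing
  with the deterministic section \<open>fill V d S\<close>.\<close>

lemma det_of_comp_margs:
  assumes V: "is_variables C V" and d: "\<forall>X\<in>vars V. d X \<in> sharp_states C (ob V X)"
    and S: "S \<subseteq> vars V" and f: "f \<in> hom C (tens C V S) B" and det: "deterministic C (f \<cdot>
      margs C V S)"
  shows "deterministic C f"
proof -
  note fill = fill_props[OF V d S]
  have "(f \<cdot> margs C V S) \<cdot> fill V d S = f"
    using fill(4) homD[OF f] homD[OF fill(1)] homD[OF margs_hom(1)[OF V S]] by simp
  then show ?thesis
    using det_comp[OF fill(2) det] homD[OF f] homD[OF fill(1)] homD[OF margs_hom(1)[OF V S]] by simp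
qed

text \<open>\<open>decomposes\<close> asks only for isomorphisms, while an upward abstraction
  requires deterministic channels. Determinism is inherited from \<rho> through the
  marginals.\<close>

lemma decomposes_det:
  assumes V: "is_variables C V" and W: "is_variables C W"
    and d: "\<forall>X\<in>vars V. d X \<in> sharp_states C (ob V X)"
    and \<rho>: "det_iso C V W \<rho>" and dec: "decomposes C V W \<rho> \<rho>in \<rho>nin"
  shows "deterministic C \<rho>in" "deterministic C \<rho>nin"
proof -
  have sub: "ins V \<subseteq> vars V" "nin V \<subseteq> vars V" "ins W \<subseteq> vars W" "nin W \<subseteq> vars W"
    using V W by (auto simp: is_variables_def nin_def)
  have \<rho>hom: "\<rho> \<in> hom C (tens C V (vars V)) (tens C W (vars W))" and \<rho>det: "deterministic C \<rho>"
    using \<rho> by (simp_all add: det_iso_def)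
  have \<rho>i: "\<rho>in \<in> hom C (tens C V (ins V)) (tens C W (ins W))"
    and \<rho>n: "\<rho>nin \<in> hom C (tens C V (nin V)) (tens C W (nin W))"
    using dec by (simp_all add: decomposes_def)
  have det: "deterministic C (margs C W S \<cdot> \<rho>)" if "S \<subseteq> vars W" for S
    using det_comp[OF \<rho>det margs_hom(2)[OF W that]] homD[OF \<rho>hom] homD[OF margs_hom(1)[OF W that]]
    by simp
  show "deterministic C \<rho>in" "deterministic C \<rho>nin"
    using det_of_comp_margs[OF V d sub(1) \<rho>i] det_of_comp_margs[OF V d sub(2) \<rho>n]
      det[OF sub(3)] det[OF sub(4)] decomposes_margs[OF V W \<rho> dec] by simp_all
qed

text \<open>The hypothesis on states concerns the variables of \<open>V\<close>. A joint sharp state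
  of these is pushed forward along \<rho>, and its marginals supply sharp states for
  \<open>W\<close>.\<close>

lemma default_states_transfer:
  assumes V: "is_variables C V" and W: "is_variables C W"
    and d: "\<forall>X\<in>vars V. d X \<in> sharp_states C (ob V X)"
    and \<rho>: "\<rho> \<in> hom C (tens C V (vars V)) (tens C W (vars W))" "deterministic C \<rho>"
  shows "\<exists>d'. \<forall>X\<in>vars W. d' X \<in> sharp_states C (ob W X)"
proof -
  define s where "s = tuple C (unit_obj C) (map d (enum (vars V)))"
  have set: "set (enum (vars V)) = vars V"
    using vars_subset(3)[OF V order_refl] .
  have dh: "d X \<in> hom C (unit_obj C) (ob V X)" "deterministic C (d X)" if "X \<in> vars V" for X
    using d that by (auto simp: sharp_states_def)
  have "s \<in> hom C (unit_obj C) (wires (ob V) (enum (vars V)))"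
    unfolding s_def by (rule tuple_hom) (use dh set in auto)
  moreover have "deterministic C s"
    unfolding s_def by (rule tuple_det[where b = "ob V"]) (use dh set in auto)
  ultimately have "s \<in> sharp_states C (tens C V (vars V))"
    by (simp add: sharp_states_def tens_def)
  then have "\<rho> \<cdot> s \<in> sharp_states C (tens C W (vars W))"
    using sharp_comp[OF \<rho>] by blast
  then show ?thesis
    using marg_state[OF W] by (intro exI[of _ "\<lambda>X. marg C W X \<cdot> \<rho> \<cdot> s"]) blast
qed

lemma conj_chan_hom:
  assumes M: "is_causal_model C M" "deterministic_model C M" and \<rho>: "det_iso C M W \<rho>"
  shows "conj_chan C \<rho> M \<in> hom C (tens C W (vars W)) (tens C W (vars W))"
    "deterministic C (conj_chan C \<rho> M)"
    "conj_chan C \<rho> M \<cdot> \<rho> = \<rho> \<cdot> par C M"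
proof -
  have \<rho>': "\<rho> \<in> hom C (tens C M (vars M)) (tens C W (vars W))" "iso C \<rho>" "deterministic C \<rho>"
    using \<rho> by (simp_all add: det_iso_def)
  note inv = inv_arr_props[OF \<rho>'(2)]
  have [simp]: "\<rho> \<in> Arr C" "Dom C \<rho> = tens C M (vars M)" "Cod C \<rho> = tens C W (vars W)"
    "par C M \<in> Arr C" "Dom C (par C M) = tens C M (vars M)" "Cod C (par C M) = tens C M (vars M)"
    using homD[OF \<rho>'(1)] homD[OF par_hom[OF M(1)]] by simp_all
  show "conj_chan C \<rho> M \<in> hom C (tens C W (vars W)) (tens C W (vars W))"
    "conj_chan C \<rho> M \<cdot> \<rho> = \<rho> \<cdot> par C M"
    by (simp_all add: conj_chan_def hom_def inv)
  show "deterministic C (conj_chan C \<rho> M)"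
    unfolding conj_chan_def
    by (intro det_comp \<rho>'(3) par_det[OF M] det_inv_arr[OF \<rho>'(2,3)]) (simp_all add: inv)
qed

text \<open>Interventions whose induced mechanisms coincide must have had the same parallel channel;
  this is where the invertibility of \<rho> gives that conclusion.\<close>

lemma conj_chan_inject:
  assumes "is_causal_model C M" "deterministic_model C M" "det_iso C M W \<rho>"
    and "is_causal_model C M'" "deterministic_model C M'" "det_iso C M' W \<rho>"
    and eq: "conj_chan C \<rho> M = conj_chan C \<rho> M'"
  shows "par C M = par C M'"
proof (rule iso_cancel_left)
  show "iso C \<rho>"
    using assms(3) by (simp add: det_iso_def)
  show "\<rho> \<cdot> par C M = \<rho> \<cdot> par C M'"
    using conj_chan_hom(3)[OF assms(1-3)] conj_chan_hom(3)[OF assms(4-6)] eq by simp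
  show "par C M \<in> Arr C" "par C M' \<in> Arr C" "Cod C (par C M) = Dom C \<rho>" "Cod C (par C M') = Dom C \<rho>"
    using homD[OF par_hom[OF assms(1)]] homD[OF par_hom[OF assms(4)]] assms(3,6)
    by (auto simp: det_iso_def hom_def)
qed

lemma ind_model_props:
  assumes M: "is_causal_model C M" "deterministic_model C M"
    and d: "\<forall>X\<in>vars M. d X \<in> sharp_states C (ob M X)"
    and W: "is_variables C W" and resp: "respects_model C W \<rho> M"
  defines "H \<equiv> ind_model C W \<rho> M"
  shows "is_causal_model C H" "deterministic_model C H" "par C H = conj_chan C \<rho> M"
    "vars H = vars W" "ins H = ins W" "outs H = nin W" "nin H = nin W"
    "tens C H = tens C W" "margs C H = margs C W"
proof -
  have \<rho>: "det_iso C M W \<rho>" and acyc: "acyclic_chan C W (conj_chan C \<rho> M)"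
    and ins: "chan_ins C W (conj_chan C \<rho> M) = ins W"
    using resp by (simp_all add: respects_model_def)
  obtain d' where d': "\<forall>X\<in>vars W. d' X \<in> sharp_states C (ob W X)"
    using default_states_transfer[OF causal_modelD(1)[OF M(1)] W d] \<rho> by (auto simp: det_iso_def)
  interpret channel C W d' "conj_chan C \<rho> M"
    using W d' conj_chan_hom[OF M \<rho>] by unfold_locales
  show "is_causal_model C H" "deterministic_model C H" "par C H = conj_chan C \<rho> M"
    unfolding H_def ind_model_def
    using chan_model_causal[OF acyc] chan_model_det par_chan_model[OF acyc] by simp_all
  show "vars H = vars W" "ins H = ins W" "outs H = nin W" "nin H = nin W"
    "tens C H = tens C W" "margs C H = margs C W"
    unfolding H_def ind_model_def by (simp_all add: chan_model_simps ins nin_def)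
qed

text \<open>\<open>\<rho>\<close> maps solutions of \<open>M\<close> to solutions of the induced model, and a solution is determined by
  its inputs.\<close>

lemma ind_model_io:
  assumes M: "is_causal_model C M" "deterministic_model C M" and outs: "outs M = nin M"
    and d: "\<forall>X\<in>vars M. d X \<in> sharp_states C (ob M X)"
    and W: "is_variables C W" and resp: "respects_model C W \<rho> M"
    and dec: "decomposes C M W \<rho> \<rho>in \<rho>nin"
  shows "\<rho>nin \<cdot> io C M = io C (ind_model C W \<rho> M) \<cdot> \<rho>in"
proof -
  let ?H = "ind_model C W \<rho> M"
  note H = ind_model_props[OF M d W resp]
  note cm = causal_modelD[OF M(1)]
  have \<rho>: "det_iso C M W \<rho>"
    using resp by (simp add: respects_model_def)
  then have \<rho>hom: "\<rho> \<in> hom C (tens C M (vars M)) (tens C W (vars W))" and \<rho>det: "deterministic C \<rho>"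
    by (simp_all add: det_iso_def)
  have \<rho>i: "\<rho>in \<in> hom C (tens C M (ins M)) (tens C W (ins W))"
    and \<rho>n: "\<rho>nin \<in> hom C (tens C M (nin M)) (tens C W (nin W))"
    using dec by (simp_all add: decomposes_def)
  have subW: "ins W \<subseteq> vars W" "nin W \<subseteq> vars W"
    using W by (auto simp: is_variables_def nin_def)
  note dm = decomposes_margs[OF cm(1) W \<rho> dec]
  have ioM: "io C M \<in> hom C (tens C M (ins M)) (tens C M (nin M))"
    using io_solution(1)[OF M] outs by simp
  have ioH: "io C ?H \<in> hom C (tens C W (ins W)) (tens C W (nin W))"
    using io_solution(1)[OF H(1,2)] by (simp add: H)
  show ?thesis
  proof (rule hom_eqI[OF comp_hom[OF ioM \<rho>n] comp_hom[OF \<rho>i ioH]])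
    fix s assume s: "s \<in> sharp_states C (tens C M (ins M))"
    obtain u where u: "solves M u" "margs C M (ins M) \<cdot> u = s" "io C M \<cdot> s = margs C M (nin M) \<cdot> u"
      using io_solution(2)[OF M s] outs by auto
    have us: "u \<in> sharp_states C (tens C M (vars M))" and pu: "par C M \<cdot> u = u"
      using u(1) by (simp_all add: solves_def)
    have \<rho>u: "\<rho> \<cdot> u \<in> sharp_states C (tens C W (vars W))"
      using sharp_comp[OF \<rho>hom \<rho>det us] .
    have "par C ?H \<cdot> \<rho> \<cdot> u = (conj_chan C \<rho> M \<cdot> \<rho>) \<cdot> u"
      unfolding H(3) using comp_assoc_state[OF \<rho>hom conj_chan_hom(1)[OF M \<rho>] us] by simp
    also have "\<dots> = \<rho> \<cdot> u"
      unfolding conj_chan_hom(3)[OF M \<rho>] using comp_assoc_state[OF par_hom[OF M(1)] \<rho>hom us] pu by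
        simp
    finally have w: "solves ?H (\<rho> \<cdot> u)"
      using \<rho>u by (simp add: solves_def H)
    have \<rho>ins: "margs C W (ins W) \<cdot> \<rho> \<cdot> u = \<rho>in \<cdot> s"
      using comp_assoc_state[OF \<rho>hom margs_hom(1)[OF W subW(1)] us]
        comp_assoc_state[OF margs_hom(1)[OF cm(1,3)] \<rho>i us] dm(1) u(2) by simp
    have \<rho>nins: "margs C W (nin W) \<cdot> \<rho> \<cdot> u = \<rho>nin \<cdot> io C M \<cdot> s"
      using comp_assoc_state[OF \<rho>hom margs_hom(1)[OF W subW(2)] us]
        comp_assoc_state[OF margs_hom(1)[OF cm(1,4)] \<rho>n us] dm(2) u(3) by simp
    \<comment> \<open>Sharpness is read off the solution: \<open>\<rho>in \<cdot> s\<close> is the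
      input marginal of the sharp state \<open>\<rho> \<cdot> u\<close>.\<close>
    have \<rho>s: "\<rho>in \<cdot> s \<in> sharp_states C (tens C ?H (ins ?H))"
      using margs_state[OF W subW(1) \<rho>u] by (simp add: H \<rho>ins)
    obtain v where v: "solves ?H v" "margs C W (ins W) \<cdot> v = \<rho>in \<cdot> s"
        "io C ?H \<cdot> \<rho>in \<cdot> s = margs C W (nin W) \<cdot> v"
      using io_solution(2)[OF H(1,2) \<rho>s] by (auto simp: H)
    have "v = \<rho> \<cdot> u"
      using solves_unique[OF H(1,2) v(1) w] v(2) \<rho>ins by (simp add: H)
    then have "\<rho>nin \<cdot> io C M \<cdot> s = io C ?H \<cdot> \<rho>in \<cdot> s"
      using v(3) \<rho>nins by simp
    then show "(\<rho>nin \<cdot> io C M) \<cdot> s = (io C ?H \<cdot> \<rho>in) \<cdot> s"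
      using comp_assoc_state[OF ioM \<rho>n s] comp_assoc_state[OF \<rho>i ioH s] by simp
  qed
qed

end

section \<open>Induced interventions and the resulting abstraction\<close>

lemma intervene_simps:
  "vars (intervene M \<sigma>) = vars M" "ins (intervene M \<sigma>) = ins M" "outs (intervene M \<sigma>) = outs M"
  "ob (intervene M \<sigma>) = ob M" "nin (intervene M \<sigma>) = nin M"
  "tens C (intervene M \<sigma>) = tens C M" "margs C (intervene M \<sigma>) = margs C M"
  "split_in C (intervene M \<sigma>) = split_in C M"
  by (simp_all add: intervene_def nin_def tens_def[abs_def] margs_def[abs_def] split_in_def)

lemma intervene_trivial: "trivial \<sigma> \<Longrightarrow> intervene M \<sigma> = M"
  by (simp add: intervene_def trivial_def)

text \<open>Mechanisms left alone by the induced intervention agree in both models by its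
  definition. Equal input sets give agreement outside \<open>nin W\<close> too, where
  \<open>chan_model\<close> uses fixed dummy values, so the records are equal.\<close>

lemma intervene_ind_intervention:
  assumes "chan_ins C W (conj_chan C \<rho> M) = ins W"
    and "chan_ins C W (conj_chan C \<rho> (intervene M \<sigma>)) = ins W"
  shows "intervene (ind_model C W \<rho> M) (ind_intervention C W \<rho> M \<sigma>) =
    ind_model C W \<rho> (intervene M \<sigma>)"
  using assms
  by (auto simp: intervene_def ind_intervention_def Let_def ind_model_def chan_model_def nin_def
    fun_eq_iff
      intro!: causal_model.equality)

text \<open>The bijection rests on names, which are distinct in \<I> and kept by
  \<open>\<rho>hat\<close>. The clause on \<open>new_mech\<close> therefore records separately which
  interventions become identified once names are dropped.\<close>

theorem proposition43:
  fixes C :: "('o, 'm) markov_data"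
    and M :: "('v::linorder, 'o, 'm) causal_model"
    and \<I> :: "('s, 'v, 'm) intervention set"
    and W :: "('w::linorder, 'o) variables"
    and \<rho> \<rho>in \<rho>nin :: 'm
  assumes "markov_category C"
    and "enough_states C"
    and "is_causal_model C M"
    and "deterministic_model C M"
    and "outs M = nin M"
    and "\<forall>X\<in>vars M. hom C (unit_obj C) (ob M X) \<noteq> {}"
    and "intervention_set C M \<I>"
    and "\<exists>\<sigma>\<in>\<I>. trivial \<sigma>"
    and "is_variables C W"
    and "outs W = nin W"
    and "det_iso C M W \<rho>"
    and "respects_set C W \<rho> \<I> M"
    and "decomposes C M W \<rho> \<rho>in \<rho>nin"
  shows "let H = ind_model C W \<rho> M;
             \<rho>hat = (ind_intervention C W \<rho> M :: ('s, 'v, 'm) intervention \<Rightarrow> ('s, 'w, 'm) intervention)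
         in is_causal_model C H \<and> deterministic_model C H \<and>
            (\<forall>\<sigma>\<in>\<I>. intervene H (\<rho>hat \<sigma>) = ind_model C W \<rho> (intervene M \<sigma>)) \<and>
            intervention_set C H (\<rho>hat ` \<I>) \<and>
            upward_abstraction C (io_sig C \<I> M) (io_sig C (\<rho>hat ` \<I>) H)
              (\<lambda>t. case t of In \<Rightarrow> \<rho>in | Out \<Rightarrow> \<rho>nin)
              (\<lambda>\<sigma>. if \<sigma> \<in> \<I> then Some (\<rho>hat \<sigma>) else None) \<and>
            bij_betw \<rho>hat \<I> (\<rho>hat ` \<I>) \<and>
            (\<forall>\<sigma>\<in>\<I>. \<forall>\<sigma>'\<in>\<I>.
               new_mech (\<rho>hat \<sigma>) = new_mech (\<rho>hat \<sigma>') \<longleftrightarrow>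
               par C (intervene M \<sigma>) = par C (intervene M \<sigma>')) \<and>
            (\<forall>\<sigma>\<in>\<I>. \<rho>nin \<cdot>\<^bsub>C\<^esub> io C (intervene M \<sigma>) = io C (intervene H (\<rho>hat \<sigma>)) \<cdot>\<^bsub>C\<^esub> \<rho>in) \<and>
            \<rho>nin \<cdot>\<^bsub>C\<^esub> io C M = io C H \<cdot>\<^bsub>C\<^esub> \<rho>in"
proof -
  let ?H = "ind_model C W \<rho> M"
  let ?h = "ind_intervention C W \<rho> M :: ('s, 'v, 'm) intervention \<Rightarrow> ('s, 'w, 'm) intervention"
  interpret states_category C
    using assms(1,2) by (simp add: states_category_def states_category_axioms_def)
  note M = assms(3,4) and outs = assms(5) and W = assms(9) and \<rho> = assms(11) and dec = assms(13)
  have V: "is_variables C M"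
    using causal_modelD(1)[OF M(1)] .
  define d where "d X = (SOME x. x \<in> sharp_states C (ob M X))" for X
  \<comment> \<open>The given states need not be sharp; \<open>sharp_state_exists\<close> replaces
    them by sharp ones.\<close>
  have d: "\<forall>X\<in>vars M. d X \<in> sharp_states C (ob M X)"
    unfolding d_def using sharp_state_exists assms(6) by (auto simp: some_in_eq)
  have \<rho>i: "\<rho>in \<in> hom C (tens C M (ins M)) (tens C W (ins W))" "iso C \<rho>in"
    and \<rho>n: "\<rho>nin \<in> hom C (tens C M (nin M)) (tens C W (nin W))" "iso C \<rho>nin"
    using dec by (simp_all add: decomposes_def)
  have M\<sigma>: "is_causal_model C (intervene M \<sigma>)" "deterministic_model C (intervene M \<sigma>)"
    "respects_model C W \<rho> (intervene M \<sigma>)" if "\<sigma> \<in> \<I>" for \<sigma>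
    using assms(7,12) that by (auto simp: intervention_set_def is_intervention_def respects_set_def)
  \<comment> \<open>Interventions leave variables, objects and inputs unchanged, so one and the same
    pair \<open>\<rho>in\<close>, \<open>\<rho>nin\<close> serves every intervened model.\<close>
  have dec\<sigma>: "decomposes C (intervene M \<sigma>) W \<rho> \<rho>in \<rho>nin"
    and \<rho>\<sigma>: "det_iso C (intervene M \<sigma>) W \<rho>" for \<sigma> :: "('s, 'v, 'm) intervention"
    using dec \<rho> by (simp_all add: decomposes_def det_iso_def intervene_simps)
  have d\<sigma>: "\<forall>X\<in>vars (intervene M \<sigma>). d X \<in> sharp_states C (ob (intervene M \<sigma>) X)"
    for \<sigma> :: "('s, 'v, 'm) intervention"
    using d by (simp add: intervene_simps)
  \<comment> \<open>The trivial intervention contributes the model \<open>M\<close> itself, so that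
    \<open>?H\<close> is well-behaved.\<close>
  have resp: "respects_model C W \<rho> M"
    using assms(8) M\<sigma>(3) intervene_trivial by metis
  note H = ind_model_props[OF M d W resp]
  have int: "intervene ?H (?h \<sigma>) = ind_model C W \<rho> (intervene M \<sigma>)" if "\<sigma> \<in> \<I>" for \<sigma>
    using resp M\<sigma>(3)[OF that] by (intro intervene_ind_intervention) (simp_all add:
      respects_model_def)
  note H\<sigma> = ind_model_props[OF M\<sigma>(1) M\<sigma>(2) d\<sigma> W M\<sigma>(3)]
  have inj: "inj_on ?h \<I>" "inj_on name (?h ` \<I>)"
    using assms(7) by (auto simp: intervention_set_def inj_on_def ind_intervention_def Let_def)
  have set: "intervention_set C ?H (?h ` \<I>)"
    unfolding intervention_set_def
  proof (intro conjI ballI inj(2))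
    fix \<sigma>' assume "\<sigma>' \<in> ?h ` \<I>"
    then obtain \<sigma> where \<sigma>: "\<sigma> \<in> \<I>" "\<sigma>' = ?h \<sigma>"
      by blast
    have "dom (new_mech (?h \<sigma>)) \<subseteq> nin W"
      by (auto simp: ind_intervention_def Let_def split: if_splits)
    then show "is_intervention C ?H \<sigma>'"
      unfolding is_intervention_def \<sigma>(2) int[OF \<sigma>(1)] H(7) using H\<sigma>(1,2)[OF \<sigma>(1)] \<sigma>(1) by blast
  qed
  have io: "\<rho>nin \<cdot>\<^bsub>C\<^esub> io C (intervene M \<sigma>) = io C (intervene ?H (?h \<sigma>)) \<cdot>\<^bsub>C\<^esub> \<rho>in" if "\<sigma> \<in> \<I>" for \<sigma>
    unfolding int[OF that] using outs
    by (intro ind_model_io[OF M\<sigma>(1,2)[OF that] _ d\<sigma> W M\<sigma>(3)[OF that] dec\<sigma>])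
      (simp add: intervene_simps)
  have up: "upward_abstraction C (io_sig C \<I> M) (io_sig C (?h ` \<I>) ?H)
      (\<lambda>t. case t of In \<Rightarrow> \<rho>in | Out \<Rightarrow> \<rho>nin) (\<lambda>\<sigma>. if \<sigma> \<in> \<I> then Some (?h \<sigma>) else None)"
  proof -
    have iso: "iso C (case t of In \<Rightarrow> \<rho>in | Out \<Rightarrow> \<rho>nin)" for t
      using \<rho>i(2) \<rho>n(2) by (cases t) simp_all
    \<comment> \<open>Epimorphisms need not be stable under tensoring, but isomorphisms are.\<close>
    have "epic C (big_tens_arr C (map (\<lambda>t. case t of In \<Rightarrow> \<rho>in | Out \<Rightarrow> \<rho>nin) ts))" for ts
      using iso by (intro iso_epic iso_big_tens) auto
    moreover have "(case t of In \<Rightarrow> \<rho>in | Out \<Rightarrow> \<rho>nin) \<in> hom C (sem_type (io_sig C \<I> M) t) (sem_type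
      (io_sig C (?h ` \<I>) ?H) t)
        \<and> deterministic C (case t of In \<Rightarrow> \<rho>in | Out \<Rightarrow> \<rho>nin)" for t
      using \<rho>i(1) \<rho>n(1) outs decomposes_det[OF V W d \<rho> dec] by (cases t) (simp_all add: io_sig_def
        H)
    moreover have "ran (\<lambda>\<sigma>. if \<sigma> \<in> \<I> then Some (?h \<sigma>) else None) = ?h ` \<I>"
      by (auto simp: ran_def)
    ultimately show ?thesis
      unfolding upward_abstraction_def using iso_epic[OF iso] io
      by (auto simp: io_sig_def split: if_splits)
  qed
  have par: "new_mech (?h \<sigma>) = new_mech (?h \<sigma>') \<longleftrightarrow> par C (intervene M \<sigma>) = par C (intervene M \<sigma>')"
    if \<sigma>: "\<sigma> \<in> \<I>" and \<sigma>': "\<sigma>' \<in> \<I>" for \<sigma> \<sigma>'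
  proof
    assume "new_mech (?h \<sigma>) = new_mech (?h \<sigma>')"
    then have "intervene ?H (?h \<sigma>) = intervene ?H (?h \<sigma>')"
      by (simp add: intervene_def)
    \<comment> \<open>Equal mechanisms give equal induced models, and \<open>par\<close> recovers
      from each of these its conjugated channel.\<close>
    then have "conj_chan C \<rho> (intervene M \<sigma>) = conj_chan C \<rho> (intervene M \<sigma>')"
      using H\<sigma>(3)[OF \<sigma> \<sigma> \<sigma>] H\<sigma>(3)[OF \<sigma>' \<sigma>' \<sigma>'] int[OF \<sigma>] int[OF \<sigma>'] by simp
    then show "par C (intervene M \<sigma>) = par C (intervene M \<sigma>')"
      by (rule conj_chan_inject[OF M\<sigma>(1,2)[OF \<sigma>] \<rho>\<sigma> M\<sigma>(1,2)[OF \<sigma>'] \<rho>\<sigma>])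
  next
    assume "par C (intervene M \<sigma>) = par C (intervene M \<sigma>')"
    then show "new_mech (?h \<sigma>) = new_mech (?h \<sigma>')"
      by (simp add: ind_intervention_def Let_def ind_model_def conj_chan_def)
  qed
  show ?thesis
    unfolding Let_def
    using H(1,2) int set up inj(1) par io ind_model_io[OF M outs d W resp dec]
    by (auto simp: bij_betw_def)
qed

end
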